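(* Assume $T$ is NIP. Let $A\subseteq\mathcal U$ be a small set, $a\in\mathcal U$ a tuple and $p(x)=\operatorname{tp}(a/A)$. Then there is a partial type $\pi(x)$, generically stable over $A$, with $\pi(x)|_A\subseteq p(x)$, such that the following holds: whenever $(A,a)\prec(A',a)$ is an $|A|^+$-saturated elementary extension and $q(y)$ is a global type finitely satisfiable in $A$, the set $\operatorname{tp}_x(a/A')\cup(\pi\otimes q)|_{A'}(x,y)$ implies the complete type $(q\otimes p)(y,x)|_A$.
   Context: $T$ is a complete first-order theory in a language $L$; $\mathcal U$ is a monster model ($\bar\kappa$-saturated and $\bar\kappa$-strongly homogeneous for a large $\bar\kappa$), and all parameter sets are small (of size $<\bar\kappa$). $T$ is NIP if no formula has the independence property. A partial type $\pi(x)$ is a consistent set of formulas with parameters in $\mathcal U$, closed under finite conjunctions and logical consequence; for a set $B$, $\pi|_B$ (or $\pi|B$) is the set of formulas in $\pi$ with parameters in $B$; $a\models\pi|_B$ iff some global extension of $\operatorname{tp}(a/B)$ contains $\pi$. $\pi$ is Ind-definable over $A$ if for every $L$-formula $\phi(x;y)$ the set $\{b:\phi(x;b)\in\pi\}$ is a union of $A$-definable sets (this implies $\pi$ is $A$-invariant). $\pi$ is generically stable over $A$ if it is Ind-definable over $A$ and: whenever $(a_k:k<\omega)$ satisfies $a_k\models\pi|_{Aa_{<k}}$ for all $k$ and $\phi(x;b)\in\pi$, then $\models\phi(a_k;b)$ for all but finitely many $k$. For $A$ a set and $a$ a tuple, $(A,a)$ denotes the structure with universe $A$ having, for each $L$-formula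 $\phi(\bar x;y)$, a predicate interpreted as $\{\bar b\in A:\ \models\phi(\bar b;a)\}$; any elementary extension can be taken of the form $(A',a)$ with $A\subseteq A'\subseteq\mathcal U$. A global type $q$ is finitely satisfiable in $A$ if every formula of $q$ is satisfied by a tuple from $A$; such $q$ is $A$-invariant. If $\pi(x)$ is Ind-definable over $A$ and $q(y)$ is a global $A$-invariant type, $(\pi\otimes q)(x,y)$ is the partial type generated by $q(y)$ together with all formulas $d\phi(y,c)\to\phi(x;y,c)$ for $c\in\mathcal U$, where $\phi(x;y,z)\in L(A)$ and $d\phi(y,z)\in L(A)$ are such that $\phi(x;b,c')\in\pi$ for all $(b,c')\models d\phi$; equivalently $(a,b)$ realizes it iff $b\models q$ and $a\models\pi|_{\mathcal U b}$. For $q$ a global $A$-invariant type and $p$ a type over $A$, $(q\otimes p)(y,x)|_A=\operatorname{tp}(b,a'/A)$ where $a'\models p$ and $b\models q|_{Aa'}$. *)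

theory Defs
  imports Main
begin

unbundle cardinal_syntax

section \<open>First-order languages, structures and satisfaction\<close>

record ('f, 'r) lang =
  Fsyms :: "'f set"
  farity :: "'f \<Rightarrow> nat"
  Rsyms :: "'r set"
  rarity :: "'r \<Rightarrow> nat"

datatype 'f trm = Var nat | Fn 'f "'f trm list"

datatype ('f, 'r) fm =
    Fls
  | Eq "'f trm" "'f trm"
  | Rel 'r "'f trm list"
  | Imp "('f, 'r) fm" "('f, 'r) fm"
  | All nat "('f, 'r) fm"

abbreviation Neg :: "('f, 'r) fm \<Rightarrow> ('f, 'r) fm" where
  "Neg \<phi> \<equiv> Imp \<phi> Fls"

fun wf_trm :: "('f, 'r) lang \<Rightarrow> 'f trm \<Rightarrow> bool" where
  "wf_trm L (Var i) = True"
| "wf_trm L (Fn f ts) = (f \<in> Fsyms L \<and> length ts = farity L f \<and> (\<forall>t\<in>set ts. wf_trm L t))"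

fun wf_fm :: "('f, 'r) lang \<Rightarrow> ('f, 'r) fm \<Rightarrow> bool" where
  "wf_fm L Fls = True"
| "wf_fm L (Eq s t) = (wf_trm L s \<and> wf_trm L t)"
| "wf_fm L (Rel r ts) = (r \<in> Rsyms L \<and> length ts = rarity L r \<and> (\<forall>t\<in>set ts. wf_trm L t))"
| "wf_fm L (Imp \<phi> \<psi>) = (wf_fm L \<phi> \<and> wf_fm L \<psi>)"
| "wf_fm L (All i \<phi>) = wf_fm L \<phi>"

fun fv_trm :: "'f trm \<Rightarrow> nat set" where
  "fv_trm (Var i) = {i}"
| "fv_trm (Fn f ts) = (\<Union>t\<in>set ts. fv_trm t)"

fun fv :: "('f, 'r) fm \<Rightarrow> nat set" where
  "fv Fls = {}"
| "fv (Eq s t) = fv_trm s \<union> fv_trm t"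
| "fv (Rel r ts) = (\<Union>t\<in>set ts. fv_trm t)"
| "fv (Imp \<phi> \<psi>) = fv \<phi> \<union> fv \<psi>"
| "fv (All i \<phi>) = fv \<phi> - {i}"

definition forms :: "('f, 'r) lang \<Rightarrow> nat \<Rightarrow> ('f, 'r) fm set" where
  "forms L n = {\<phi>. wf_fm L \<phi> \<and> fv \<phi> \<subseteq> {..<n}}"

definition tuples :: "'u set \<Rightarrow> nat \<Rightarrow> 'u list set" where
  "tuples B n = {as. set as \<subseteq> B \<and> length as = n}"

record ('f, 'r, 'u) struct =
  Dom :: "'u set"
  fint :: "'f \<Rightarrow> 'u list \<Rightarrow> 'u"
  rint :: "'r \<Rightarrow> 'u list \<Rightarrow> bool"

text \<open>The empty universe is allowed here, because the pair \<open>(A, a)\<close> below may have \<open>A = {}\<close>;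
  models of a theory are required to be nonempty in the definition of \<open>monster\<close>.\<close>

definition is_structure :: "('f, 'r) lang \<Rightarrow> ('f, 'r, 'u) struct \<Rightarrow> bool" where
  "is_structure L M \<longleftrightarrow>
     (\<forall>f\<in>Fsyms L. \<forall>as\<in>tuples (Dom M) (farity L f). fint M f as \<in> Dom M)"

fun eval_trm :: "('f, 'r, 'u) struct \<Rightarrow> (nat \<Rightarrow> 'u) \<Rightarrow> 'f trm \<Rightarrow> 'u" where
  "eval_trm M v (Var i) = v i"
| "eval_trm M v (Fn f ts) = fint M f (map (eval_trm M v) ts)"

fun sat :: "('f, 'r, 'u) struct \<Rightarrow> (nat \<Rightarrow> 'u) \<Rightarrow> ('f, 'r) fm \<Rightarrow> bool" where
  "sat M v Fls = False"
| "sat M v (Eq s t) = (eval_trm M v s = eval_trm M v t)"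
| "sat M v (Rel r ts) = rint M r (map (eval_trm M v) ts)"
| "sat M v (Imp \<phi> \<psi>) = (sat M v \<phi> \<longrightarrow> sat M v \<psi>)"
| "sat M v (All i \<phi>) = (\<forall>x\<in>Dom M. sat M (v(i := x)) \<phi>)"

text \<open>\<open>M \<Turnstile> \<phi>(as)\<close>, where \<open>\<phi>\<close> has its free variables below \<open>length as\<close>.  The values of \<open>(!) as\<close>
  beyond the end of the list are irrelevant for such formulas.\<close>

definition holds :: "('f, 'r, 'u) struct \<Rightarrow> ('f, 'r) fm \<Rightarrow> 'u list \<Rightarrow> bool" where
  "holds M \<phi> as \<longleftrightarrow> sat M ((!) as) \<phi>"

text \<open>Renaming of all variables, bound ones included.  It is correct for injective renamings only.\<close>

fun rename_trm :: "(nat \<Rightarrow> nat) \<Rightarrow> 'f trm \<Rightarrow> 'f trm" where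
  "rename_trm \<rho> (Var i) = Var (\<rho> i)"
| "rename_trm \<rho> (Fn f ts) = Fn f (map (rename_trm \<rho>) ts)"

fun rename :: "(nat \<Rightarrow> nat) \<Rightarrow> ('f, 'r) fm \<Rightarrow> ('f, 'r) fm" where
  "rename \<rho> Fls = Fls"
| "rename \<rho> (Eq s t) = Eq (rename_trm \<rho> s) (rename_trm \<rho> t)"
| "rename \<rho> (Rel r ts) = Rel r (map (rename_trm \<rho>) ts)"
| "rename \<rho> (Imp \<phi> \<psi>) = Imp (rename \<rho> \<phi>) (rename \<rho> \<psi>)"
| "rename \<rho> (All i \<phi>) = All (\<rho> i) (rename \<rho> \<phi>)"

abbreviation shift :: "nat \<Rightarrow> ('f, 'r) fm \<Rightarrow> ('f, 'r) fm" where
  "shift k \<equiv> rename ((+) k)"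


section \<open>Formulas with parameters and types\<close>

text \<open>A formula \<open>\<phi>(x; b)\<close> with \<open>x\<close> an \<open>n\<close>-tuple of variables is the pair \<open>(\<phi>, b)\<close>: the variables
  \<open>0, \<dots>, n - 1\<close> of \<open>\<phi>\<close> stand for \<open>x\<close>, the variables from \<open>n\<close> on for the parameter tuple \<open>b\<close>.\<close>

type_synonym ('f, 'r, 'u) pfm = "('f, 'r) fm \<times> 'u list"

definition pforms :: "('f, 'r) lang \<Rightarrow> nat \<Rightarrow> 'u set \<Rightarrow> ('f, 'r, 'u) pfm set" where
  "pforms L n B = {(\<phi>, b). set b \<subseteq> B \<and> \<phi> \<in> forms L (n + length b)}"

definition psat :: "('f, 'r, 'u) struct \<Rightarrow> 'u list \<Rightarrow> ('f, 'r, 'u) pfm \<Rightarrow> bool" where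
  "psat M as \<theta> \<longleftrightarrow> holds M (fst \<theta>) (as @ snd \<theta>)"

definition realizes ::
    "('f, 'r, 'u) struct \<Rightarrow> nat \<Rightarrow> ('f, 'r, 'u) pfm set \<Rightarrow> 'u list \<Rightarrow> bool" where
  "realizes M n \<Sigma> as \<longleftrightarrow> as \<in> tuples (Dom M) n \<and> (\<forall>\<theta>\<in>\<Sigma>. psat M as \<theta>)"

definition consistent :: "('f, 'r, 'u) struct \<Rightarrow> nat \<Rightarrow> ('f, 'r, 'u) pfm set \<Rightarrow> bool" where
  "consistent M n \<Sigma> \<longleftrightarrow> (\<forall>F. finite F \<and> F \<subseteq> \<Sigma> \<longrightarrow> (\<exists>as. realizes M n F as))"

text \<open>Closure of a set of formulas over \<open>M\<close> under finite conjunctions and logical consequence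
  (modulo the elementary diagram of \<open>M\<close>).\<close>

definition generated ::
    "('f, 'r) lang \<Rightarrow> ('f, 'r, 'u) struct \<Rightarrow> nat \<Rightarrow> ('f, 'r, 'u) pfm set \<Rightarrow> ('f, 'r, 'u) pfm set" where
  "generated L M n \<Sigma> = {\<theta> \<in> pforms L n (Dom M).
     \<exists>F. finite F \<and> F \<subseteq> \<Sigma> \<and> (\<forall>as. realizes M n F as \<longrightarrow> psat M as \<theta>)}"

definition partial_type ::
    "('f, 'r) lang \<Rightarrow> ('f, 'r, 'u) struct \<Rightarrow> nat \<Rightarrow> ('f, 'r, 'u) pfm set \<Rightarrow> bool" where
  "partial_type L M n \<pi> \<longleftrightarrow>
     \<pi> \<subseteq> pforms L n (Dom M) \<and> consistent M n \<pi> \<and> generated L M n \<pi> \<subseteq> \<pi>"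

definition global_type ::
    "('f, 'r) lang \<Rightarrow> ('f, 'r, 'u) struct \<Rightarrow> nat \<Rightarrow> ('f, 'r, 'u) pfm set \<Rightarrow> bool" where
  "global_type L M n q \<longleftrightarrow>
     q \<subseteq> pforms L n (Dom M) \<and> consistent M n q \<and>
     (\<forall>(\<phi>, b) \<in> pforms L n (Dom M). (\<phi>, b) \<in> q \<or> (Neg \<phi>, b) \<in> q)"

definition tp ::
    "('f, 'r) lang \<Rightarrow> ('f, 'r, 'u) struct \<Rightarrow> 'u set \<Rightarrow> 'u list \<Rightarrow> ('f, 'r, 'u) pfm set" where
  "tp L M B as = {\<theta> \<in> pforms L (length as) B. psat M as \<theta>}"

definition restr :: "('f, 'r, 'u) pfm set \<Rightarrow> 'u set \<Rightarrow> ('f, 'r, 'u) pfm set"  (infixl "\<restriction>\<restriction>" 110) where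
  "\<pi> \<restriction>\<restriction> B = {(\<phi>, b) \<in> \<pi>. set b \<subseteq> B}"

definition fin_satisfiable_in ::
    "('f, 'r, 'u) struct \<Rightarrow> nat \<Rightarrow> 'u set \<Rightarrow> ('f, 'r, 'u) pfm set \<Rightarrow> bool" where
  "fin_satisfiable_in M n A q \<longleftrightarrow> (\<forall>\<theta>\<in>q. \<exists>as\<in>tuples A n. psat M as \<theta>)"

lemma eval_trm_cong:
  "(\<And>i. i \<in> fv_trm t \<Longrightarrow> v i = w i) \<Longrightarrow> eval_trm M v t = eval_trm M w t"
proof (induction t)
  case (Fn f ts)
  then have "map (eval_trm M v) ts = map (eval_trm M w) ts" by fastforce
  then show ?case by (simp only: eval_trm.simps)
qed simp

lemma sat_cong:
  "(\<And>i. i \<in> fv \<phi> \<Longrightarrow> v i = w i) \<Longrightarrow> sat M v \<phi> = sat M w \<phi>"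
proof (induction \<phi> arbitrary: v w)
  case (Eq s t)
  then show ?case using eval_trm_cong[of s v w M] eval_trm_cong[of t v w M] by simp
next
  case (Rel r ts)
  then have "map (eval_trm M v) ts = map (eval_trm M w) ts" by (auto intro!: eval_trm_cong)
  then show ?case by (simp only: sat.simps)
next
  case (Imp \<phi> \<psi>)
  have "sat M v \<phi> = sat M w \<phi>" "sat M v \<psi> = sat M w \<psi>" using Imp.prems by (auto intro!: Imp.IH)
  then show ?case by simp
next
  case (All i \<phi>)
  have "sat M (v(i := x)) \<phi> = sat M (w(i := x)) \<phi>" for x
    using All.prems by (intro All.IH) auto
  then show ?case by simp
qed simp

lemma eval_trm_rename: "eval_trm M v (rename_trm \<rho> t) = eval_trm M (\<lambda>i. v (\<rho> i)) t"
proof (induction t)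
  case (Fn f ts)
  then have "map (eval_trm M v \<circ> rename_trm \<rho>) ts = map (eval_trm M (\<lambda>i. v (\<rho> i))) ts" by simp
  then show ?case by (simp only: eval_trm.simps rename_trm.simps map_map)
qed simp

lemma sat_rename: "inj \<rho> \<Longrightarrow> sat M v (rename \<rho> \<phi>) = sat M (\<lambda>i. v (\<rho> i)) \<phi>"
proof (induction \<phi> arbitrary: v)
  case (Rel r ts)
  have "map (eval_trm M v \<circ> rename_trm \<rho>) ts = map (eval_trm M (\<lambda>i. v (\<rho> i))) ts"
    by (simp add: eval_trm_rename)
  then show ?case by (simp only: rename.simps sat.simps map_map)
next
  case (All i \<phi>)
  have "(\<lambda>j. (v(\<rho> i := x)) (\<rho> j)) = (\<lambda>j. v (\<rho> j))(i := x)" for x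
    using All.prems by (auto simp: fun_eq_iff inj_eq)
  then show ?case by (simp only: rename.simps sat.simps All.IH[OF All.prems])
qed (simp_all add: eval_trm_rename)

lemma fv_trm_rename: "fv_trm (rename_trm \<rho> t) = \<rho> ` fv_trm t"
  by (induction t) auto

lemma fv_rename: "inj \<rho> \<Longrightarrow> fv (rename \<rho> \<phi>) = \<rho> ` fv \<phi>"
  by (induction \<phi>) (auto simp: fv_trm_rename inj_eq)

lemma wf_trm_rename: "wf_trm L (rename_trm \<rho> t) = wf_trm L t"
  by (induction t) auto

lemma wf_fm_rename: "wf_fm L (rename \<rho> \<phi>) = wf_fm L \<phi>"
  by (induction \<phi>) (auto simp: wf_trm_rename)

lemma pforms_Conj:
  assumes "\<theta> \<in> pforms L n B" "\<eta> \<in> pforms L n B"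
  obtains \<chi> where "\<chi> \<in> pforms L n B"
    "\<And>M as. as \<in> tuples (Dom M) n \<Longrightarrow> psat M as \<chi> \<longleftrightarrow> psat M as \<theta> \<and> psat M as \<eta>"
proof -
  obtain \<phi> b \<psi> c where e: "\<theta> = (\<phi>, b)" "\<eta> = (\<psi>, c)" by fastforce
  define \<rho> where "\<rho> i = (if i < n then i else i + length b)" for i
  have inj: "inj \<rho>" by (auto simp: inj_def \<rho>_def split: if_splits)
  define \<chi> where "\<chi> = (Neg (Imp \<phi> (Neg (rename \<rho> \<psi>))), b @ c)"
  have f: "fv \<phi> \<subseteq> {..<n + length b}" "fv \<psi> \<subseteq> {..<n + length c}"
    using assms by (auto simp: e pforms_def forms_def)
  have "\<rho> ` fv \<psi> \<subseteq> {..<n + (length b + length c)}"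
    using f(2) by (auto simp: \<rho>_def)
  then have 1: "\<chi> \<in> pforms L n B"
    using assms f by (auto simp: e pforms_def forms_def \<chi>_def fv_rename[OF inj] wf_fm_rename)
  have 2: "psat M as \<chi> \<longleftrightarrow> psat M as \<theta> \<and> psat M as \<eta>" if "as \<in> tuples (Dom M) n" for M as
  proof -
    have l: "length as = n" using that by (simp add: tuples_def)
    have "sat M ((!) (as @ b @ c)) \<phi> = sat M ((!) (as @ b)) \<phi>"
      using f(1) l by (intro sat_cong) (auto simp: nth_append)
    moreover have "sat M ((!) (as @ b @ c)) (rename \<rho> \<psi>) = sat M ((!) (as @ c)) \<psi>"
      unfolding sat_rename[OF inj]
      using f(2) l by (intro sat_cong) (auto simp: nth_append \<rho>_def)
    ultimately show ?thesis by (simp add: psat_def holds_def \<chi>_def e)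
  qed
  show ?thesis using that 1 2 by blast
qed

lemma pforms_Conj_finite:
  assumes "finite F" "F \<subseteq> pforms L n B"
  shows "\<exists>\<chi>\<in>pforms L n B. \<forall>M. \<forall>as\<in>tuples (Dom M) n. psat M as \<chi> \<longleftrightarrow> (\<forall>\<theta>\<in>F. psat M as \<theta>)"
  using assms
proof (induction F rule: finite_induct)
  case empty
  show ?case
    by (rule bexI[of _ "(Neg Fls, [])"]) (auto simp: pforms_def forms_def psat_def holds_def)
next
  case (insert \<eta> F)
  then obtain \<chi> where \<chi>: "\<chi> \<in> pforms L n B"
    "\<And>M as. as \<in> tuples (Dom M) n \<Longrightarrow> psat M as \<chi> \<longleftrightarrow> (\<forall>\<theta>\<in>F. psat M as \<theta>)" by auto
  from insert.prems have "\<eta> \<in> pforms L n B" by simp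
  from pforms_Conj[OF this \<chi>(1)] obtain \<zeta> where "\<zeta> \<in> pforms L n B"
    "\<And>M as. as \<in> tuples (Dom M) n \<Longrightarrow> psat M as \<zeta> \<longleftrightarrow> psat M as \<eta> \<and> psat M as \<chi>" by metis
  then show ?case using \<chi>(2) by (auto intro!: bexI[of _ \<zeta>])
qed

lemma consistent_extends_to_global_type:
  assumes "\<Sigma> \<subseteq> pforms L n (Dom M)" "consistent M n \<Sigma>"
  shows "\<exists>r. global_type L M n r \<and> \<Sigma> \<subseteq> r"
proof -
  define \<A> where "\<A> = {X. X \<subseteq> pforms L n (Dom M) \<and> consistent M n (\<Sigma> \<union> X)}"
  have "\<Union>C \<in> \<A>" if C: "subset.chain \<A> C" for C
  proof -
    have sub: "C \<subseteq> \<A>" using C by (simp add: subset.chain_def)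
    have "\<exists>as. realizes M n F as" if F: "finite F" "F \<subseteq> \<Sigma> \<union> \<Union>C" for F
    proof (cases "C = {}")
      case True
      then show ?thesis using F assms(2) by (auto simp: consistent_def)
    next
      case False
      have "finite (F - \<Sigma>)" "F - \<Sigma> \<subseteq> \<Union>C" using F by auto
      then obtain X where X: "X \<in> C" "F - \<Sigma> \<subseteq> X"
        using finite_subset_Union_chain[OF _ _ False C] by metis
      then have "consistent M n (\<Sigma> \<union> X)" using sub by (auto simp: \<A>_def)
      moreover have "F \<subseteq> \<Sigma> \<union> X" using X by auto
      ultimately show ?thesis using F(1) by (auto simp: consistent_def)
    qed
    then show ?thesis using sub by (auto simp: \<A>_def consistent_def)
  qed
  from subset_Zorn'[OF this] obtain r where r: "r \<in> \<A>"
    and max: "\<And>X. X \<in> \<A> \<Longrightarrow> r \<subseteq> X \<Longrightarrow> X = r" by blast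
  have con: "consistent M n (\<Sigma> \<union> r)" and rsub: "r \<subseteq> pforms L n (Dom M)"
    using r by (auto simp: \<A>_def)
  have "\<Sigma> \<union> r \<in> \<A>" using con rsub assms(1) by (auto simp: \<A>_def Un_assoc[symmetric])
  then have sr: "\<Sigma> \<subseteq> r" using max by blast
  then have conr: "consistent M n r" using con by (simp add: Un_absorb1)
  have step: "\<exists>F. finite F \<and> F \<subseteq> r \<and> (\<forall>as. realizes M n F as \<longrightarrow> \<not> psat M as \<theta>)"
    if "\<theta> \<in> pforms L n (Dom M)" "\<theta> \<notin> r" for \<theta>
  proof -
    have "insert \<theta> r \<notin> \<A>" using max[of "insert \<theta> r"] that(2) by blast
    then have "\<not> consistent M n (insert \<theta> r)"
      using that(1) rsub sr by (auto simp: \<A>_def Un_absorb1 insert_absorb)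
    then obtain F where F: "finite F" "F \<subseteq> insert \<theta> r" "\<nexists>as. realizes M n F as"
      by (auto simp: consistent_def)
    have "\<not> psat M as \<theta>" if "realizes M n (F - {\<theta>}) as" for as
      using F(3) that by (auto simp: realizes_def)
    then show ?thesis using F by (intro exI[of _ "F - {\<theta>}"]) auto
  qed
  have "(\<phi>, b) \<in> r \<or> (Neg \<phi>, b) \<in> r" if p: "(\<phi>, b) \<in> pforms L n (Dom M)" for \<phi> b
  proof (rule ccontr)
    assume n: "\<not> ?thesis"
    have "(Neg \<phi>, b) \<in> pforms L n (Dom M)" using p by (auto simp: pforms_def forms_def)
    from step[OF this] step[OF p] n obtain F G where
      "finite F" "F \<subseteq> r" "\<And>as. realizes M n F as \<Longrightarrow> \<not> psat M as (\<phi>, b)"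
      "finite G" "G \<subseteq> r" "\<And>as. realizes M n G as \<Longrightarrow> \<not> psat M as (Neg \<phi>, b)" by metis
    moreover from this conr obtain as where "realizes M n (F \<union> G) as"
      by (auto simp: consistent_def)
    moreover from this have "realizes M n F as" "realizes M n G as" by (auto simp: realizes_def)
    ultimately have "\<not> psat M as (\<phi>, b)" "\<not> psat M as (Neg \<phi>, b)" by blast+
    then show False by (simp add: psat_def holds_def)
  qed
  then show ?thesis using conr rsub sr by (auto simp: global_type_def)
qed

text \<open>For a partial type \<open>\<pi>\<close> and \<open>B \<subseteq> Dom M\<close>, realizing \<open>\<pi>|\<^sub>B\<close>, that is, satisfying all
  formulas in it, amounts to \<open>tp(a/B)\<close> having a global extension that contains \<open>\<pi>\<close>.\<close>

lemma realizes_restr_iff: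
  assumes \<pi>: "partial_type L M n \<pi>" and B: "B \<subseteq> Dom M" and as: "as \<in> tuples (Dom M) n"
  shows "realizes M n (\<pi> \<restriction>\<restriction> B) as \<longleftrightarrow> (\<exists>r. global_type L M n r \<and> tp L M B as \<subseteq> r \<and> \<pi> \<subseteq> r)"
proof
  assume "\<exists>r. global_type L M n r \<and> tp L M B as \<subseteq> r \<and> \<pi> \<subseteq> r"
  then obtain r where r: "global_type L M n r" "tp L M B as \<subseteq> r" "\<pi> \<subseteq> r" by blast
  have "psat M as (\<phi>, b)" if pb: "(\<phi>, b) \<in> \<pi>" "set b \<subseteq> B" for \<phi> b
  proof (rule ccontr)
    assume "\<not> psat M as (\<phi>, b)"
    moreover have "(\<phi>, b) \<in> pforms L n (Dom M)" using \<pi> pb by (auto simp: partial_type_def)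
    ultimately have "(Neg \<phi>, b) \<in> tp L M B as"
      using pb as by (auto simp: tp_def pforms_def forms_def tuples_def psat_def holds_def)
    then have "{(\<phi>, b), (Neg \<phi>, b)} \<subseteq> r" using r pb by blast
    moreover have "consistent M n r" using r by (simp add: global_type_def)
    ultimately obtain cs where "realizes M n {(\<phi>, b), (Neg \<phi>, b)} cs"
      unfolding consistent_def by (meson finite.emptyI finite_insert)
    then show False by (auto simp: realizes_def psat_def holds_def)
  qed
  then show "realizes M n (\<pi> \<restriction>\<restriction> B) as" using as by (auto simp: realizes_def restr_def)
next
  assume re: "realizes M n (\<pi> \<restriction>\<restriction> B) as"
  have l: "length as = n" using as by (simp add: tuples_def)
  have "\<exists>cs. realizes M n F cs" if F: "finite F" "F \<subseteq> \<pi> \<union> tp L M B as" for F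
  proof (rule ccontr)
    assume no: "\<nexists>cs. realizes M n F cs"
    have "finite (F \<inter> tp L M B as)" "F \<inter> tp L M B as \<subseteq> pforms L n B"
      using F l by (auto simp: tp_def)
    from pforms_Conj_finite[OF this] obtain \<chi> where \<chi>: "\<chi> \<in> pforms L n B"
      "\<And>cs. cs \<in> tuples (Dom M) n \<Longrightarrow> psat M cs \<chi> \<longleftrightarrow> (\<forall>\<theta>\<in>F \<inter> tp L M B as. psat M cs \<theta>)"
      by blast
    obtain \<psi> d where \<psi>: "\<chi> = (\<psi>, d)" by fastforce
    have d: "set d \<subseteq> B" using \<chi>(1) by (auto simp: \<psi> pforms_def)
    have "(Neg \<psi>, d) \<in> generated L M n \<pi>"
      unfolding generated_def mem_Collect_eq
    proof (intro conjI exI[of _ "F \<inter> \<pi>"] allI impI)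
      show "(Neg \<psi>, d) \<in> pforms L n (Dom M)"
        using \<chi>(1) B by (auto simp: \<psi> pforms_def forms_def)
      fix cs assume c: "realizes M n (F \<inter> \<pi>) cs"
      then have t: "cs \<in> tuples (Dom M) n" by (simp add: realizes_def)
      obtain \<theta> where "\<theta> \<in> F" "\<not> psat M cs \<theta>" using no t by (auto simp: realizes_def)
      moreover from this have "\<theta> \<notin> F \<inter> \<pi>" using c by (auto simp: realizes_def)
      ultimately have "\<not> psat M cs \<chi>" using F(2) \<chi>(2)[OF t] by blast
      then show "psat M cs (Neg \<psi>, d)" by (simp add: \<psi> psat_def holds_def)
    qed (use F in auto)
    then have "(Neg \<psi>, d) \<in> \<pi> \<restriction>\<restriction> B" using \<pi> d by (auto simp: partial_type_def restr_def)
    then have "\<not> psat M as \<chi>" using re by (auto simp: realizes_def \<psi> psat_def holds_def)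
    then show False using \<chi>(2)[OF as] by (auto simp: tp_def)
  qed
  then have "consistent M n (\<pi> \<union> tp L M B as)" by (simp add: consistent_def)
  moreover have "\<pi> \<union> tp L M B as \<subseteq> pforms L n (Dom M)"
    using \<pi> B l by (auto simp: partial_type_def tp_def pforms_def)
  ultimately show "\<exists>r. global_type L M n r \<and> tp L M B as \<subseteq> r \<and> \<pi> \<subseteq> r"
    using consistent_extends_to_global_type by (metis Un_subset_iff)
qed


section \<open>Monster models and NIP\<close>

text \<open>Cardinals are cardinal orders in the sense of the HOL library.\<close>

definition saturated :: "('f, 'r) lang \<Rightarrow> 'k rel \<Rightarrow> ('f, 'r, 'u) struct \<Rightarrow> bool" where
  "saturated L \<kappa> M \<longleftrightarrow>
     (\<forall>B n \<Sigma>. B \<subseteq> Dom M \<and> |B| <o \<kappa> \<and> \<Sigma> \<subseteq> pforms L n B \<and> consistent M n \<Sigma>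
        \<longrightarrow> (\<exists>as. realizes M n \<Sigma> as))"

definition automorphism :: "('f, 'r) lang \<Rightarrow> ('f, 'r, 'u) struct \<Rightarrow> ('u \<Rightarrow> 'u) \<Rightarrow> bool" where
  "automorphism L M \<sigma> \<longleftrightarrow>
     bij_betw \<sigma> (Dom M) (Dom M) \<and>
     (\<forall>f\<in>Fsyms L. \<forall>as\<in>tuples (Dom M) (farity L f). \<sigma> (fint M f as) = fint M f (map \<sigma> as)) \<and>
     (\<forall>r\<in>Rsyms L. \<forall>as\<in>tuples (Dom M) (rarity L r). rint M r as \<longleftrightarrow> rint M r (map \<sigma> as))"

definition partial_elementary ::
    "('f, 'r) lang \<Rightarrow> ('f, 'r, 'u) struct \<Rightarrow> 'u set \<Rightarrow> ('u \<Rightarrow> 'u) \<Rightarrow> bool" where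
  "partial_elementary L M B f \<longleftrightarrow>
     f ` B \<subseteq> Dom M \<and>
     (\<forall>n. \<forall>\<phi>\<in>forms L n. \<forall>bs\<in>tuples B n. holds M \<phi> bs \<longleftrightarrow> holds M \<phi> (map f bs))"

definition strongly_homogeneous :: "('f, 'r) lang \<Rightarrow> 'k rel \<Rightarrow> ('f, 'r, 'u) struct \<Rightarrow> bool" where
  "strongly_homogeneous L \<kappa> M \<longleftrightarrow>
     (\<forall>B f. B \<subseteq> Dom M \<and> |B| <o \<kappa> \<and> partial_elementary L M B f
        \<longrightarrow> (\<exists>\<sigma>. automorphism L M \<sigma> \<and> (\<forall>b\<in>B. \<sigma> b = f b)))"

text \<open>Theories are deductively closed, so a complete theory contains exactly one of
  \<open>\<phi>\<close>, \<open>\<not> \<phi>\<close> for each sentence \<open>\<phi>\<close>; its consistency comes from the monster model.\<close>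

definition complete_theory :: "('f, 'r) lang \<Rightarrow> ('f, 'r) fm set \<Rightarrow> bool" where
  "complete_theory L T \<longleftrightarrow> T \<subseteq> forms L 0 \<and> (\<forall>\<phi>\<in>forms L 0. \<phi> \<in> T \<longleftrightarrow> Neg \<phi> \<notin> T)"

text \<open>The cardinal \<open>\<kappa>\<close> is large in the sense that it exceeds the number of formulas of the
  language, which is \<open>|L| + \<aleph>\<^sub>0\<close>; in particular \<open>\<kappa>\<close> is uncountable.\<close>

definition monster ::
    "('f, 'r) lang \<Rightarrow> ('f, 'r) fm set \<Rightarrow> 'k rel \<Rightarrow> ('f, 'r, 'u) struct \<Rightarrow> bool" where
  "monster L T \<kappa> U \<longleftrightarrow>
     is_structure L U \<and> Dom U \<noteq> {} \<and> (\<forall>\<phi>\<in>T. holds U \<phi> []) \<and>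
     Card_order \<kappa> \<and> |{\<phi>. wf_fm L \<phi>}| <o \<kappa> \<and>
     saturated L \<kappa> U \<and> strongly_homogeneous L \<kappa> U"

text \<open>The independence property of \<open>\<phi>(x; y)\<close> with \<open>|x| = n\<close>, \<open>|y| = m\<close>, witnessed in the
  monster model: some infinite sequence of \<open>n\<close>-tuples has all its subsets cut out by \<open>\<phi>\<close>.\<close>

definition has_IP :: "('f, 'r, 'u) struct \<Rightarrow> nat \<Rightarrow> nat \<Rightarrow> ('f, 'r) fm \<Rightarrow> bool" where
  "has_IP U n m \<phi> \<longleftrightarrow>
     (\<exists>(a :: nat \<Rightarrow> 'u list) (b :: nat set \<Rightarrow> 'u list).
        (\<forall>i. a i \<in> tuples (Dom U) n) \<and> (\<forall>I. b I \<in> tuples (Dom U) m) \<and>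
        (\<forall>i I. holds U \<phi> (a i @ b I) \<longleftrightarrow> i \<in> I))"

definition NIP :: "('f, 'r) lang \<Rightarrow> ('f, 'r, 'u) struct \<Rightarrow> bool" where
  "NIP L U \<longleftrightarrow> (\<forall>n m. \<forall>\<phi>\<in>forms L (n + m). \<not> has_IP U n m \<phi>)"


section \<open>Generically stable partial types\<close>

definition definable_over ::
    "('f, 'r) lang \<Rightarrow> ('f, 'r, 'u) struct \<Rightarrow> 'u set \<Rightarrow> nat \<Rightarrow> 'u list set \<Rightarrow> bool" where
  "definable_over L U A m D \<longleftrightarrow>
     (\<exists>\<theta>\<in>pforms L m A. D = {b \<in> tuples (Dom U) m. psat U b \<theta>})"

definition Ind_definable ::
    "('f, 'r) lang \<Rightarrow> ('f, 'r, 'u) struct \<Rightarrow> nat \<Rightarrow> 'u set \<Rightarrow> ('f, 'r, 'u) pfm set \<Rightarrow> bool" where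
  "Ind_definable L U n A \<pi> \<longleftrightarrow>
     (\<forall>m. \<forall>\<phi>\<in>forms L (n + m). \<exists>\<D>. (\<forall>D\<in>\<D>. definable_over L U A m D) \<and>
        {b \<in> tuples (Dom U) m. (\<phi>, b) \<in> \<pi>} = \<Union>\<D>)"

definition generically_stable ::
    "('f, 'r) lang \<Rightarrow> ('f, 'r, 'u) struct \<Rightarrow> nat \<Rightarrow> 'u set \<Rightarrow> ('f, 'r, 'u) pfm set \<Rightarrow> bool" where
  "generically_stable L U n A \<pi> \<longleftrightarrow>
     partial_type L U n \<pi> \<and> Ind_definable L U n A \<pi> \<and>
     (\<forall>a. (\<forall>k::nat. realizes U n (\<pi> \<restriction>\<restriction> (A \<union> (\<Union>j<k. set (a j)))) (a k))
        \<longrightarrow> (\<forall>\<theta>\<in>\<pi>. finite {k. \<not> psat U (a k) \<theta>}))"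


section \<open>The products\<close>

text \<open>The partial type \<open>(\<pi> \<otimes> q)(x, y)\<close> with \<open>|x| = n\<close>, \<open>|y| = m\<close>.  Its variables are
  \<open>0, \<dots>, n - 1\<close> for \<open>x\<close> and \<open>n, \<dots>, n + m - 1\<close> for \<open>y\<close>, so formulas in \<open>y\<close> alone are shifted
  by \<open>n\<close>.  The \<open>L(A)\<close>-formulas \<open>\<phi>(x; y, z)\<close> and \<open>d\<phi>(y, z)\<close> are given by \<open>L\<close>-formulas \<open>\<phi>\<close>, \<open>\<psi>\<close>
  together with one tuple \<open>e\<close> containing the parameters of both.\<close>

definition tensor_generators ::
    "('f, 'r) lang \<Rightarrow> ('f, 'r, 'u) struct \<Rightarrow> 'u set \<Rightarrow> nat \<Rightarrow> nat \<Rightarrow>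
     ('f, 'r, 'u) pfm set \<Rightarrow> ('f, 'r, 'u) pfm set \<Rightarrow> ('f, 'r, 'u) pfm set" where
  "tensor_generators L U A n m \<pi> q =
     {(shift n \<psi>, d) |\<psi> d. (\<psi>, d) \<in> q} \<union>
     {(Imp (shift n \<psi>) \<phi>, c @ e) |\<phi> \<psi> c e.
        set c \<subseteq> Dom U \<and> set e \<subseteq> A \<and>
        \<phi> \<in> forms L (n + m + length c + length e) \<and>
        \<psi> \<in> forms L (m + length c + length e) \<and>
        (\<forall>b\<in>tuples (Dom U) m. \<forall>c'\<in>tuples (Dom U) (length c).
           holds U \<psi> (b @ c' @ e) \<longrightarrow> (\<phi>, b @ c' @ e) \<in> \<pi>)}"

definition tensor ::
    "('f, 'r) lang \<Rightarrow> ('f, 'r, 'u) struct \<Rightarrow> 'u set \<Rightarrow> nat \<Rightarrow> nat \<Rightarrow>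
     ('f, 'r, 'u) pfm set \<Rightarrow> ('f, 'r, 'u) pfm set \<Rightarrow> ('f, 'r, 'u) pfm set" where
  "tensor L U A n m \<pi> q = generated L U (n + m) (tensor_generators L U A n m \<pi> q)"

text \<open>The complete type \<open>(q \<otimes> p)(y, x)|\<^sub>A\<close> for \<open>q\<close> global and \<open>A\<close>-invariant in \<open>m\<close> variables and \<open>p\<close> over \<open>A\<close>
  in \<open>n\<close> variables.  By invariance the type of \<open>(b, a')\<close> over \<open>A\<close> is the same for all pairs as below.\<close>

definition tensor_over ::
    "('f, 'r) lang \<Rightarrow> ('f, 'r, 'u) struct \<Rightarrow> 'u set \<Rightarrow> nat \<Rightarrow> nat \<Rightarrow>
     ('f, 'r, 'u) pfm set \<Rightarrow> ('f, 'r, 'u) pfm set \<Rightarrow> ('f, 'r, 'u) pfm set" where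
  "tensor_over L U A m n q p =
     \<Union>{tp L U A (b @ a') |a' b. realizes U n p a' \<and> realizes U m (q \<restriction>\<restriction> (A \<union> set a')) b}"


section \<open>The pair \<open>(A, a)\<close>\<close>

text \<open>The language of \<open>(A, a)\<close> for a \<open>k\<close>-tuple \<open>a\<close> has an \<open>l\<close>-ary relation symbol \<open>(l, \<phi>)\<close> for each
  \<open>L\<close>-formula \<open>\<phi>(x; y)\<close> with \<open>|x| = l\<close>, \<open>|y| = k\<close>, and no function symbols.\<close>

definition pair_lang :: "('f, 'r) lang \<Rightarrow> nat \<Rightarrow> ('f, nat \<times> ('f, 'r) fm) lang" where
  "pair_lang L k = \<lparr>Fsyms = {}, farity = (\<lambda>_. 0),
     Rsyms = {(l, \<phi>). \<phi> \<in> forms L (l + k)}, rarity = fst\<rparr>"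

definition pair_struct ::
    "('f, 'r, 'u) struct \<Rightarrow> 'u set \<Rightarrow> 'u list \<Rightarrow> ('f, nat \<times> ('f, 'r) fm, 'u) struct" where
  "pair_struct U A a = \<lparr>Dom = A, fint = (\<lambda>_ _. undefined),
     rint = (\<lambda>(l, \<phi>) b. holds U \<phi> (b @ a))\<rparr>"

definition elementary_extension ::
    "('f, 'r) lang \<Rightarrow> ('f, 'r, 'u) struct \<Rightarrow> ('f, 'r, 'u) struct \<Rightarrow> bool" where
  "elementary_extension L M N \<longleftrightarrow>
     is_structure L M \<and> is_structure L N \<and> Dom M \<subseteq> Dom N \<and>
     (\<forall>n. \<forall>\<phi>\<in>forms L n. \<forall>as\<in>tuples (Dom M) n. holds M \<phi> as \<longleftrightarrow> holds N \<phi> as)"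

end

theory Submission
  imports Defs "HOL-Library.Infinite_Set"
begin

text \<open>An ultrafilter on the tuples of \<open>A\<close> stands for a global type that is finitely satisfiable in
  \<open>A\<close>.  Suppose that \<open>\<not> X(a; b)\<close> for \<open>E\<close>-most \<open>b\<close>.  By NIP no \<open>x\<close> makes \<open>X(x; \<cdot>)\<close> alternate too often
  along a typical sequence for \<open>E\<close>.  For the largest number \<open>k\<close> of alternations that \<open>a\<close> still realizes
  coherently with every other ultrafilter, the failure at \<open>k + 1\<close> yields
  formulas \<open>g(x, t)\<close> and \<open>I(x, z)\<close>, with \<open>t\<close> and \<open>z\<close> ranging over ultrafilters on \<open>A\<close>, such that
  \<open>g(a, t)\<close> holds generically, \<open>I(a, z)\<close> is coherent with the ultrafilter \<open>G\<close> of \<open>z\<close>, and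
  \<open>\<Theta>(b, t; z) = \<exists>x (X(x; b) \<and> g(x, t) \<and> I(x, z))\<close> is generically false, whichever of \<open>(b, t)\<close> and \<open>z\<close>
  is chosen first.  The type \<open>\<pi>\<close> consists of \<open>tp(a/A)\<close> and all formulas \<open>\<not> (X(x; b) \<and> g(x, t))\<close> for
  which \<open>\<Theta>(b, t; v\<^sub>j)\<close> fails for all \<open>j < K\<close>, where \<open>v\<close> is a suitable \<open>K\<close>-tuple from \<open>A\<close> that is typical for \<open>G\<close>
  and \<open>K\<close> bounds the alternation of \<open>\<Theta>\<close> along \<open>G\<close>.

  This condition on \<open>(b, t)\<close> is a formula over \<open>A\<close>, so \<open>\<pi>\<close> is Ind-definable.  If \<open>K\<close> members of a Morley
  sequence of \<open>\<pi>\<close> satisfied \<open>X(x; b) \<and> g(x, t)\<close>, they could be matched through \<open>I\<close> with tuples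
  \<open>c\<^sub>0, \<dots>, c\<^sub>K\<^sub>-\<^sub>1\<close> for which \<open>\<Theta>(b, t; \<cdot>)\<close> alternates \<open>K\<close> times along \<open>c\<^sub>0, v\<^sub>0, c\<^sub>1, v\<^sub>1, \<dots>\<close>; this is
  impossible.  The same argument, with generic realizations of an ultrafilter extending \<open>tp(a/A)\<close> instead of a
  Morley sequence, shows that \<open>\<pi>\<close> is consistent.  Finally, if \<open>E\<close> comes from \<open>q\<close>, then saturation of the
  pair gives \<open>t\<close> in \<open>A'\<close> with \<open>g(a, t)\<close> such that \<open>\<pi> \<otimes> q\<close> contains \<open>\<not> (X(x; y) \<and> g(x, t))\<close>; as
  \<open>tp(a/A')\<close> contains \<open>g(x, t)\<close>, the formula \<open>\<not> X(x; y)\<close> is implied.\<close>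

section \<open>Ultrafilters on tuples\<close>

text \<open>Ultrafilters are kept as library filters, so that membership of a formula in the
  corresponding type is just \<open>eventually\<close>.\<close>

definition ultra :: "'a filter \<Rightarrow> bool" where
  "ultra E \<longleftrightarrow> E \<noteq> bot \<and> (\<forall>P. eventually P E \<or> eventually (\<lambda>x. \<not> P x) E)"

lemma ultra_not:
  assumes "ultra E"
  shows "(\<not> eventually P E) \<longleftrightarrow> eventually (\<lambda>x. \<not> P x) E"
proof
  assume "eventually (\<lambda>x. \<not> P x) E"
  moreover have "E \<noteq> bot" using assms by (simp add: ultra_def)
  ultimately show "\<not> eventually P E"
    using eventually_conj[of P E "\<lambda>x. \<not> P x"] by (auto simp: eventually_False)
qed (use assms in \<open>auto simp: ultra_def\<close>)

lemma ultra_const: "ultra E \<Longrightarrow> eventually (\<lambda>x. P) E \<longleftrightarrow> P"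
  unfolding ultra_def by simp

lemma ultra_happens: "ultra E \<Longrightarrow> eventually P E \<Longrightarrow> \<exists>x. P x"
  unfolding ultra_def by (rule eventually_happens') auto

lemma ultra_disj:
  assumes E: "ultra E" and ev: "eventually (\<lambda>x. P x \<or> Q x) E"
  shows "eventually P E \<or> eventually Q E"
proof (rule disjCI)
  assume "\<not> eventually Q E"
  then have "eventually (\<lambda>x. \<not> Q x) E" by (simp add: ultra_not[OF E])
  with ev show "eventually P E" by eventually_elim blast
qed

lemma ultra_Bex_finite:
  assumes "ultra E" "finite J" "eventually (\<lambda>x. \<exists>t\<in>J. P t x) E"
  shows "\<exists>t\<in>J. eventually (P t) E"
  using assms(2,3)
proof (induction J rule: finite_induct)
  case empty
  then show ?case using assms(1) by (simp add: ultra_def)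
next
  case (insert t J)
  from insert.prems have "eventually (\<lambda>x. P t x \<or> (\<exists>t\<in>J. P t x)) E" by simp
  from ultra_disj[OF assms(1) this] insert.IH show ?case by blast
qed

text \<open>Zorn's lemma is applied to the families of eventual predicates of the proper filters
  below \<open>F\<close>, ordered by inclusion. The union of a chain of such families is again one,
  and a maximal family decides every predicate.\<close>

lemma ultra_exists:
  assumes "F \<noteq> bot"
  shows "\<exists>E. E \<le> F \<and> ultra E"
proof -
  define \<A> where "\<A> = {X. \<exists>E. E \<noteq> bot \<and> E \<le> F \<and> X = {P. eventually P E}}"
  have "\<exists>M\<in>\<A>. \<forall>X\<in>\<A>. M \<subseteq> X \<longrightarrow> X = M"
  proof (rule subset_Zorn_nonempty)
    show "\<A> \<noteq> {}" using assms by (auto simp: \<A>_def)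
    fix C assume C: "C \<noteq> {}" "subset.chain \<A> C"
    have flt: "\<exists>E. E \<noteq> bot \<and> E \<le> F \<and> X = {P. eventually P E}" if "X \<in> C" for X
      using C(2) that by (auto simp: subset.chain_def \<A>_def)
    have ch: "X \<subseteq> Y \<or> Y \<subseteq> X" if "X \<in> C" "Y \<in> C" for X Y
      using C(2) that by (auto simp: subset.chain_def)
    have isf: "is_filter (\<lambda>P. P \<in> \<Union>C)"
    proof (rule is_filter.intro)
      obtain X where "X \<in> C" using C(1) by blast
      moreover from flt[OF this] have "(\<lambda>x. True) \<in> X" by auto
      ultimately show "(\<lambda>x. True) \<in> \<Union>C" by blast
    next
      fix P Q assume "P \<in> \<Union>C" "Q \<in> \<Union>C"
      then obtain X where "X \<in> C" "P \<in> X" "Q \<in> X" using ch by blast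
      from flt[OF \<open>X \<in> C\<close>] obtain E where "X = {P. eventually P E}" by blast
      with \<open>P \<in> X\<close> \<open>Q \<in> X\<close> have "(\<lambda>x. P x \<and> Q x) \<in> X" by (simp add: eventually_conj)
      then show "(\<lambda>x. P x \<and> Q x) \<in> \<Union>C" using \<open>X \<in> C\<close> by blast
    next
      fix P Q :: "'a \<Rightarrow> bool" assume PQ: "\<forall>x. P x \<longrightarrow> Q x" "P \<in> \<Union>C"
      then obtain X where X: "X \<in> C" "P \<in> X" by blast
      from flt[OF X(1)] obtain E where "X = {P. eventually P E}" by blast
      with X(2) PQ(1) have "Q \<in> X" using eventually_mono[of P E Q] by simp
      then show "Q \<in> \<Union>C" using X(1) by blast
    qed
    define E where "E = Abs_filter (\<lambda>P. P \<in> \<Union>C)"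
    have ev: "eventually P E \<longleftrightarrow> P \<in> \<Union>C" for P
      unfolding E_def using eventually_Abs_filter[OF isf] .
    have "E \<noteq> bot"
    proof
      assume "E = bot"
      then have "(\<lambda>x. False) \<in> \<Union>C" using ev[of "\<lambda>x. False"] by simp
      then obtain X where "X \<in> C" "(\<lambda>x. False) \<in> X" by blast
      then show False using flt[of X] by (auto simp: eventually_False)
    qed
    moreover have "E \<le> F"
    proof (rule filter_leI)
      fix P assume "eventually P F"
      moreover obtain X where X: "X \<in> C" using C(1) by blast
      moreover from flt[OF X] obtain E' where "E' \<le> F" "X = {P. eventually P E'}" by blast
      ultimately have "P \<in> X" by (simp add: filter_leD)
      then show "eventually P E" using X ev by blast
    qed
    moreover have "\<Union>C = {P. eventually P E}" using ev by blast
    ultimately show "\<Union>C \<in> \<A>" unfolding \<A>_def by blast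
  qed
  then obtain M where M: "M \<in> \<A>" "\<And>X. X \<in> \<A> \<Longrightarrow> M \<subseteq> X \<Longrightarrow> X = M" by blast
  then obtain E where E: "E \<noteq> bot" "E \<le> F" "M = {P. eventually P E}" by (auto simp: \<A>_def)
  have "eventually P E \<or> eventually (\<lambda>x. \<not> P x) E" for P
  proof (rule ccontr)
    assume n: "\<not> ?thesis"
    \<comment> \<open>Adjoining \<open>P\<close> keeps the filter proper because
      \<open>\<not> P\<close> is not eventual in \<open>E\<close>; maximality then makes
      \<open>P\<close> eventual already.\<close>
    define E' where "E' = inf E (principal {x. P x})"
    have "E' \<noteq> bot"
      using n by (auto simp: E'_def trivial_limit_def eventually_inf_principal)
    moreover have "E' \<le> F" using E(2) by (simp add: E'_def le_infI1)
    ultimately have "{P. eventually P E'} \<in> \<A>" by (auto simp: \<A>_def)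
    moreover have "M \<subseteq> {P. eventually P E'}"
    proof
      fix Q assume "Q \<in> M"
      then have "eventually Q E" using E(3) by simp
      then show "Q \<in> {P. eventually P E'}"
        by (simp add: E'_def eventually_inf_principal eventually_mono)
    qed
    ultimately have "{P. eventually P E'} = M" using M(2) by blast
    moreover have "eventually P E'" by (simp add: E'_def eventually_inf_principal)
    ultimately show False using n E(3) by blast
  qed
  then show ?thesis using E by (auto simp: ultra_def)
qed

text \<open>The principal filters of the given predicates have a proper infimum, since every finite
  subfamily has a common point; any ultrafilter below it works.\<close>

lemma ultra_of_fip:
  assumes "\<And>F. finite F \<Longrightarrow> F \<subseteq> \<F> \<Longrightarrow> \<exists>x. \<forall>P\<in>F. P x"
  shows "\<exists>E. ultra E \<and> (\<forall>P\<in>\<F>. eventually P E)"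
proof -
  have "(INF P\<in>\<F>. principal (Collect P)) \<noteq> bot"
  proof (rule INF_filter_not_bot)
    fix X assume X: "X \<subseteq> \<F>" "finite X"
    obtain x where "\<forall>P\<in>X. P x" using assms[OF X(2,1)] by blast
    then have "x \<in> (\<Inter>P\<in>X. Collect P)" by simp
    then show "(INF P\<in>X. principal (Collect P)) \<noteq> bot"
      unfolding INF_principal_finite[OF X(2)] principal_eq_bot_iff by blast
  qed
  then obtain E where E: "E \<le> (INF P\<in>\<F>. principal (Collect P))" "ultra E"
    using ultra_exists by blast
  have "eventually P E" if "P \<in> \<F>" for P
  proof -
    have "E \<le> principal (Collect P)" using E(1) that by (metis INF_lower order_trans)
    then show ?thesis by (simp add: le_principal)
  qed
  then show ?thesis using E(2) by blast
qed

section \<open>Iterated choice: products and powers of ultrafilters\<close>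

definition fbind :: "'a filter \<Rightarrow> ('a \<Rightarrow> 'b filter) \<Rightarrow> 'b filter" where
  "fbind E F = Abs_filter (\<lambda>P. eventually (\<lambda>s. eventually P (F s)) E)"

lemma eventually_fbind:
  fixes F :: "'a \<Rightarrow> 'b filter"
  shows "eventually P (fbind E F) \<longleftrightarrow> eventually (\<lambda>s. eventually P (F s)) E"
  unfolding fbind_def
proof (rule eventually_Abs_filter, rule is_filter.intro)
  show "eventually (\<lambda>s. eventually (\<lambda>x. True) (F s)) E" by simp
next
  fix P Q :: "'b \<Rightarrow> bool"
  assume "eventually (\<lambda>s. eventually P (F s)) E" "eventually (\<lambda>s. eventually Q (F s)) E"
  then show "eventually (\<lambda>s. eventually (\<lambda>x. P x \<and> Q x) (F s)) E"
    by eventually_elim (rule eventually_conj)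
next
  fix P Q :: "'b \<Rightarrow> bool"
  assume "\<forall>x. P x \<longrightarrow> Q x" "eventually (\<lambda>s. eventually P (F s)) E"
  then show "eventually (\<lambda>s. eventually Q (F s)) E"
    by (auto elim!: eventually_mono)
qed

lemma ultra_fbind:
  assumes "ultra E" "eventually (\<lambda>s. ultra (F s)) E"
  shows "ultra (fbind E F)"
  unfolding ultra_def
proof (intro conjI allI)
  show "fbind E F \<noteq> bot"
  proof
    assume "fbind E F = bot"
    then have "eventually (\<lambda>s. eventually (\<lambda>x. False) (F s)) E"
      using eventually_fbind[of "\<lambda>x. False" E F] by simp
    with assms(2) have "eventually (\<lambda>s. False) E"
      by eventually_elim (simp add: ultra_const)
    then show False using assms(1) by (simp add: ultra_const)
  qed
next
  fix P
  show "eventually P (fbind E F) \<or> eventually (\<lambda>x. \<not> P x) (fbind E F)"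
  proof (cases "eventually (\<lambda>s. eventually P (F s)) E")
    case False
    then have "eventually (\<lambda>s. \<not> eventually P (F s)) E" using ultra_not[OF assms(1)] by blast
    with assms(2) have "eventually (\<lambda>s. eventually (\<lambda>x. \<not> P x) (F s)) E"
      by eventually_elim (simp add: ultra_not)
    then show ?thesis by (simp add: eventually_fbind)
  qed (simp add: eventually_fbind)
qed

text \<open>As a quantifier the block from \<open>E\<close> comes first. For the induced types this
  is the product in which \<open>F\<close> is realized first and \<open>E\<close> over it, which is
  why realized sequences below grow at the front.\<close>

definition fprod :: "'a list filter \<Rightarrow> 'a list filter \<Rightarrow> 'a list filter"  (infixr "\<otimes>f" 70) where
  "E \<otimes>f F = fbind E (\<lambda>s. filtermap ((@) s) F)"

lemma eventually_fprod:
  "eventually P (E \<otimes>f F) \<longleftrightarrow> eventually (\<lambda>s. eventually (\<lambda>t. P (s @ t)) F) E"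
  by (simp add: fprod_def eventually_fbind eventually_filtermap)

lemma ultra_filtermap: "ultra F \<Longrightarrow> ultra (filtermap f F)"
  unfolding ultra_def by (auto simp: eventually_filtermap filtermap_bot_iff)

lemma ultra_fprod: "ultra E \<Longrightarrow> ultra F \<Longrightarrow> ultra (E \<otimes>f F)"
  unfolding fprod_def by (intro ultra_fbind always_eventually allI ultra_filtermap)

lemma fprod_assoc: "(E \<otimes>f F) \<otimes>f G = E \<otimes>f (F \<otimes>f G)"
  by (rule filter_eqI) (simp add: eventually_fprod)

definition fnil :: "'a list filter" where "fnil = principal {[]}"

lemma eventually_fnil [simp]: "eventually P fnil \<longleftrightarrow> P []"
  by (simp add: fnil_def eventually_principal)

lemma ultra_fnil: "ultra fnil"
  by (auto simp: ultra_def trivial_limit_def)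

lemma fprod_fnil [simp]: "E \<otimes>f fnil = E" "fnil \<otimes>f E = E"
  by (rule filter_eqI, simp add: eventually_fprod)+

primrec pw :: "'a list filter \<Rightarrow> nat \<Rightarrow> 'a list filter" where
  "pw E 0 = fnil"
| "pw E (Suc k) = E \<otimes>f pw E k"

lemma ultra_pw: "ultra E \<Longrightarrow> ultra (pw E k)"
  by (induction k) (auto simp: ultra_fnil ultra_fprod)

lemma pw_Suc_right: "pw E (Suc k) = pw E k \<otimes>f E"
proof (induction k)
  case (Suc k)
  have "pw E (Suc (Suc k)) = E \<otimes>f pw E (Suc k)" by simp
  also have "\<dots> = (E \<otimes>f pw E k) \<otimes>f E" unfolding Suc.IH fprod_assoc ..
  finally show ?case by simp
qed simp

definition uf :: "'u set \<Rightarrow> nat \<Rightarrow> 'u list filter \<Rightarrow> bool" where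
  "uf A m E \<longleftrightarrow> ultra E \<and> eventually (\<lambda>t. t \<in> tuples A m) E"

lemma uf_ultra: "uf A m E \<Longrightarrow> ultra E"
  and uf_tuples: "uf A m E \<Longrightarrow> eventually (\<lambda>t. t \<in> tuples A m) E"
  by (simp_all add: uf_def)

lemma tuples_append: "s \<in> tuples B m \<Longrightarrow> t \<in> tuples B k \<Longrightarrow> s @ t \<in> tuples B (m + k)"
  by (auto simp: tuples_def)

lemma tuples_take: "v \<in> tuples B (m + k) \<Longrightarrow> take m v \<in> tuples B m"
  by (auto simp: tuples_def dest: in_set_takeD)

lemma tuples_drop: "v \<in> tuples B (m + k) \<Longrightarrow> drop m v \<in> tuples B k"
  by (auto simp: tuples_def dest: in_set_dropD)

lemma tuples_mono: "B \<subseteq> C \<Longrightarrow> tuples B m \<subseteq> tuples C m"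
  by (auto simp: tuples_def)

lemma tuples_len: "t \<in> tuples B m \<Longrightarrow> length t = m"
  by (simp add: tuples_def)

lemma tuples_0 [simp]: "tuples B 0 = {[]}"
  by (auto simp: tuples_def)

lemma uf_fnil: "uf A 0 fnil"
  by (simp add: uf_def ultra_fnil)

lemma uf_fprod: "uf A m E \<Longrightarrow> uf A k F \<Longrightarrow> uf A (m + k) (E \<otimes>f F)"
  unfolding uf_def
proof (elim conjE, intro conjI ultra_fprod)
  assume "eventually (\<lambda>t. t \<in> tuples A m) E" "eventually (\<lambda>t. t \<in> tuples A k) F"
  then show "eventually (\<lambda>t. t \<in> tuples A (m + k)) (E \<otimes>f F)"
    unfolding eventually_fprod
    by (auto intro: tuples_append elim!: eventually_mono)
qed

lemma uf_pw: "uf A m E \<Longrightarrow> uf A (k * m) (pw E k)"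
  by (induction k) (auto simp: uf_fnil uf_fprod)

lemma uf_happens: "uf A m E \<Longrightarrow> eventually P E \<Longrightarrow> \<exists>t\<in>tuples A m. P t"
  using ultra_happens[of E "\<lambda>t. t \<in> tuples A m \<and> P t"] by (auto simp: uf_def eventually_conj_iff)


section \<open>Definable predicates\<close>

text \<open>Formulas are handled through the predicates on tuples that they define; quantifiers then range over
  whole tuples and substitution is composition.  The values outside \<open>tuples (Dom U) N\<close> are irrelevant.  The
  functions in \<open>tm\<close> are the substitutions: each entry of the result is an entry of the argument or a parameter.\<close>

definition df0 :: "('f, 'r) lang \<Rightarrow> ('f, 'r, 'u) struct \<Rightarrow> nat \<Rightarrow> ('u list \<Rightarrow> bool) \<Rightarrow> bool" where
  "df0 L U N P \<longleftrightarrow> (\<exists>\<phi>\<in>forms L N. \<forall>v\<in>tuples (Dom U) N. P v \<longleftrightarrow> holds U \<phi> v)"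

lemma df0_cong:
  assumes "df0 L U N P" "\<And>v. v \<in> tuples (Dom U) N \<Longrightarrow> P v = Q v"
  shows "df0 L U N Q"
  using assms by (simp add: df0_def)

lemma df0_const: "df0 L U N (\<lambda>v. b)"
proof (cases b)
  case True
  then show ?thesis
    unfolding df0_def by (intro bexI[of _ "Neg Fls"]) (auto simp: forms_def holds_def)
next
  case False
  then show ?thesis
    unfolding df0_def by (intro bexI[of _ "Fls"]) (auto simp: forms_def holds_def)
qed

lemma df0_imp:
  assumes "df0 L U N P" "df0 L U N Q"
  shows "df0 L U N (\<lambda>v. P v \<longrightarrow> Q v)"
proof -
  obtain \<phi> \<psi> where "\<phi> \<in> forms L N" "\<psi> \<in> forms L N"
    "\<forall>v\<in>tuples (Dom U) N. P v \<longleftrightarrow> holds U \<phi> v" "\<forall>v\<in>tuples (Dom U) N. Q v \<longleftrightarrow> holds U \<psi> v"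
    using assms unfolding df0_def by blast
  then show ?thesis
    unfolding df0_def by (intro bexI[of _ "Imp \<phi> \<psi>"]) (auto simp: forms_def holds_def)
qed

lemma df0_not: "df0 L U N P \<Longrightarrow> df0 L U N (\<lambda>v. \<not> P v)"
  using df0_imp[OF _ df0_const[where b = False]] by simp

lemma df0_conj: "df0 L U N P \<Longrightarrow> df0 L U N Q \<Longrightarrow> df0 L U N (\<lambda>v. P v \<and> Q v)"
  using df0_not[OF df0_imp[of L U N P "\<lambda>v. \<not> Q v"]] by (auto simp: df0_not)

lemma df0_ex1:
  assumes "df0 L U (Suc N) P"
  shows "df0 L U N (\<lambda>v. \<exists>x\<in>Dom U. P (v @ [x]))"
proof -
  obtain \<phi> where \<phi>: "\<phi> \<in> forms L (Suc N)"
    "\<forall>v\<in>tuples (Dom U) (Suc N). P v \<longleftrightarrow> holds U \<phi> v" using assms unfolding df0_def by blast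
  define \<psi> where "\<psi> = Neg (All N (Neg \<phi>))"
  have "\<psi> \<in> forms L N" using \<phi>(1) by (auto simp: \<psi>_def forms_def less_Suc_eq)
  moreover have "(\<exists>x\<in>Dom U. P (v @ [x])) \<longleftrightarrow> holds U \<psi> v" if v: "v \<in> tuples (Dom U) N" for v
  proof -
    have "P (v @ [x]) \<longleftrightarrow> sat U (((!) v)(N := x)) \<phi>" if "x \<in> Dom U" for x
    proof -
      have "v @ [x] \<in> tuples (Dom U) (Suc N)" using v that by (auto simp: tuples_def)
      then have "P (v @ [x]) \<longleftrightarrow> sat U ((!) (v @ [x])) \<phi>" using \<phi>(2) by (simp add: holds_def)
      also have "\<dots> \<longleftrightarrow> sat U (((!) v)(N := x)) \<phi>"
        using \<phi>(1) v by (intro sat_cong) (auto simp: forms_def tuples_def nth_append less_Suc_eq)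
      finally show ?thesis .
    qed
    then show ?thesis by (auto simp: \<psi>_def holds_def)
  qed
  ultimately show ?thesis unfolding df0_def by blast
qed

lemma df0_ex:
  "df0 L U (N + k) P \<Longrightarrow> df0 L U N (\<lambda>v. \<exists>y\<in>tuples (Dom U) k. P (v @ y))"
proof (induction k arbitrary: P)
  case (Suc k)
  from Suc.prems have "df0 L U (Suc (N + k)) P" by simp
  from Suc.IH[OF df0_ex1[OF this]]
  have "df0 L U N (\<lambda>v. \<exists>y\<in>tuples (Dom U) k. \<exists>x\<in>Dom U. P ((v @ y) @ [x]))" .
  then show ?case
  proof (rule df0_cong)
    fix v
    show "(\<exists>y\<in>tuples (Dom U) k. \<exists>x\<in>Dom U. P ((v @ y) @ [x])) = (\<exists>y\<in>tuples (Dom U) (Suc k). P (v @ y))"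
      (is "?l = ?r")
    proof
      assume ?l
      then obtain y x where "y \<in> tuples (Dom U) k" "x \<in> Dom U" "P (v @ y @ [x])" by auto
      then show ?r by (intro bexI[of _ "y @ [x]"]) (auto simp: tuples_def)
    next
      assume ?r
      then obtain y where y: "y \<in> tuples (Dom U) (Suc k)" "P (v @ y)" by blast
      then have "y \<noteq> []" by (auto simp: tuples_def)
      then have "y = butlast y @ [last y]" by simp
      then obtain y' x where yx: "y = y' @ [x]" by blast
      then show ?l using y by (intro bexI[of _ y'] bexI[of _ x]) (auto simp: tuples_def)
    qed
  qed
qed simp

lemma df0_eq: "i < N \<Longrightarrow> j < N \<Longrightarrow> df0 L U N (\<lambda>v. v ! i = v ! j)"
  unfolding df0_def
  by (intro bexI[of _ "Eq (Var i) (Var j)"]) (auto simp: forms_def holds_def)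

lemma df0_drop:
  assumes "df0 L U k P"
  shows "df0 L U (N + k) (\<lambda>v. P (drop N v))"
proof -
  obtain \<phi> where \<phi>: "\<phi> \<in> forms L k"
    "\<forall>v\<in>tuples (Dom U) k. P v \<longleftrightarrow> holds U \<phi> v" using assms unfolding df0_def by blast
  have inj: "inj ((+) N)" by (simp add: inj_def)
  have "shift N \<phi> \<in> forms L (N + k)"
    using \<phi>(1) by (auto simp: forms_def fv_rename[OF inj] wf_fm_rename)
  moreover have "P (drop N v) \<longleftrightarrow> holds U (shift N \<phi>) v" if "v \<in> tuples (Dom U) (N + k)" for v
  proof -
    have "P (drop N v) \<longleftrightarrow> sat U ((!) (drop N v)) \<phi>"
      using \<phi>(2) tuples_drop[OF that] by (simp add: holds_def)
    also have "\<dots> \<longleftrightarrow> holds U (shift N \<phi>) v"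
      unfolding holds_def sat_rename[OF inj]
      using \<phi>(1) tuples_len[OF that] by (intro sat_cong) (auto simp: forms_def)
    finally show ?thesis .
  qed
  ultimately show ?thesis unfolding df0_def by blast
qed

lemma df0_Ball_less:
  "(\<And>i. i < (k::nat) \<Longrightarrow> df0 L U N (P i)) \<Longrightarrow> df0 L U N (\<lambda>v. \<forall>i<k. P i v)"
proof (induction k)
  case (Suc k)
  then have "df0 L U N (\<lambda>v. (\<forall>i<k. P i v) \<and> P k v)" by (intro df0_conj) auto
  then show ?case by (rule df0_cong) (auto simp: less_Suc_eq)
qed (simp add: df0_const)

text \<open>The list \<open>js\<close> may repeat entries, so injective renaming does not suffice.
  Instead a new tuple is quantified existentially and equated entrywise with the selected
  variables.\<close>

lemma df0_sel:
  assumes P: "df0 L U k P" and js: "length js = k" "set js \<subseteq> {..<N}"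
  shows "df0 L U N (\<lambda>v. P (map ((!) v) js))"
proof -
  have "df0 L U (N + k) (\<lambda>w. (\<forall>i<k. w ! (N + i) = w ! (js ! i)) \<and> P (drop N w))"
  proof (intro df0_conj df0_Ball_less df0_eq df0_drop[OF P])
    fix i assume "i < k"
    then have "js ! i \<in> set js" using js by simp
    then show "js ! i < N + k" using js by auto
  qed simp
  from df0_ex[OF this] show ?thesis
  proof (rule df0_cong)
    fix v assume v: "v \<in> tuples (Dom U) N"
    have eq: "(\<forall>i<k. (v @ y) ! (N + i) = (v @ y) ! (js ! i)) \<longleftrightarrow> y = map ((!) v) js"
      if "length y = k" for y
    proof -
      have "js ! i < N" if "i < k" for i using js that nth_mem by blast
      then show ?thesis using v that js
        by (auto simp: tuples_def nth_append list_eq_iff_nth_eq)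
    qed
    have m: "map ((!) v) js \<in> tuples (Dom U) k"
      using v js by (auto simp: tuples_def subset_iff)
    show "(\<exists>y\<in>tuples (Dom U) k. (\<forall>i<k. (v @ y) ! (N + i) = (v @ y) ! (js ! i)) \<and> P (drop N (v @ y)))
        = P (map ((!) v) js)"
      using m eq v by (auto simp: tuples_def)
  qed
qed

text \<open>Parameters are taken from \<open>B \<inter> Dom U\<close>, so that appending them to a
  tuple of the universe gives such a tuple again.\<close>

definition df :: "('f, 'r) lang \<Rightarrow> ('f, 'r, 'u) struct \<Rightarrow> 'u set \<Rightarrow> nat \<Rightarrow> ('u list \<Rightarrow> bool) \<Rightarrow> bool" where
  "df L U B N P \<longleftrightarrow> (\<exists>e R. set e \<subseteq> B \<inter> Dom U \<and> df0 L U (N + length e) R \<and>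
     (\<forall>v\<in>tuples (Dom U) N. P v \<longleftrightarrow> R (v @ e)))"

definition tm :: "('f, 'r, 'u) struct \<Rightarrow> 'u set \<Rightarrow> nat \<Rightarrow> nat \<Rightarrow> ('u list \<Rightarrow> 'u list) \<Rightarrow> bool" where
  "tm U B N k t \<longleftrightarrow> (\<exists>e js. set e \<subseteq> B \<inter> Dom U \<and> length js = k \<and> set js \<subseteq> {..<N + length e} \<and>
     (\<forall>v\<in>tuples (Dom U) N. t v = map ((!) (v @ e)) js))"

lemma df_cong:
  assumes "df L U B N P" "\<And>v. v \<in> tuples (Dom U) N \<Longrightarrow> P v = Q v"
  shows "df L U B N Q"
  using assms unfolding df_def by metis

lemma df_mono: "df L U B N P \<Longrightarrow> B \<subseteq> C \<Longrightarrow> df L U C N P"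
  unfolding df_def by blast

lemma df_tm:
  assumes P: "df L U B k P" and t: "tm U B N k t"
  shows "df L U B N (\<lambda>v. P (t v))"
proof -
  obtain e R where e: "set e \<subseteq> B \<inter> Dom U" "df0 L U (k + length e) R"
    "\<And>v. v \<in> tuples (Dom U) k \<Longrightarrow> P v \<longleftrightarrow> R (v @ e)" using P unfolding df_def by blast
  obtain d js where d: "set d \<subseteq> B \<inter> Dom U" "length js = k" "set js \<subseteq> {..<N + length d}"
    "\<And>v. v \<in> tuples (Dom U) N \<Longrightarrow> t v = map ((!) (v @ d)) js" using t unfolding tm_def by blast
  define js' where "js' = js @ map ((+) (N + length d)) [0..<length e]"
  have 1: "df0 L U (N + length (d @ e)) (\<lambda>w. R (map ((!) w) js'))"
    by (rule df0_sel[OF e(2)]) (use d in \<open>auto simp: js'_def\<close>)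
  show ?thesis unfolding df_def
  proof (intro exI conjI ballI)
    show "df0 L U (N + length (d @ e)) (\<lambda>w. R (map ((!) w) js'))" by (rule 1)
    show "set (d @ e) \<subseteq> B \<inter> Dom U" using d e by auto
    fix v assume v: "v \<in> tuples (Dom U) N"
    have l: "length v = N" using v by (simp add: tuples_def)
    have "set (map ((!) (v @ d)) js) \<subseteq> Dom U"
    proof -
      have "(v @ d) ! j \<in> set (v @ d)" if "j \<in> set js" for j
        using d(3) that l by (intro nth_mem) auto
      then show ?thesis using d(1) v by (auto simp: tuples_def)
    qed
    then have "t v \<in> tuples (Dom U) k" using d(2,4) v by (simp add: tuples_def)
    then have "P (t v) \<longleftrightarrow> R (t v @ e)" by (rule e(3))
    also have "t v @ e = map ((!) (v @ d @ e)) js'"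
    proof -
      have "map ((!) (v @ d)) js = map ((!) (v @ d @ e)) js"
        using d(3) l by (auto simp: nth_append)
      moreover have "map ((!) (v @ d @ e)) (map ((+) (N + length d)) [0..<length e]) = e"
        using l by (intro nth_equalityI) (auto simp: nth_append)
      ultimately show ?thesis using d(4)[OF v] by (simp add: js'_def)
    qed
    finally show "P (t v) \<longleftrightarrow> R (map ((!) (v @ d @ e)) js')" .
  qed
qed

lemma tm_id: "tm U B N N (\<lambda>v. v)"
  unfolding tm_def
  by (intro exI[of _ "[]"] exI[of _ "[0..<N]"]) (auto simp: tuples_def map_nth)

lemma tm_take_min: "tm U B N k t \<Longrightarrow> tm U B N (min k j) (\<lambda>v. take j (t v))"
  unfolding tm_def
  by (elim exE, rule_tac x=e in exI, rule_tac x="take j js" in exI)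
     (auto simp: take_map dest: in_set_takeD)

lemma tm_drop_diff: "tm U B N k t \<Longrightarrow> tm U B N (k - j) (\<lambda>v. drop j (t v))"
  unfolding tm_def
  by (elim exE, rule_tac x=e in exI, rule_tac x="drop j js" in exI)
     (auto simp: drop_map dest: in_set_dropD)

lemma tm_take: "tm U B N k t \<Longrightarrow> j \<le> k \<Longrightarrow> tm U B N j (\<lambda>v. take j (t v))"
  using tm_take_min[of U B N k t j] by (simp add: min_absorb2)

lemma tm_drop: "tm U B N (j + k) t \<Longrightarrow> tm U B N k (\<lambda>v. drop j (t v))"
  using tm_drop_diff[of U B N "j + k" t j] by simp

lemma tm_const: "e \<in> tuples B k \<Longrightarrow> e \<in> tuples (Dom U) k \<Longrightarrow> tm U B N k (\<lambda>v. e)"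
  unfolding tm_def
  by (intro exI[of _ e] exI[of _ "map ((+) N) [0..<length e]"])
     (auto simp: tuples_def nth_append intro!: nth_equalityI)

lemma tm_append:
  assumes "tm U B N k s" "tm U B N l t"
  shows "tm U B N (k + l) (\<lambda>v. s v @ t v)"
proof -
  obtain d js where d: "set d \<subseteq> B \<inter> Dom U" "length js = k" "set js \<subseteq> {..<N + length d}"
    "\<And>v. v \<in> tuples (Dom U) N \<Longrightarrow> s v = map ((!) (v @ d)) js"
    using assms(1) unfolding tm_def by blast
  obtain e is2 where e: "set e \<subseteq> B \<inter> Dom U" "length is2 = l" "set is2 \<subseteq> {..<N + length e}"
    "\<And>v. v \<in> tuples (Dom U) N \<Longrightarrow> t v = map ((!) (v @ e)) is2"
    using assms(2) unfolding tm_def by blast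
  define g where "g i = (if i < N then i else i + length d)" for i
  show ?thesis unfolding tm_def
  proof (intro exI conjI ballI)
    show "set (d @ e) \<subseteq> B \<inter> Dom U" using d e by auto
    show "length (js @ map g is2) = k + l" using d e by simp
    show "set (js @ map g is2) \<subseteq> {..<N + length (d @ e)}" using d(3) e(3) by (auto simp: g_def)
    fix v assume v: "v \<in> tuples (Dom U) N"
    then have l: "length v = N" by (simp add: tuples_def)
    have "map ((!) (v @ d)) js = map ((!) (v @ d @ e)) js"
      using d(3) l by (auto simp: nth_append)
    moreover have "map ((!) (v @ e)) is2 = map ((!) (v @ d @ e)) (map g is2)"
      using l by (auto simp: nth_append g_def)
    ultimately show "s v @ t v = map ((!) (v @ d @ e)) (js @ map g is2)"
      using d(4)[OF v] e(4)[OF v] by simp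
  qed
qed

text \<open>These rules compute the length of a selection from its syntax; \<open>tm_eq\<close> then
  leaves a single arithmetic goal. Most definability proofs below end in this way.\<close>

lemmas tm_intros = tm_append tm_take_min tm_drop_diff tm_id

lemma tm_eq: "tm U B N k t \<Longrightarrow> k = l \<Longrightarrow> tm U B N l t"
  by simp

lemma df_imp:
  assumes "df L U B N P" "df L U B N Q"
  shows "df L U B N (\<lambda>v. P v \<longrightarrow> Q v)"
proof -
  obtain d R where d: "set d \<subseteq> B \<inter> Dom U" "df0 L U (N + length d) R"
    "\<And>v. v \<in> tuples (Dom U) N \<Longrightarrow> P v \<longleftrightarrow> R (v @ d)" using assms(1) unfolding df_def by blast
  obtain e S where e: "set e \<subseteq> B \<inter> Dom U" "df0 L U (N + length e) S"
    "\<And>v. v \<in> tuples (Dom U) N \<Longrightarrow> Q v \<longleftrightarrow> S (v @ e)" using assms(2) unfolding df_def by blast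
  define js where "js = [0..<N + length d]"
  define is2 where "is2 = [0..<N] @ map ((+) (N + length d)) [0..<length e]"
  have 1: "df0 L U (N + length (d @ e)) (\<lambda>w. R (map ((!) w) js) \<longrightarrow> S (map ((!) w) is2))"
    by (intro df0_imp df0_sel[OF d(2)] df0_sel[OF e(2)]) (auto simp: js_def is2_def)
  show ?thesis unfolding df_def
  proof (intro exI conjI ballI)
    show "set (d @ e) \<subseteq> B \<inter> Dom U" using d e by auto
    show "df0 L U (N + length (d @ e)) (\<lambda>w. R (map ((!) w) js) \<longrightarrow> S (map ((!) w) is2))" by (rule 1)
    fix v assume v: "v \<in> tuples (Dom U) N"
    then have l: "length v = N" by (simp add: tuples_def)
    have "map ((!) (v @ d @ e)) js = v @ d"
      using l by (intro nth_equalityI) (auto simp: js_def nth_append)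
    moreover have "map ((!) (v @ d @ e)) is2 = v @ e"
      using l by (intro nth_equalityI) (auto simp: is2_def nth_append)
    ultimately show "(P v \<longrightarrow> Q v) = (R (map ((!) (v @ d @ e)) js) \<longrightarrow> S (map ((!) (v @ d @ e)) is2))"
      using d(3)[OF v] e(3)[OF v] by simp
  qed
qed

lemma df_const: "df L U B N (\<lambda>v. b)"
  unfolding df_def by (intro exI[of _ "[]"] exI[of _ "\<lambda>v. b"]) (simp add: df0_const)

lemma df_not: "df L U B N P \<Longrightarrow> df L U B N (\<lambda>v. \<not> P v)"
  using df_imp[OF _ df_const[where b = False]] by simp

lemma df_conj: "df L U B N P \<Longrightarrow> df L U B N Q \<Longrightarrow> df L U B N (\<lambda>v. P v \<and> Q v)"
  using df_not[OF df_imp[of L U B N P "\<lambda>v. \<not> Q v"]] by (auto simp: df_not)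

lemma df_ex:
  assumes "df L U B (N + k) (\<lambda>w. Q (take N w) (drop N w))"
  shows "df L U B N (\<lambda>v. \<exists>y\<in>tuples (Dom U) k. Q v y)"
proof -
  obtain e R where e: "set e \<subseteq> B \<inter> Dom U" "df0 L U (N + k + length e) R"
    "\<And>v. v \<in> tuples (Dom U) (N + k) \<Longrightarrow> Q (take N v) (drop N v) \<longleftrightarrow> R (v @ e)"
    using assms unfolding df_def by blast
  \<comment> \<open>The quantified block must come last for \<open>df0_ex\<close>, behind the
    parameters \<open>e\<close>, so the variables are permuted first.\<close>
  define js where "js = [0..<N] @ map ((+) (N + length e)) [0..<k] @ map ((+) N) [0..<length e]"
  have "df0 L U (N + length e + k) (\<lambda>w. R (map ((!) w) js))"
    by (intro df0_sel[OF e(2)]) (auto simp: js_def)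
  from df0_ex[OF this]
  have 1: "df0 L U (N + length e) (\<lambda>v. \<exists>y\<in>tuples (Dom U) k. R (map ((!) (v @ y)) js))" .
  show ?thesis unfolding df_def
  proof (intro exI conjI ballI)
    show "set e \<subseteq> B \<inter> Dom U" by (rule e(1))
    show "df0 L U (N + length e) (\<lambda>v. \<exists>y\<in>tuples (Dom U) k. R (map ((!) (v @ y)) js))" by (rule 1)
    fix v assume v: "v \<in> tuples (Dom U) N"
    then have l: "length v = N" by (simp add: tuples_def)
    show "(\<exists>y\<in>tuples (Dom U) k. Q v y) = (\<exists>y\<in>tuples (Dom U) k. R (map ((!) ((v @ e) @ y)) js))"
    proof (rule bex_cong[OF refl])
      fix y assume y: "y \<in> tuples (Dom U) k"
      have "map ((!) ((v @ e) @ y)) js = (v @ y) @ e"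
        using l tuples_len[OF y] by (intro nth_equalityI) (auto simp: js_def nth_append add.commute)
      then show "Q v y = R (map ((!) ((v @ e) @ y)) js)"
        using e(3)[OF tuples_append[OF v y]] l by simp
    qed
  qed
qed

lemma df_all:
  assumes "df L U B (N + k) (\<lambda>w. Q (take N w) (drop N w))"
  shows "df L U B N (\<lambda>v. \<forall>y\<in>tuples (Dom U) k. Q v y)"
  using df_not[OF df_ex[of L U B N k "\<lambda>v y. \<not> Q v y", OF df_not[OF assms]]] by simp

lemma df_Ball_less:
  "(\<And>i. i < (k::nat) \<Longrightarrow> df L U B N (P i)) \<Longrightarrow> df L U B N (\<lambda>v. \<forall>i<k. P i v)"
proof (induction k)
  case (Suc k)
  then have "df L U B N (\<lambda>v. (\<forall>i<k. P i v) \<and> P k v)" by (intro df_conj) auto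
  then show ?case by (rule df_cong) (auto simp: less_Suc_eq)
qed (simp add: df_const)

definition df2 where
  "df2 L U B n m X \<longleftrightarrow> df L U B (n + m) (\<lambda>w. X (take n w) (drop n w))"

lemma df2_tm:
  assumes "df2 L U B n m X" "tm U B N n s" "tm U B N m t"
  shows "df L U B N (\<lambda>v. X (s v) (t v))"
proof (rule df_cong)
  show "df L U B N (\<lambda>v. X (take n (s v @ t v)) (drop n (s v @ t v)))"
    using df_tm[OF assms(1)[unfolded df2_def] tm_append[OF assms(2,3)]] .
  fix v assume "v \<in> tuples (Dom U) N"
  then have "length (s v) = n" using assms(2) by (auto simp: tm_def)
  then show "X (take n (s v @ t v)) (drop n (s v @ t v)) = X (s v) (t v)" by simp
qed

lemma df2_mono: "df2 L U B n m X \<Longrightarrow> B \<subseteq> C \<Longrightarrow> df2 L U C n m X"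
  unfolding df2_def by (rule df_mono)

lemma df_psat:
  assumes "\<theta> \<in> pforms L n B" "B \<subseteq> Dom U"
  shows "df L U B n (\<lambda>v. psat U v \<theta>)"
  using assms unfolding df_def df0_def pforms_def psat_def
  by (intro exI[of _ "snd \<theta>"] exI[of _ "\<lambda>v. holds U (fst \<theta>) v"]) auto

lemma df_form: "\<phi> \<in> forms L N \<Longrightarrow> df L U B N (holds U \<phi>)"
  unfolding df_def df0_def by (intro exI[of _ "[]"] exI[of _ "holds U \<phi>"]) auto

lemma df_pform:
  assumes "df L U B n P"
  shows "\<exists>\<theta>\<in>pforms L n B. set (snd \<theta>) \<subseteq> Dom U \<and> (\<forall>v\<in>tuples (Dom U) n. P v \<longleftrightarrow> psat U v \<theta>)"
proof -
  obtain e R where e: "set e \<subseteq> B \<inter> Dom U" "df0 L U (n + length e) R"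
    "\<And>v. v \<in> tuples (Dom U) n \<Longrightarrow> P v \<longleftrightarrow> R (v @ e)" using assms unfolding df_def by blast
  obtain \<phi> where \<phi>: "\<phi> \<in> forms L (n + length e)"
    "\<And>v. v \<in> tuples (Dom U) (n + length e) \<Longrightarrow> R v \<longleftrightarrow> holds U \<phi> v" using e(2) unfolding df0_def by blast
  have "v @ e \<in> tuples (Dom U) (n + length e)" if "v \<in> tuples (Dom U) n" for v
    using that e(1) by (auto simp: tuples_def)
  then show ?thesis
    using e \<phi> by (intro bexI[of _ "(\<phi>, e)"]) (auto simp: pforms_def psat_def)
qed

lemma df_finite_params:
  assumes "df L U B N P"
  shows "\<exists>C. finite C \<and> C \<subseteq> B \<inter> Dom U \<and> df L U C N P"
proof -
  obtain e R where "set e \<subseteq> B \<inter> Dom U" "df0 L U (N + length e) R"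
     "\<forall>v\<in>tuples (Dom U) N. P v \<longleftrightarrow> R (v @ e)" using assms unfolding df_def by blast
  then show ?thesis unfolding df_def
    by (intro exI[of _ "set e"] conjI exI[of _ e] exI[of _ R]) auto
qed

lemma df_empty_params: "df L U {} N P \<Longrightarrow> df0 L U N P"
  unfolding df_def df0_def by auto

lemma df_parametrize:
  assumes "df L U B N P"
  shows "\<exists>e \<phi>. set e \<subseteq> B \<inter> Dom U \<and> \<phi> \<in> forms L (N + length e) \<and>
    (\<forall>v\<in>tuples (Dom U) N. P v \<longleftrightarrow> holds U \<phi> (v @ e))"
proof -
  obtain e R where e: "set e \<subseteq> B \<inter> Dom U" "df0 L U (N + length e) R"
    "\<forall>v\<in>tuples (Dom U) N. P v \<longleftrightarrow> R (v @ e)" using assms unfolding df_def by (elim exE conjE)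
  obtain \<phi> where \<phi>: "\<phi> \<in> forms L (N + length e)"
    "\<forall>v\<in>tuples (Dom U) (N + length e). R v \<longleftrightarrow> holds U \<phi> v" using e(2) unfolding df0_def by (elim bexE)
  have "v @ e \<in> tuples (Dom U) (N + length e)" if "v \<in> tuples (Dom U) N" for v
    using that e(1) by (auto simp: tuples_def)
  then show ?thesis using e(1,3) \<phi> by (intro exI[of _ e] exI[of _ \<phi>]) simp
qed

lemma form_select:
  assumes \<phi>: "\<phi> \<in> forms L k" and t: "tm U {} N k t"
  shows "\<exists>\<psi>\<in>forms L N. \<forall>v\<in>tuples (Dom U) N. holds U \<psi> v \<longleftrightarrow> holds U \<phi> (t v)"
  using df_empty_params[OF df_tm[OF df_form[OF \<phi>] t]] unfolding df0_def by blast

lemma holds_shift: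
  assumes "\<phi> \<in> forms L (length v)"
  shows "holds U (shift (length u) \<phi>) (u @ v) \<longleftrightarrow> holds U \<phi> v"
proof -
  have "inj ((+) (length u))" by (simp add: inj_def)
  then have "holds U (shift (length u) \<phi>) (u @ v) \<longleftrightarrow> sat U (\<lambda>i. (u @ v) ! (length u + i)) \<phi>"
    unfolding holds_def by (rule sat_rename)
  then show ?thesis by (simp add: holds_def)
qed

lemma df_Ball_finite:
  assumes "finite S" "\<And>i. i \<in> S \<Longrightarrow> df L U B N (P i)"
  shows "df L U B N (\<lambda>v. \<forall>i\<in>S. P i v)"
  using assms by (induction S rule: finite_induct) (auto simp: df_const intro: df_conj)

section \<open>Alternation in NIP theories\<close>

text \<open>The tuples \<open>c\<close> and \<open>t\<close> below are concatenations of blocks of length \<open>m\<close>.\<close>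

primrec alt :: "nat \<Rightarrow> ('u list \<Rightarrow> bool) \<Rightarrow> nat \<Rightarrow> 'u list \<Rightarrow> bool" where
  "alt m R 0 c = True"
| "alt m R (Suc k) c \<longleftrightarrow> R (take m c) \<and> \<not> R (take m (drop m c)) \<and> alt m R k (drop (2 * m) c)"

primrec none :: "nat \<Rightarrow> ('u list \<Rightarrow> bool) \<Rightarrow> nat \<Rightarrow> 'u list \<Rightarrow> bool" where
  "none m R 0 c = True"
| "none m R (Suc k) c \<longleftrightarrow> \<not> R (take m c) \<and> none m R k (drop m c)"

primrec pat :: "nat \<Rightarrow> ('u list \<Rightarrow> bool) \<Rightarrow> bool list \<Rightarrow> 'u list \<Rightarrow> bool" where
  "pat m R [] t = True"
| "pat m R (b # bs) t \<longleftrightarrow> R (take m t) = b \<and> pat m R bs (drop m t)"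

lemma df_alt:
  assumes "df2 L U B l m R" "tm U B N l s" "tm U B N (k * (2 * m)) t"
  shows "df L U B N (\<lambda>v. alt m (R (s v)) k (t v))"
  using assms(3)
proof (induction k arbitrary: t)
  case (Suc k)
  have 1: "tm U B N m (\<lambda>v. take m (t v))" by (rule tm_take[OF Suc.prems]) simp
  have 2: "tm U B N m (\<lambda>v. take m (drop m (t v)))"
    by (rule tm_take[OF tm_drop[where k = "m + k * (2 * m)"]], rule tm_eq[OF Suc.prems]) simp_all
  have 3: "tm U B N (k * (2 * m)) (\<lambda>v. drop (2 * m) (t v))"
    by (rule tm_drop, rule tm_eq[OF Suc.prems]) simp
  show ?case unfolding alt.simps
    by (intro df_conj df_not df2_tm[OF assms(1,2)] 1 2 Suc.IH[OF 3])
qed (simp add: df_const)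

lemma df_none:
  assumes "df2 L U B l m R" "tm U B N l s" "tm U B N (k * m) t"
  shows "df L U B N (\<lambda>v. none m (R (s v)) k (t v))"
  using assms(3)
proof (induction k arbitrary: t)
  case (Suc k)
  have 1: "tm U B N m (\<lambda>v. take m (t v))" by (rule tm_take[OF Suc.prems]) simp
  have 3: "tm U B N (k * m) (\<lambda>v. drop m (t v))"
    by (rule tm_drop, rule tm_eq[OF Suc.prems]) simp
  show ?case unfolding none.simps
    by (intro df_conj df_not df2_tm[OF assms(1,2)] 1 Suc.IH[OF 3])
qed (simp add: df_const)

lemma df_pat:
  assumes "df2 L U B l m R" "tm U B N l s" "tm U B N (length bs * m) t"
  shows "df L U B N (\<lambda>v. pat m (R (s v)) bs (t v))"
  using assms(3)
proof (induction bs arbitrary: t)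
  case (Cons b bs)
  have 1: "tm U B N m (\<lambda>v. take m (t v))" by (rule tm_take[OF Cons.prems]) simp
  have 3: "tm U B N (length bs * m) (\<lambda>v. drop m (t v))"
    by (rule tm_drop, rule tm_eq[OF Cons.prems]) simp
  have "df L U B N (\<lambda>v. R (s v) (take m (t v)) = b)"
    using df2_tm[OF assms(1,2) 1] df_not[OF df2_tm[OF assms(1,2) 1]] by (cases b) simp_all
  then show ?case unfolding pat.simps
    by (intro df_conj Cons.IH[OF 3])
qed (simp add: df_const)

lemma pat_append:
  "length t = length bs * m \<Longrightarrow> pat m R (bs @ cs) (t @ s) \<longleftrightarrow> pat m R bs t \<and> pat m R cs s"
  by (induction bs arbitrary: t) auto

section \<open>From alternation along a typical sequence to arbitrary truth patterns\<close>

lemma alt_to_pat: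
  assumes E: "uf A m E"
  shows "eventually (\<lambda>c. \<exists>x\<in>C. alt m (R x) N c) (pw (E \<otimes>f E) N) \<Longrightarrow> length bs = N \<Longrightarrow>
    eventually (\<lambda>t. \<exists>x\<in>C. pat m (R x) bs t) (pw E N)"
proof (induction N arbitrary: C bs)
  case (Suc N)
  obtain b bs' where bs: "bs = b # bs'" "length bs' = N" using Suc.prems(2) by (cases bs) auto
  note T = uf_tuples[OF E]
  have "eventually (\<lambda>s. eventually (\<lambda>s'. eventually (\<lambda>c. \<exists>x\<in>C. alt m (R x) (Suc N) (s @ s' @ c))
      (pw (E \<otimes>f E) N)) E) E"
    using Suc.prems(1) by (simp only: pw.simps eventually_fprod append_assoc)
  with T have "eventually (\<lambda>s. eventually (\<lambda>s'.
      eventually (\<lambda>t. \<exists>x\<in>C. (R x s \<and> \<not> R x s') \<and> pat m (R x) bs' t) (pw E N)) E) E"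
  proof eventually_elim
    case (elim s)
    from T elim(2) show ?case
    proof eventually_elim
      case (elim s')
      have "eventually (\<lambda>c. \<exists>x\<in>{x\<in>C. R x s \<and> \<not> R x s'}. alt m (R x) N c) (pw (E \<otimes>f E) N)"
        using elim(2)
        by eventually_elim (use elim(1) \<open>s \<in> tuples A m\<close> in \<open>auto simp: tuples_def\<close>)
      from Suc.IH[OF this bs(2)] show ?case by eventually_elim blast
    qed
  qed
  then have "eventually (\<lambda>s. eventually (\<lambda>t. \<exists>x\<in>C. R x s = b \<and> pat m (R x) bs' t) (pw E N)) E"
  \<comment> \<open>Of each pair of blocks, one true and one false, only the block with the truth
    value demanded by the pattern is kept. The quantifier over the other block becomes vacuous, so
    the kept blocks follow the law \<open>pw E N\<close>.\<close>
  proof (cases b)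
    case True
    assume "eventually (\<lambda>s. eventually (\<lambda>s'.
      eventually (\<lambda>t. \<exists>x\<in>C. (R x s \<and> \<not> R x s') \<and> pat m (R x) bs' t) (pw E N)) E) E"
    then show ?thesis
    proof eventually_elim
      case (elim s)
      then have "eventually (\<lambda>s'. eventually (\<lambda>t. \<exists>x\<in>C. R x s = b \<and> pat m (R x) bs' t) (pw E N)) E"
        by (rule eventually_mono) (erule eventually_mono, use True in blast)
      then show ?case by (simp add: ultra_const[OF uf_ultra[OF E]])
    qed
  next
    case False
    assume "eventually (\<lambda>s. eventually (\<lambda>s'.
      eventually (\<lambda>t. \<exists>x\<in>C. (R x s \<and> \<not> R x s') \<and> pat m (R x) bs' t) (pw E N)) E) E"
    then have "eventually (\<lambda>s. eventually (\<lambda>s'.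
      eventually (\<lambda>t. \<exists>x\<in>C. R x s' = b \<and> pat m (R x) bs' t) (pw E N)) E) E"
      by (rule eventually_mono) (erule eventually_mono, erule eventually_mono, use False in blast)
    then show ?thesis by (simp add: ultra_const[OF uf_ultra[OF E]])
  qed
  with T have "eventually (\<lambda>s. eventually (\<lambda>t. \<exists>x\<in>C. pat m (R x) bs (s @ t)) (pw E N)) E"
  proof eventually_elim
    case (elim s)
    from elim(2) show ?case
      by eventually_elim (use elim(1) in \<open>auto simp: bs tuples_def\<close>)
  qed
  then show ?case by (simp add: eventually_fprod)
qed simp

lemma alt_append:
  "length c = k * (2 * m) \<Longrightarrow> alt m R (k + j) (c @ c') \<longleftrightarrow> alt m R k c \<and> alt m R j c'"
proof (induction k arbitrary: c)
  case (Suc k)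
  have 1: "take m (c @ c') = take m c" "take m (drop m (c @ c')) = take m (drop m c)"
    "drop (2 * m) (c @ c') = drop (2 * m) c @ c'" using Suc.prems by simp_all
  have "length (drop (2 * m) c) = k * (2 * m)" using Suc.prems by simp
  from Suc.IH[OF this] show ?case unfolding add_Suc alt.simps 1 by blast
qed simp

text \<open>The same alternation as in \<open>alt\<close>, but with the positive blocks gathered in
  \<open>c\<close> and the negative ones in \<open>u\<close>. The two halves are later produced
  separately.\<close>

primrec alt2 :: "nat \<Rightarrow> ('u list \<Rightarrow> bool) \<Rightarrow> nat \<Rightarrow> 'u list \<Rightarrow> 'u list \<Rightarrow> bool" where
  "alt2 m R 0 c u = True"
| "alt2 m R (Suc k) c u \<longleftrightarrow> R (take m c) \<and> \<not> R (take m u) \<and> alt2 m R k (drop m c) (drop m u)"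

lemma df_alt2:
  assumes "df2 L U B l m R" "tm U B N l s" "tm U B N (k * m) c" "tm U B N (k * m) t"
  shows "df L U B N (\<lambda>v. alt2 m (R (s v)) k (c v) (t v))"
  using assms(3,4)
proof (induction k arbitrary: c t)
  case (Suc k)
  have 1: "tm U B N m (\<lambda>v. take m (c v))" "tm U B N m (\<lambda>v. take m (t v))"
    by (rule tm_take[OF Suc.prems(1)] tm_take[OF Suc.prems(2)], simp)+
  have 3: "tm U B N (k * m) (\<lambda>v. drop m (c v))" "tm U B N (k * m) (\<lambda>v. drop m (t v))"
    by (rule tm_drop, rule tm_eq[OF Suc.prems(1)], simp, rule tm_drop, rule tm_eq[OF Suc.prems(2)], simp)
  show ?case unfolding alt2.simps
    by (intro df_conj df_not df2_tm[OF assms(1,2)] 1 Suc.IH 3)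
qed (simp add: df_const)

lemma none_eventually:
  assumes G: "uf A m G" and R: "\<forall>\<^sub>F z in G. \<not> R z"
  shows "\<forall>\<^sub>F c in pw G k. none m R k c"
proof (induction k)
  case (Suc k)
  have "\<forall>\<^sub>F z in G. \<forall>\<^sub>F c in pw G k. none m R (Suc k) (z @ c)"
    using uf_tuples[OF G] R
  proof eventually_elim
    case (elim z)
    from Suc.IH show ?case by eventually_elim (use elim tuples_len[OF elim(1)] in simp)
  qed
  then show ?case by (simp only: pw.simps eventually_fprod)
qed simp

text \<open>Only the first block is looked at, the others being vacuous; this is the reason for
  demanding \<open>0 < k\<close>.\<close>

lemma eventually_none:
  assumes G: "uf A m G" and k: "0 < k" and R: "\<forall>\<^sub>F c in pw G k. none m R k c"
  shows "\<forall>\<^sub>F z in G. \<not> R z"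
proof -
  obtain k' where k': "k = Suc k'" using k by (cases k) auto
  have "\<forall>\<^sub>F z in G. \<forall>\<^sub>F c in pw G k'. none m R (Suc k') (z @ c)"
    using R by (simp only: k' pw.simps eventually_fprod)
  with uf_tuples[OF G] show ?thesis
  proof eventually_elim
    case (elim z)
    from elim(2) have "\<forall>\<^sub>F c in pw G k'. \<not> R z" by eventually_elim (use tuples_len[OF elim(1)] in simp)
    then show ?case by (simp add: ultra_const[OF ultra_pw[OF uf_ultra[OF G]]])
  qed
qed

lemma alt2I:
  "(\<forall>j<k. R (take m (drop (j * m) c))) \<Longrightarrow> none m R k u \<Longrightarrow> alt2 m R k c u"
proof (induction k arbitrary: c u)
  case (Suc k)
  have "R (take m (drop (0 * m) c))" using Suc.prems(1) by blast
  moreover have "\<forall>j<k. R (take m (drop (j * m) (drop m c)))"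
  proof (intro allI impI)
    fix j assume "j < k"
    then have "R (take m (drop (Suc j * m) c))" using Suc.prems(1) by blast
    then show "R (take m (drop (j * m) (drop m c)))" by (simp add: add.commute)
  qed
  ultimately show ?case using Suc.IH[of "drop m c" "drop m u"] Suc.prems(2) by simp
qed simp

text \<open>Finitely many generic statements about \<open>w\<close> hold simultaneously. The double
  negation appears because \<open>none\<close> negates its predicate.\<close>

lemma none_swap:
  assumes W: "uf A mw W"
  shows "none m (\<lambda>z. \<not> (\<forall>\<^sub>F w in W. \<not> R w z)) k v \<Longrightarrow> \<forall>\<^sub>F w in W. none m (R w) k v"
proof (induction k arbitrary: v)
  case (Suc k)
  then have "\<forall>\<^sub>F w in W. \<not> R w (take m v)" "\<forall>\<^sub>F w in W. none m (R w) k (drop m v)" by simp_all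
  then show ?case by eventually_elim simp
qed simp

text \<open>If finitely many \<open>\<zeta>\<close> already cover \<open>C\<close>, the elements of \<open>C\<close> avoiding a generic \<open>\<zeta>\<close> can be forced to
  meet another one; iterating this produces alternation.\<close>

lemma finite_cover_alternates:
  assumes Z: "uf A m Z"
  shows "(\<And>J. eventually (\<lambda>\<zeta>. \<zeta> \<in> J) Z \<Longrightarrow> \<exists>J0\<subseteq>J. finite J0 \<and> (\<forall>c\<in>C. \<exists>\<zeta>\<in>J0. \<Theta> c \<zeta>)) \<Longrightarrow>
    eventually (\<lambda>z. \<exists>c\<in>C. none m (\<Theta> c) k z) (pw Z k) \<Longrightarrow>
    \<not> eventually (\<lambda>w. \<not> (\<exists>c\<in>C. alt m (\<lambda>\<zeta>. \<not> \<Theta> c \<zeta>) k w)) (pw (Z \<otimes>f Z) k)"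
proof (induction k arbitrary: C)
  case (Suc k)
  note T = uf_tuples[OF Z] and ult = uf_ultra[OF Z]
  show ?case
  proof
    assume "eventually (\<lambda>w. \<not> (\<exists>c\<in>C. alt m (\<lambda>\<zeta>. \<not> \<Theta> c \<zeta>) (Suc k) w)) (pw (Z \<otimes>f Z) (Suc k))"
    then have 1: "eventually (\<lambda>s. eventually (\<lambda>t. eventually
        (\<lambda>w. \<not> (\<exists>c\<in>C. alt m (\<lambda>\<zeta>. \<not> \<Theta> c \<zeta>) (Suc k) (s @ t @ w))) (pw (Z \<otimes>f Z) k)) Z) Z"
      by (simp only: pw.simps eventually_fprod append_assoc)
    have 2: "eventually (\<lambda>s. eventually (\<lambda>z. \<exists>c\<in>C. none m (\<Theta> c) (Suc k) (s @ z)) (pw Z k)) Z"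
      using Suc.prems(2) by (simp only: pw.simps eventually_fprod)
    from uf_happens[OF Z eventually_conj[OF 1 2]] obtain s where s: "s \<in> tuples A m"
      "eventually (\<lambda>t. eventually
        (\<lambda>w. \<not> (\<exists>c\<in>C. alt m (\<lambda>\<zeta>. \<not> \<Theta> c \<zeta>) (Suc k) (s @ t @ w))) (pw (Z \<otimes>f Z) k)) Z"
      "eventually (\<lambda>z. \<exists>c\<in>C. none m (\<Theta> c) (Suc k) (s @ z)) (pw Z k)"
      by (elim bexE conjE)
    \<comment> \<open>These are the second blocks that, after the fixed first block
      \<open>s\<close>, still admit no alternation. They are generic, so the covering hypothesis can
      be applied inside them.\<close>
    define J where "J = {t \<in> tuples A m. eventually
        (\<lambda>w. \<not> (\<exists>c\<in>C. alt m (\<lambda>\<zeta>. \<not> \<Theta> c \<zeta>) (Suc k) (s @ t @ w))) (pw (Z \<otimes>f Z) k)}"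
    have "eventually (\<lambda>t. t \<in> J) Z"
      using eventually_conj[OF T s(2)] by (simp only: J_def mem_Collect_eq)
    from Suc.prems(1)[OF this]
    obtain J0 where J0: "J0 \<subseteq> J" "finite J0" "\<forall>c\<in>C. \<exists>\<zeta>\<in>J0. \<Theta> c \<zeta>"
      by (elim exE conjE)
    \<comment> \<open>An element that avoids \<open>s\<close> and the generic blocks
      \<open>z\<close> is covered by some \<open>t\<close> of the finite set \<open>J0\<close>; by
      finiteness one \<open>t\<close> serves for generic \<open>z\<close>. The pair
      \<open>s\<close>, \<open>t\<close> is the first alternation.\<close>
    have "eventually (\<lambda>z. \<exists>t\<in>J0. \<exists>c\<in>{c\<in>C. \<not> \<Theta> c s \<and> \<Theta> c t}. none m (\<Theta> c) k z) (pw Z k)"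
      using s(3)
    proof eventually_elim
      case (elim z)
      then obtain c where c: "c \<in> C" "none m (\<Theta> c) (Suc k) (s @ z)" by blast
      then obtain t where "t \<in> J0" "\<Theta> c t" using J0(3) by blast
      then show ?case using c tuples_len[OF s(1)] by auto
    qed
    from ultra_Bex_finite[OF ultra_pw[OF ult] J0(2) this] obtain t where t: "t \<in> J0"
      "eventually (\<lambda>z. \<exists>c\<in>{c\<in>C. \<not> \<Theta> c s \<and> \<Theta> c t}. none m (\<Theta> c) k z) (pw Z k)"
      by (elim bexE)
    have "\<exists>J0\<subseteq>J. finite J0 \<and> (\<forall>c\<in>{c\<in>C. \<not> \<Theta> c s \<and> \<Theta> c t}. \<exists>\<zeta>\<in>J0. \<Theta> c \<zeta>)"
      if "eventually (\<lambda>\<zeta>. \<zeta> \<in> J) Z" for J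
    proof -
      from Suc.prems(1)[OF that] obtain J1 where "J1 \<subseteq> J" "finite J1" "\<forall>c\<in>C. \<exists>\<zeta>\<in>J1. \<Theta> c \<zeta>"
        by (elim exE conjE)
      then show ?thesis by (intro exI[of _ J1]) simp
    qed
    from Suc.IH[OF this t(2)]
    have "\<not> eventually (\<lambda>w. \<not> (\<exists>c\<in>{c\<in>C. \<not> \<Theta> c s \<and> \<Theta> c t}. alt m (\<lambda>\<zeta>. \<not> \<Theta> c \<zeta>) k w)) (pw (Z \<otimes>f Z) k)" .
    moreover have tJ: "t \<in> J" using t(1) J0(1) by blast
    then have "eventually (\<lambda>w. \<not> (\<exists>c\<in>C. alt m (\<lambda>\<zeta>. \<not> \<Theta> c \<zeta>) (Suc k) (s @ t @ w))) (pw (Z \<otimes>f Z) k)"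
      "t \<in> tuples A m" by (simp_all add: J_def)
    then have "eventually (\<lambda>w. \<not> (\<exists>c\<in>{c\<in>C. \<not> \<Theta> c s \<and> \<Theta> c t}. alt m (\<lambda>\<zeta>. \<not> \<Theta> c \<zeta>) k w)) (pw (Z \<otimes>f Z) k)"
      using tuples_len[OF s(1)] tuples_len[of t A m] by (elim eventually_mono) simp
    ultimately show False by (rule notE)
  qed
next
  case 0
  from "0.prems"(2) show ?case by simp
qed

lemma saturatedD:
  "saturated L \<kappa> M \<Longrightarrow> B \<subseteq> Dom M \<Longrightarrow> |B| <o \<kappa> \<Longrightarrow> \<Sigma> \<subseteq> pforms L n B \<Longrightarrow> consistent M n \<Sigma> \<Longrightarrow>
     \<exists>as. realizes M n \<Sigma> as"
  unfolding saturated_def by blast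

section \<open>Smallness, compactness and NIP in a saturated model\<close>

locale nip_setting =
  fixes L :: "('f, 'r) lang" and U :: "('f, 'r, 'u) struct" and \<kappa> :: "'k rel" and A :: "'u set"
  assumes sat: "saturated L \<kappa> U" and card: "Card_order \<kappa>"
    and big: "|{\<phi> :: ('f, 'r) fm. wf_fm L \<phi>}| <o \<kappa>"
    and ne: "Dom U \<noteq> {}" and nip: "NIP L U"
    and A: "A \<subseteq> Dom U" "|A| <o \<kappa>"
begin

abbreviation tu :: "nat \<Rightarrow> 'u list set" where "tu \<equiv> tuples (Dom U)"

definition small :: "'u set \<Rightarrow> bool" where
  "small B \<longleftrightarrow> B \<subseteq> Dom U \<and> |B| <o \<kappa>"

text \<open>The set of formulas serves as an infinite set of size below \<kappa>. Adding it to
  \<open>A\<close> or to an index set makes infinite cardinal arithmetic applicable when these are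
  finite.\<close>

lemma inf_wf: "infinite {\<phi> :: ('f, 'r) fm. wf_fm L \<phi>}"
proof
  assume fin: "finite {\<phi> :: ('f, 'r) fm. wf_fm L \<phi>}"
  have "inj (\<lambda>i. All i (Fls :: ('f, 'r) fm))" by (auto simp: inj_def)
  then have "infinite (range (\<lambda>i. All i (Fls :: ('f, 'r) fm)))"
    using finite_imageD infinite_UNIV_nat by blast
  moreover have "range (\<lambda>i. All i (Fls :: ('f, 'r) fm)) \<subseteq> {\<phi>. wf_fm L \<phi>}" by auto
  ultimately show False using fin finite_subset by blast
qed

lemma finite_ordLeq: "finite X \<Longrightarrow> infinite Y \<Longrightarrow> |X| \<le>o |Y|"
  by (rule ordLess_imp_ordLeq, rule finite_ordLess_infinite[OF card_of_Well_order card_of_Well_order])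
    (simp_all add: Field_card_of)

lemma inf_kappa: "infinite (Field \<kappa>)"
proof
  assume "finite (Field \<kappa>)"
  moreover have "|{\<phi> :: ('f, 'r) fm. wf_fm L \<phi>}| \<le>o |Field \<kappa>|"
    using big card card_of_Field_ordIso ordIso_symmetric ordLess_imp_ordLeq ordLeq_ordIso_trans
    by blast
  ultimately show False using card_of_ordLeq_finite inf_wf by blast
qed

lemma small_A: "small A"
  using A by (simp add: small_def)

lemma small_finite: "finite B \<Longrightarrow> B \<subseteq> Dom U \<Longrightarrow> small B"
  unfolding small_def
  by (auto intro!: finite_ordLess_infinite inf_kappa card_of_Well_order
      simp: card card_order_on_well_order_on Field_card_of)

lemma small_Un: "small B \<Longrightarrow> small C \<Longrightarrow> small (B \<union> C)"
  unfolding small_def using card_of_Un_ordLess_infinite_Field[OF inf_kappa card] by blast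

lemma small_set: "t \<in> tu k \<Longrightarrow> small (set t)"
  by (rule small_finite) (auto simp: tuples_def)

lemma small_UN:
  assumes "|I| <o \<kappa>" "\<And>i. i \<in> I \<Longrightarrow> finite (X i)" "\<And>i. i \<in> I \<Longrightarrow> X i \<subseteq> Dom U"
  shows "small (\<Union>i\<in>I. X i)"
proof -
  let ?W = "{\<phi> :: ('f, 'r) fm. wf_fm L \<phi>}"
  have inf: "infinite (?W <+> I)" using inf_wf by simp
  have "|X i| \<le>o |?W <+> I|" if "i \<in> I" for i
    using that assms(2) inf by (simp add: finite_ordLeq)
  then have "|\<Union>i\<in>I. X i| \<le>o |?W <+> I|"
    by (intro card_of_UNION_ordLeq_infinite[OF inf]) (auto intro: card_of_Plus2)
  moreover have "|?W <+> I| <o \<kappa>"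
    using card_of_Plus_ordLess_infinite_Field[OF inf_kappa card big assms(1)] .
  ultimately show ?thesis
    unfolding small_def using assms(3) ordLeq_ordLess_trans by blast
qed

lemma card_nat: "|UNIV :: nat set| <o \<kappa>"
  using inf_wf big infinite_iff_card_of_nat ordLeq_ordLess_trans by blast

lemma card_tuples: "|tuples A k| <o \<kappa>"
proof -
  let ?W = "{\<phi> :: ('f, 'r) fm. wf_fm L \<phi>}"
  have inf: "infinite (?W <+> A)" using inf_wf by simp
  have "|tuples A k| \<le>o |?W <+> A|"
  proof (induction k)
    case 0
    then show ?case using inf by (simp add: finite_ordLeq)
  next
    case (Suc k)
    have "|SIGMA x : A. tuples A k| \<le>o |?W <+> A|"
      by (rule card_of_Sigma_ordLeq_infinite[OF inf]) (auto intro: card_of_Plus2 Suc.IH)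
    moreover have "tuples A (Suc k) \<subseteq> (\<lambda>(x, xs). x # xs) ` (A \<times> tuples A k)"
    proof
      fix t assume "t \<in> tuples A (Suc k)"
      then show "t \<in> (\<lambda>(x, xs). x # xs) ` (A \<times> tuples A k)"
        by (cases t) (auto simp: tuples_def)
    qed
    then have "|tuples A (Suc k)| \<le>o |A \<times> tuples A k|"
      by (metis card_of_image card_of_mono1 ordLeq_transitive)
    ultimately show ?case using ordLeq_transitive by blast
  qed
  moreover have "|?W <+> A| <o \<kappa>"
    using card_of_Plus_ordLess_infinite_Field[OF inf_kappa card big A(2)] .
  ultimately show ?thesis using ordLeq_ordLess_trans by blast
qed

lemma tu_ne: "\<exists>t. t \<in> tu k"
proof -
  obtain x where "x \<in> Dom U" using ne by blast
  then show ?thesis by (intro exI[of _ "replicate k x"]) (auto simp: tuples_def)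
qed

lemma tA: "t \<in> tuples A k \<Longrightarrow> t \<in> tu k"
  using A(1) tuples_mono by blast

text \<open>Saturation restated for predicates: a formula over \<open>B\<close> is chosen for each
  predicate of the family.\<close>

lemma sat_df:
  assumes B: "small B" and P: "\<And>P. P \<in> \<P> \<Longrightarrow> df L U B N P"
    and fs: "\<And>F. finite F \<Longrightarrow> F \<subseteq> \<P> \<Longrightarrow> \<exists>v\<in>tu N. \<forall>P\<in>F. P v"
  shows "\<exists>v\<in>tu N. \<forall>P\<in>\<P>. P v"
proof -
  have "\<forall>P\<in>\<P>. \<exists>\<theta>. \<theta> \<in> pforms L N B \<and> (\<forall>v\<in>tu N. P v \<longleftrightarrow> psat U v \<theta>)"
    using df_pform[OF P] by blast
  from bchoice[OF this] obtain th where th': "\<forall>P\<in>\<P>. th P \<in> pforms L N B \<and>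
    (\<forall>v\<in>tu N. P v \<longleftrightarrow> psat U v (th P))" ..
  then have th: "\<And>P. P \<in> \<P> \<Longrightarrow> th P \<in> pforms L N B"
    "\<And>P v. P \<in> \<P> \<Longrightarrow> v \<in> tu N \<Longrightarrow> P v \<longleftrightarrow> psat U v (th P)"
    by blast+
  have "consistent U N (th ` \<P>)"
    unfolding consistent_def
  proof (intro allI impI, elim conjE)
    fix F assume "finite F" "F \<subseteq> th ` \<P>"
    from finite_subset_image[OF this]
    obtain F0 where F0: "F0 \<subseteq> \<P>" "finite F0" "F = th ` F0" by (elim exE conjE)
    from fs[OF F0(2,1)] obtain v where v: "v \<in> tu N" "\<forall>P\<in>F0. P v" by blast
    have "realizes U N F v" unfolding realizes_def
    proof (intro conjI ballI v(1))
      fix \<theta> assume "\<theta> \<in> F"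
      then obtain P where "P \<in> F0" "\<theta> = th P" using F0(3) by blast
      then show "psat U v \<theta>" using th(2)[of P v] v F0(1) by blast
    qed
    then show "\<exists>as. realizes U N F as" ..
  qed
  moreover have "th ` \<P> \<subseteq> pforms L N B" using th(1) by blast
  ultimately obtain v where "realizes U N (th ` \<P>) v"
    using saturatedD[OF sat] B unfolding small_def by blast
  then have v: "v \<in> tu N" "\<And>P. P \<in> \<P> \<Longrightarrow> psat U v (th P)" by (auto simp: realizes_def)
  show ?thesis using v th(2) by (intro bexI[of _ v] ballI) blast+
qed

text \<open>If no finite part of \<open>J\<close> covered, then by saturation some element
  satisfying \<open>C\<close> would avoid every \<zeta> in \<open>J\<close>.\<close>

lemma compact_cover:
  assumes B: "small B" and C: "df L U B N C" and \<Theta>: "\<And>\<zeta>. \<zeta> \<in> J \<Longrightarrow> df L U B N (\<lambda>c. \<Theta> c \<zeta>)"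
    and cov: "\<forall>c\<in>tu N. C c \<longrightarrow> (\<exists>\<zeta>\<in>J. \<Theta> c \<zeta>)"
  shows "\<exists>J0\<subseteq>J. finite J0 \<and> (\<forall>c\<in>{c\<in>tu N. C c}. \<exists>\<zeta>\<in>J0. \<Theta> c \<zeta>)"
proof (rule ccontr)
  assume no: "\<not> ?thesis"
  let ?P = "insert C ((\<lambda>\<zeta> c. \<not> \<Theta> c \<zeta>) ` J)"
  have "\<exists>v\<in>tu N. \<forall>P\<in>?P. P v"
  proof (rule sat_df[OF B])
    fix F assume F: "finite F" "F \<subseteq> ?P"
    then have "finite (F - {C})" "F - {C} \<subseteq> (\<lambda>\<zeta> c. \<not> \<Theta> c \<zeta>) ` J" by auto
    from finite_subset_image[OF this]
    obtain J0 where J0: "J0 \<subseteq> J" "finite J0" "F - {C} = (\<lambda>\<zeta> c. \<not> \<Theta> c \<zeta>) ` J0"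
      by (elim exE conjE)
    have "\<exists>v\<in>tu N. C v \<and> (\<forall>\<zeta>\<in>J0. \<not> \<Theta> v \<zeta>)"
    proof (rule ccontr)
      assume "\<not> ?thesis"
      then have "\<forall>c\<in>{c\<in>tu N. C c}. \<exists>\<zeta>\<in>J0. \<Theta> c \<zeta>" by simp
      with J0(1,2) no show False by (elim notE, intro exI[of _ J0]) simp
    qed
    then obtain v where v: "v \<in> tu N" "C v" "\<forall>\<zeta>\<in>J0. \<not> \<Theta> v \<zeta>" by (elim bexE conjE)
    have "\<forall>P\<in>F - {C}. P v" unfolding J0(3) using v(3) by simp
    then have "P v" if "P \<in> F" for P using v(2) that by (cases "P = C") auto
    then show "\<exists>v\<in>tu N. \<forall>P\<in>F. P v" using v(1) by blast
  next
    fix P assume "P \<in> ?P"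
    then consider "P = C" | \<zeta> where "\<zeta> \<in> J" "P = (\<lambda>c. \<not> \<Theta> c \<zeta>)" by (elim insertE imageE)
    then show "df L U B N P"
    proof cases
      case 1
      then show ?thesis using C by simp
    next
      case 2
      then show ?thesis using df_not[OF \<Theta>[OF 2(1)]] by simp
    qed
  qed
  then obtain v where v: "v \<in> tu N" "\<forall>P\<in>?P. P v" by (elim bexE)
  from v(2) have "C v" by simp
  then obtain \<zeta> where "\<zeta> \<in> J" "\<Theta> v \<zeta>" using cov v(1) by blast
  then show False using v(2) by simp
qed

text \<open>Compactness in three stages: shattered tuples of all finite lengths give an infinite
  sequence with shattered initial segments; saturation realizes every subset of it; finally the
  parameters of \<open>R\<close> are moved into the parameter tuple of an \<open>L\<close>-formula
  with the independence property.\<close>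

lemma shatter_IP:
  assumes R: "df2 L U B l m R" and B: "small B"
    and sh: "\<And>N. \<exists>t\<in>tu (N * m). \<forall>bs. length bs = N \<longrightarrow> (\<exists>x\<in>tu l. pat m (R x) bs t)"
  shows False
proof -
  define SH where "SH k t \<longleftrightarrow> (\<forall>bs\<in>{bs. length bs = k}. \<exists>x\<in>tu l. pat m (R x) bs t)" for k t
  have fin: "finite {bs :: bool list. length bs = k}" for k
    using finite_lists_length_eq[of "UNIV :: bool set" k] by simp
  have SH_take: "SH k t" if "SH (k + j) (t @ t')" "length t = k * m" for k j t t'
    unfolding SH_def
  proof
    fix bs :: "bool list" assume bs: "bs \<in> {bs. length bs = k}"
    then have "bs @ replicate j True \<in> {bs. length bs = k + j}" by simp
    with that(1) obtain x where "x \<in> tu l" "pat m (R x) (bs @ replicate j True) (t @ t')"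
      unfolding SH_def by blast
    then show "\<exists>x\<in>tu l. pat m (R x) bs t" using bs that(2) by (auto simp: pat_append)
  qed
  \<comment> \<open>The invariant of the recursive construction: \<open>t\<close> extends to
    shattered tuples of every greater length.\<close>
  define P where "P k t \<longleftrightarrow> t \<in> tu (k * m) \<and>
      (\<forall>j. \<exists>t'\<in>tu (j * m). SH (k + j) (t @ t'))" for k t
  have "\<exists>f. \<forall>k. P k (f k) \<and> (\<exists>s\<in>tu m. f (Suc k) = f k @ s)"
  proof (rule dependent_nat_choice)
    show "\<exists>t. P 0 t" using sh by (auto simp: P_def SH_def)
    fix t k assume t: "P k t"
    define Q where "Q j s \<longleftrightarrow> (\<exists>t'\<in>tu (j * m). SH (Suc k + j) (t @ s @ t'))" for j s
    have tt: "t \<in> tu (k * m)" using t by (simp add: P_def)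
    \<comment> \<open>Longer extensions give shorter ones, so finitely many of the conditions
      \<open>Q j\<close> reduce to the one with the largest \<open>j\<close>.\<close>
    have Qmono: "Q i s" if "Q j s" "i \<le> j" "s \<in> tu m" for i j s
    proof -
      obtain t' where t': "t' \<in> tu (j * m)" "SH (Suc k + j) (t @ s @ t')"
        using \<open>Q j s\<close> by (auto simp: Q_def)
      have "i + (j - i) = j" using \<open>i \<le> j\<close> by simp
      then have jm: "j * m = i * m + (j - i) * m" by (metis add_mult_distrib)
      have "take (i * m) t' \<in> tu (i * m)"
        using t'(1) unfolding jm by (rule tuples_take)
      moreover have "SH (Suc k + i) (t @ s @ take (i * m) t')"
      proof (rule SH_take[where j = "j - i" and t' = "drop (i * m) t'"])
        have e: "Suc k + i + (j - i) = Suc k + j" using \<open>i \<le> j\<close> by simp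
        show "SH (Suc k + i + (j - i)) ((t @ s @ take (i * m) t') @ drop (i * m) t')"
          unfolding e append_assoc append_take_drop_id by (rule t'(2))
        show "length (t @ s @ take (i * m) t') = (Suc k + i) * m"
          using tuples_len[OF tt] tuples_len[OF that(3)] tuples_len[OF t'(1)]
            mult_le_mono1[OF \<open>i \<le> j\<close>, of m] by (simp add: algebra_simps)
      qed
      ultimately show ?thesis unfolding Q_def by blast
    qed
    have "\<exists>s\<in>tu m. \<forall>P\<in>range Q. P s"
    proof (rule sat_df[OF small_Un[OF B small_set[OF tt]]])
      fix P' assume "P' \<in> range Q"
      then obtain j where P': "P' = Q j" by blast
      show "df L U (B \<union> set t) m P'"
        unfolding P' Q_def SH_def
      proof (intro df_ex df_Ball_finite fin)
        fix bs assume bs: "bs \<in> {bs :: bool list. length bs = Suc k + j}"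
        let ?B = "B \<union> set t"
        have 1: "tm U ?B (m + j * m + l) (k * m) (\<lambda>v. t)"
          by (rule tm_const) (use tt in \<open>auto simp: tuples_def\<close>)
        have 2: "tm U ?B (m + j * m + l) m (\<lambda>v. take m (take (m + j * m) v))"
          by (rule tm_take[OF tm_take[OF tm_id]]) auto
        have 3: "tm U ?B (m + j * m + l) (j * m) (\<lambda>v. drop m (take (m + j * m) v))"
          by (rule tm_drop[OF tm_take[OF tm_id]]) auto
        have 4: "tm U ?B (m + j * m + l) l (\<lambda>v. drop (m + j * m) v)"
          by (rule tm_drop[OF tm_id])
        show "df L U ?B (m + j * m + l)
            (\<lambda>w. pat m (R (drop (m + j * m) w)) bs
               (t @ take m (take (m + j * m) w) @ drop m (take (m + j * m) w)))"
          by (rule df_pat[OF df2_mono[OF R] 4], simp, rule tm_eq[OF tm_append[OF 1 tm_append[OF 2 3]]])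
            (use bs in \<open>simp add: algebra_simps\<close>)
      qed
    next
      fix F assume F: "finite F" "F \<subseteq> range Q"
      then obtain S where S: "finite S" "F = Q ` S" by (meson finite_subset_image)
      define M where "M = Max (insert 0 S)"
      have leM: "i \<le> M" if "i \<in> S" for i using that S by (simp add: M_def)
      obtain t' where t': "t' \<in> tu (Suc M * m)" "SH (k + Suc M) (t @ t')"
        using t unfolding P_def by blast
      have "Q M (take m t')"
        unfolding Q_def using t' tuples_drop[of t' "Dom U" m "M * m"]
        by (intro bexI[of _ "drop m t'"]) auto
      moreover have "take m t' \<in> tu m" using t'(1) tuples_take[of t' "Dom U" m "M * m"] by simp
      ultimately show "\<exists>v\<in>tu m. \<forall>P\<in>F. P v" using Qmono leM S(2) by blast
    qed
    then obtain s where s: "s \<in> tu m" "\<And>j. Q j s" by blast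
    have "t @ s \<in> tu (Suc k * m)" using tuples_append[OF tt s(1)] by (simp add: add.commute)
    then have "P (Suc k) (t @ s)" using s(2) by (simp add: P_def Q_def)
    then show "\<exists>y. P (Suc k) y \<and> (\<exists>s\<in>tu m. y = t @ s)" using s(1) by blast
  qed
  then obtain f where f: "\<And>k. P k (f k)" "\<And>k. \<exists>s\<in>tu m. f (Suc k) = f k @ s" by blast
  then obtain s where s: "\<And>k. s k \<in> tu m" "\<And>k. f (Suc k) = f k @ s k" by metis
  have lf: "length (f k) = k * m" for k using f(1)[of k] by (simp add: P_def tuples_def)
  have pf: "pat m (R x) bs (f (length bs)) \<longleftrightarrow> (\<forall>i<length bs. R x (s i) = bs ! i)" for x bs
  proof (induction bs rule: rev_induct)
    case (snoc b bs)
    have "take m (s (length bs)) = s (length bs)" using s(1) by (simp add: tuples_def)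
    then show ?case using snoc by (auto simp: s(2) pat_append lf nth_append less_Suc_eq)
  qed simp
  have SHf: "SH k (f k)" for k
  proof -
    from f(1)[of k] have "\<exists>t'\<in>tu (0 * m). SH (k + 0) (f k @ t')" unfolding P_def by blast
    then show ?thesis by simp
  qed
  have S: "small (B \<union> (\<Union>i. set (s i)))"
    by (rule small_Un[OF B small_UN[OF card_nat]]) (use s(1) in \<open>auto simp: tuples_def\<close>)
  have "\<exists>x\<in>tu l. \<forall>i. R x (s i) = (i \<in> I)" for I :: "nat set"
  proof -
    define H where "H i x \<longleftrightarrow> R x (s i) = (i \<in> I)" for i x
    have "\<exists>x\<in>tu l. \<forall>P\<in>range H. P x"
    proof (rule sat_df[OF S])
      fix P' assume "P' \<in> range H"
      then obtain i where P': "P' = H i" ..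
      have "tm U (B \<union> (\<Union>i. set (s i))) l m (\<lambda>x. s i)"
        by (rule tm_const) (use s(1) in \<open>auto simp: tuples_def\<close>)
      then have 1: "df L U (B \<union> (\<Union>i. set (s i))) l (\<lambda>x. R x (s i))"
        by (intro df2_tm[OF df2_mono[OF R] tm_id]) auto
      then show "df L U (B \<union> (\<Union>i. set (s i))) l P'"
        unfolding P' H_def using df_not[OF 1] by (cases "i \<in> I") auto
    next
      fix F assume F: "finite F" "F \<subseteq> range H"
      from finite_subset_image[OF this] obtain S where S: "finite S" "F = H ` S" by (elim exE conjE)
      define M where "M = Suc (Max (insert 0 S))"
      have ltM: "i < M" if "i \<in> S" for i using that S by (simp add: M_def less_Suc_eq_le)
      have "map (\<lambda>i. i \<in> I) [0..<M] \<in> {bs. length bs = M}" by simp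
      from bspec[OF SHf[of M, unfolded SH_def] this]
      obtain x where x: "x \<in> tu l" "pat m (R x) (map (\<lambda>i. i \<in> I) [0..<M]) (f M)" ..
      then have "\<forall>i<M. H i x" using pf[of x "map (\<lambda>i. i \<in> I) [0..<M]"] by (simp add: H_def)
      then show "\<exists>v\<in>tu l. \<forall>P\<in>F. P v" using x(1) ltM S(2) by (intro bexI[of _ x]) auto
    qed
    then show ?thesis by (simp add: H_def)
  qed
  then have "\<forall>I. \<exists>x. x \<in> tu l \<and> (\<forall>i. R x (s i) = (i \<in> I))" by blast
  from choice[OF this] obtain b where b: "\<And>I. b I \<in> tu l" "\<And>I i. R (b I) (s i) = (i \<in> I)"
    by blast
  obtain e Q where e: "set e \<subseteq> B \<inter> Dom U" "df0 L U (l + m + length e) Q"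
    "\<And>v. v \<in> tu (l + m) \<Longrightarrow> R (take l v) (drop l v) \<longleftrightarrow> Q (v @ e)"
    using R unfolding df2_def df_def by blast
  \<comment> \<open>In \<open>has_IP\<close> the members of the sequence come first, whereas
    \<open>R\<close> takes them second.\<close>
  define js where "js = map ((+) m) [0..<l] @ [0..<m] @ map ((+) (m + l)) [0..<length e]"
  have "df0 L U (m + (l + length e)) (\<lambda>w. Q (map ((!) w) js))"
    by (rule df0_sel[OF e(2)]) (auto simp: js_def)
  then obtain \<phi> where \<phi>: "\<phi> \<in> forms L (m + (l + length e))"
    "\<And>v. v \<in> tu (m + (l + length e)) \<Longrightarrow> Q (map ((!) v) js) \<longleftrightarrow> holds U \<phi> v"
    unfolding df0_def by blast
  have "has_IP U m (l + length e) \<phi>"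
    unfolding has_IP_def
  proof (intro exI conjI allI)
    show "s i \<in> tu m" for i by (rule s(1))
    show be: "b I @ e \<in> tu (l + length e)" for I
      using b(1)[of I] e(1) by (auto simp: tuples_def)
    fix i I
    have "map ((!) (s i @ b I @ e)) js = (b I @ s i) @ e"
      using tuples_len[OF b(1)[of I]] tuples_len[OF s(1)[of i]]
      by (intro nth_equalityI) (auto simp: js_def nth_append add.commute diff_diff_left)
    then have "holds U \<phi> (s i @ b I @ e) \<longleftrightarrow> Q ((b I @ s i) @ e)"
      using \<phi>(2)[OF tuples_append[OF s(1)[of i] be[of I]]] by simp
    also have "\<dots> \<longleftrightarrow> R (b I) (s i)"
      using e(3)[OF tuples_append[OF b(1)[of I] s(1)[of i]]] tuples_len[OF b(1)[of I]] by simp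
    finally show "holds U \<phi> (s i @ b I @ e) \<longleftrightarrow> i \<in> I" using b(2) by simp
  qed
  then show False using nip \<phi>(1) unfolding NIP_def by blast
qed

text \<open>Otherwise alternation of every length is generic, since an ultrafilter decides it. By
  \<open>alt_to_pat\<close> all finitely many patterns of a given length are then realized along one
  tuple of \<open>A\<close>, against \<open>shatter_IP\<close>. The bound is positive because
  alternation zero times is always possible.\<close>

lemma alternation_bound:
  assumes R: "df2 L U B l m R" and B: "small B" and E: "uf A m E"
  shows "\<exists>K>0. eventually (\<lambda>c. \<not> (\<exists>x\<in>tu l. alt m (R x) K c)) (pw (E \<otimes>f E) K)"
proof -
  have "\<exists>K. eventually (\<lambda>c. \<not> (\<exists>x\<in>tu l. alt m (R x) K c)) (pw (E \<otimes>f E) K)"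
  proof (rule ccontr)
    assume "\<not> ?thesis"
    then have ev: "eventually (\<lambda>c. \<exists>x\<in>tu l. alt m (R x) N c) (pw (E \<otimes>f E) N)" for N
      using ultra_not[OF ultra_pw[OF ultra_fprod[OF uf_ultra[OF E] uf_ultra[OF E]]]] by simp
    show False
    proof (rule shatter_IP[OF R B])
      fix N
      have fin: "finite {bs :: bool list. length bs = N}"
        using finite_lists_length_eq[of "UNIV :: bool set" N] by simp
      have "eventually (\<lambda>t. \<forall>bs\<in>{bs. length bs = N}. \<exists>x\<in>tu l. pat m (R x) bs t) (pw E N)"
        by (rule eventually_ball_finite[OF fin]) (use alt_to_pat[OF E ev] in auto)
      from uf_happens[OF uf_pw[OF E] this]
      show "\<exists>t\<in>tu (N * m). \<forall>bs. length bs = N \<longrightarrow> (\<exists>x\<in>tu l. pat m (R x) bs t)"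
        using tA by blast
    qed
  qed
  then obtain K where K: "eventually (\<lambda>c. \<not> (\<exists>x\<in>tu l. alt m (R x) K c)) (pw (E \<otimes>f E) K)" ..
  have "K \<noteq> 0"
  proof
    assume "K = 0"
    with K show False using tu_ne[of l] by auto
  qed
  then show ?thesis using K by blast
qed

end

section \<open>Separating formulas\<close>

text \<open>The fields are the formula \<open>X(x; b)\<close> with its ultrafilter \<open>nE\<close>, the formula \<open>g(x, t)\<close> with
  \<open>nZ\<close>, and the formula \<open>I(x, z)\<close> with \<open>nG\<close>; \<open>nm\<close>, \<open>nt\<close>, \<open>nz\<close> are the lengths of \<open>b\<close>, \<open>t\<close>, \<open>z\<close>.\<close>

record 'u node =
  nm :: nat
  nX :: "'u list \<Rightarrow> 'u list \<Rightarrow> bool"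
  nE :: "'u list filter"
  nt :: nat
  nZ :: "'u list filter"
  ng :: "'u list \<Rightarrow> 'u list \<Rightarrow> bool"
  nz :: nat
  nG :: "'u list filter"
  nI :: "'u list \<Rightarrow> 'u list \<Rightarrow> bool"

locale type_setting = nip_setting L U \<kappa> A
  for L :: "('f, 'r) lang" and U :: "('f, 'r, 'u) struct" and \<kappa> :: "'k rel" and A :: "'u set" +
  fixes a :: "'u list"
  assumes a: "set a \<subseteq> Dom U"
begin

abbreviation n :: nat where "n \<equiv> length a"

lemma a_tu: "a \<in> tu n"
  using a by (simp add: tuples_def)

text \<open>A coheir-like condition: \<open>h(a; z)\<close> behaves over generic \<open>w\<close> as if \<open>z\<close> had been chosen from \<open>G\<close> first.\<close>

definition compatible :: "('u list \<Rightarrow> 'u list \<Rightarrow> bool) \<Rightarrow> nat \<Rightarrow> 'u list filter \<Rightarrow> bool" where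
  "compatible h k G \<longleftrightarrow> (\<forall>mw W T. uf A mw W \<longrightarrow> df L U A (k + mw) T \<longrightarrow>
     (\<forall>\<^sub>F z in G. \<forall>\<^sub>F w in W. T (z @ w)) \<longrightarrow>
     (\<forall>\<^sub>F w in W. \<exists>z\<in>tu k. h a z \<and> T (z @ w)))"

lemma compatibleD:
  "compatible h k G \<Longrightarrow> uf A mw W \<Longrightarrow> df L U A (k + mw) T \<Longrightarrow> \<forall>\<^sub>F z in G. \<forall>\<^sub>F w in W. T (z @ w) \<Longrightarrow>
     \<forall>\<^sub>F w in W. \<exists>z\<in>tu k. h a z \<and> T (z @ w)"
  unfolding compatible_def by blast

text \<open>This is the formula \<Theta> of the introduction, where \<open>y\<close> is the
  concatenation of \<open>b\<close> and \<open>t\<close>.\<close>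

definition Th :: "'u node \<Rightarrow> 'u list \<Rightarrow> 'u list \<Rightarrow> bool" where
  "Th M y z \<longleftrightarrow> (\<exists>x\<in>tu n. (nX M x (take (nm M) y) \<and> ng M x (drop (nm M) y)) \<and> nI M x z)"

text \<open>The last two conjuncts are the two orders of choice. The order \<open>b\<close>,
  \<open>t\<close>, \<open>z\<close> makes certificates generic; the order \<open>z\<close>,
  \<open>b\<close>, \<open>t\<close> allows a typical \<open>v\<close> to be fixed in
  \<open>A\<close> before \<open>b\<close> and \<open>t\<close> in the final argument.\<close>

definition is_node :: "'u node \<Rightarrow> bool" where
  "is_node M \<longleftrightarrow> uf A (nm M) (nE M) \<and> df2 L U A n (nm M) (nX M) \<and>
     uf A (nt M) (nZ M) \<and> df2 L U A n (nt M) (ng M) \<and>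
     uf A (nz M) (nG M) \<and> df2 L U A n (nz M) (nI M) \<and>
     compatible (nI M) (nz M) (nG M) \<and> (\<forall>\<^sub>F t in nZ M. ng M a t) \<and>
     (\<forall>\<^sub>F b in nE M. \<forall>\<^sub>F t in nZ M. \<forall>\<^sub>F z in nG M. \<not> Th M (b @ t) z) \<and>
     (\<forall>\<^sub>F z in nG M. \<forall>\<^sub>F b in nE M. \<forall>\<^sub>F t in nZ M. \<not> Th M (b @ t) z)"

text \<open>Take \<open>k\<close> maximal such that \<open>k\<close>-fold alternation is compatible, and let \<open>T\<close>, \<open>W\<close> witness the failure at
  \<open>k + 1\<close>.  Then \<open>xi(x, i)\<close>, true of \<open>a\<close>, says that no \<open>k + 1\<close> alternations \<open>c\<close> of \<open>x\<close> satisfy \<open>T(c, i)\<close>.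
  A block with \<open>X\<close> and a block without it, put before or after \<open>k\<close> alternations, violates this.\<close>

lemma node_exists:
  assumes E: "uf A m E" and X: "df2 L U A n m X" and nX: "\<forall>\<^sub>F b in E. \<not> X a b"
  shows "\<exists>M. is_node M \<and> nm M = m \<and> nX M = X \<and> nE M = E"
proof -
  let ?EE = "E \<otimes>f E"
  have EE: "uf A (2 * m) ?EE" using uf_fprod[OF E E] by (simp add: mult_2)
  note ultE = uf_ultra[OF E] and TE = uf_tuples[OF E]
  define J where "J k \<longleftrightarrow> compatible (\<lambda>x c. alt m (X x) k c) (k * (2 * m)) (pw ?EE k)" for k
  obtain K where K: "\<forall>\<^sub>F c in pw ?EE K. \<not> (\<exists>x\<in>tu n. alt m (X x) K c)"
    using alternation_bound[OF X small_A E] by blast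
  \<comment> \<open>Were alternation \<open>K\<close> times compatible, the formula excluding it for
    every \<open>x\<close> would hold at some tuple along which \<open>a\<close> itself
    alternates.\<close>
  have "\<not> J K"
  proof
    assume J: "J K"
    have "df L U A (K * (2 * m) + 0) (\<lambda>v. \<not> (\<exists>x\<in>tu n. alt m (X x) K v))"
    proof (intro df_not df_ex, rule df_alt[OF X])
      show "tm U A (K * (2 * m) + 0 + n) n (drop (K * (2 * m) + 0))"
        by (rule tm_eq, (rule tm_intros)+) simp
      show "tm U A (K * (2 * m) + 0 + n) (K * (2 * m)) (take (K * (2 * m) + 0))"
        by (rule tm_eq, (rule tm_intros)+) simp
    qed
    from compatibleD[OF J[unfolded J_def] uf_fnil this] K show False using a_tu by auto
  qed
  moreover have "J 0" by (simp add: J_def compatible_def)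
  ultimately obtain k where k: "J k" "\<not> J (Suc k)" by (metis nat_induct)
  let ?K = "k * (2 * m)" and ?K1 = "Suc k * (2 * m)"
  from k(2) obtain mw W T where W: "uf A mw W" and T: "df L U A (?K1 + mw) T"
    "\<forall>\<^sub>F z in pw ?EE (Suc k). \<forall>\<^sub>F w in W. T (z @ w)"
    and "\<not> (\<forall>\<^sub>F w in W. \<exists>z\<in>tu ?K1. alt m (X a) (Suc k) z \<and> T (z @ w))"
    unfolding J_def compatible_def by blast
  note ultW = uf_ultra[OF W] and TW = uf_tuples[OF W]
  define xi where "xi x i \<longleftrightarrow> \<not> (\<exists>c\<in>tu ?K1. alt m (X x) (Suc k) c \<and> T (c @ i))" for x i
  have xia: "\<forall>\<^sub>F i in W. xi a i"
    using \<open>\<not> (\<forall>\<^sub>F w in W. _ w)\<close> unfolding ultra_not[OF ultW] xi_def .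
  have dxi: "df2 L U A n mw xi"
    unfolding df2_def xi_def
  proof (intro df_not df_ex df_conj)
    let ?N = "n + mw + ?K1"
    show "df L U A ?N (\<lambda>w. alt m (X (take n (take (n + mw) w))) (Suc k) (drop (n + mw) w))"
    proof (rule df_alt[OF X])
      show "tm U A ?N n (\<lambda>w. take n (take (n + mw) w))"
        by (rule tm_eq, (rule tm_intros)+) simp
      show "tm U A ?N ?K1 (\<lambda>w. drop (n + mw) w)"
        by (rule tm_eq, (rule tm_intros)+) simp
    qed
    show "df L U A ?N (\<lambda>w. T (drop (n + mw) w @ drop n (take (n + mw) w)))"
      by (rule df_tm[OF T(1)], rule tm_eq, (rule tm_intros)+) simp
  qed
  \<comment> \<open>Here \<open>t\<close> consists of a block \<open>d\<close> without
    \<open>X\<close> and a tuple \<open>i\<close> with \<open>xi\<close>; \<open>z\<close> consists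
    of \<open>k\<close> alternations \<open>c\<close> and a tuple \<open>i'\<close> with
    \<open>xi\<close>. Both contain a copy of \<open>xi\<close>, because the copy chosen last is the
    one that is used.\<close>
  define M where "M = \<lparr>nm = m, nX = X, nE = E, nt = m + mw, nZ = E \<otimes>f W,
    ng = (\<lambda>x t. \<not> X x (take m t) \<and> xi x (drop m t)), nz = ?K + mw, nG = pw ?EE k \<otimes>f W,
    nI = (\<lambda>x z. alt m (X x) k (take ?K z) \<and> xi x (drop ?K z))\<rparr>"
  have sel: "nm M = m" "nX M = X" "nE M = E" "nt M = m + mw" "nZ M = E \<otimes>f W"
    "ng M = (\<lambda>x t. \<not> X x (take m t) \<and> xi x (drop m t))" "nz M = ?K + mw" "nG M = pw ?EE k \<otimes>f W"
    "nI M = (\<lambda>x z. alt m (X x) k (take ?K z) \<and> xi x (drop ?K z))"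
    by (simp_all add: M_def)
  have ufG: "uf A (?K + mw) (pw ?EE k \<otimes>f W)" by (rule uf_fprod[OF uf_pw[OF EE] W])
  have dng: "df2 L U A n (m + mw) (ng M)"
    unfolding df2_def sel
  proof (intro df_conj df_not)
    let ?N = "n + (m + mw)"
    show "df L U A ?N (\<lambda>w. X (take n w) (take m (drop n w)))"
      by (rule df2_tm[OF X]; rule tm_eq, (rule tm_intros)+; simp)
    show "df L U A ?N (\<lambda>w. xi (take n w) (drop m (drop n w)))"
      by (rule df2_tm[OF dxi]; rule tm_eq, (rule tm_intros)+; simp)
  qed
  have dnI: "df2 L U A n (?K + mw) (nI M)"
    unfolding df2_def sel
  proof (intro df_conj)
    let ?N = "n + (?K + mw)"
    show "df L U A ?N (\<lambda>w. alt m (X (take n w)) k (take ?K (drop n w)))"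
      by (rule df_alt[OF X]; rule tm_eq, (rule tm_intros)+; simp)
    show "df L U A ?N (\<lambda>w. xi (take n w) (drop ?K (drop n w)))"
      by (rule df2_tm[OF dxi]; rule tm_eq, (rule tm_intros)+; simp)
  qed
  \<comment> \<open>The ultrafilter \<open>W\<close> is first counted as part of the test
    ultrafilter; then a tuple \<open>i\<close> of \<open>A\<close> with \<open>xi a i\<close> is
    fixed and appended to the block.\<close>
  have JM: "compatible (nI M) (?K + mw) (pw ?EE k \<otimes>f W)"
    unfolding compatible_def
  proof (intro allI impI)
    fix mw' W' T'
    assume W': "uf A mw' W'" and T': "df L U A (?K + mw + mw') T'"
      "\<forall>\<^sub>F z in pw ?EE k \<otimes>f W. \<forall>\<^sub>F w in W'. T' (z @ w)"
    have "\<forall>\<^sub>F w in W \<otimes>f W'. \<exists>z\<in>tu ?K. alt m (X a) k z \<and> T' (z @ w)"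
      by (rule compatibleD[OF k(1)[unfolded J_def] uf_fprod[OF W W']])
        (use T' in \<open>simp_all add: add.assoc eventually_fprod\<close>)
    then have "\<forall>\<^sub>F i in W. \<forall>\<^sub>F w in W'. \<exists>z\<in>tu ?K. alt m (X a) k z \<and> T' (z @ i @ w)"
      by (simp add: eventually_fprod)
    from uf_happens[OF W eventually_conj[OF this xia]] obtain i where i: "i \<in> tuples A mw" "xi a i"
      "\<forall>\<^sub>F w in W'. \<exists>z\<in>tu ?K. alt m (X a) k z \<and> T' (z @ i @ w)" by (elim bexE conjE)
    from i(3) show "\<forall>\<^sub>F w in W'. \<exists>z\<in>tu (?K + mw). nI M a z \<and> T' (z @ w)"
    proof eventually_elim
      case (elim w)
      then obtain z where z: "z \<in> tu ?K" "alt m (X a) k z" "T' (z @ i @ w)" by (elim bexE conjE)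
      show ?case
      proof (intro bexI conjI)
        show "nI M a (z @ i)" using z i(2) tuples_len[OF z(1)] by (simp add: sel)
        show "T' ((z @ i) @ w)" using z(3) by simp
        show "z @ i \<in> tu (?K + mw)" by (rule tuples_append[OF z(1) tA[OF i(1)]])
      qed
    qed
  qed
  have "\<forall>\<^sub>F d in E. \<forall>\<^sub>F i in W. ng M a (d @ i)"
    using eventually_conj[OF TE nX]
  proof eventually_elim
    case (elim d)
    from xia show ?case by eventually_elim (use elim tuples_len[of d A m] in \<open>simp add: sel\<close>)
  qed
  then have nga: "\<forall>\<^sub>F t in nZ M. ng M a t" by (simp add: sel eventually_fprod)
  have T': "\<forall>\<^sub>F b in E. \<forall>\<^sub>F d in E. \<forall>\<^sub>F c in pw ?EE k. \<forall>\<^sub>F i in W. T (b @ d @ c @ i)"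
    using T(2) by (simp add: eventually_fprod)
  \<comment> \<open>The pair \<open>b\<close>, \<open>d\<close> is put before the alternations
    \<open>c\<close>, and \<open>xi\<close> is applied to the tuple \<open>i'\<close> that belongs
    to \<open>z\<close>.\<close>
  have gen1: "\<forall>\<^sub>F b in E. \<forall>\<^sub>F d in E. \<forall>\<^sub>F i in W. \<forall>\<^sub>F c in pw ?EE k. \<forall>\<^sub>F i' in W. \<not> Th M (b @ d @ i) (c @ i')"
    using TE T'
  proof eventually_elim
    case (elim b)
    note b = elim(1)
    from TE elim(2) show ?case
    proof eventually_elim
      case (elim d)
      note d = elim(1) and e = elim(2)
      from TW show ?case
      proof eventually_elim
        case (elim i)
        note i = elim
        from uf_tuples[OF uf_pw[OF EE]] e show ?case
        proof eventually_elim
          case (elim c)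
          note c = elim(1)
          from TW elim(2) show ?case
          proof eventually_elim
            case (elim i')
            show ?case
            proof
              assume "Th M (b @ d @ i) (c @ i')"
              then obtain x where x: "X x b" "\<not> X x d" "alt m (X x) k c" "xi x i'"
                using tuples_len[OF b] tuples_len[OF d] tuples_len[OF c] by (auto simp: Th_def sel)
              have "alt m (X x) (Suc k) (b @ d @ c)"
                using x tuples_len[OF b] tuples_len[OF d] by simp
              moreover have "b @ d @ c \<in> tu ?K1"
                using tuples_append[OF b tuples_append[OF d c]] tA by (simp add: mult_2 add.assoc)
              ultimately show False using x(4) elim(2) unfolding xi_def by auto
            qed
          qed
        qed
      qed
    qed
  qed
  have T'': "\<forall>\<^sub>F c in pw ?EE k. \<forall>\<^sub>F b in E. \<forall>\<^sub>F d in E. \<forall>\<^sub>F i in W. T (c @ b @ d @ i)"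
    using T(2) unfolding pw_Suc_right by (simp add: eventually_fprod)
  \<comment> \<open>Now the pair follows \<open>c\<close>, and \<open>xi\<close> is applied to the
    tuple \<open>i\<close> that belongs to \<open>t\<close>.\<close>
  have gen2: "\<forall>\<^sub>F c in pw ?EE k. \<forall>\<^sub>F i' in W. \<forall>\<^sub>F b in E. \<forall>\<^sub>F d in E. \<forall>\<^sub>F i in W. \<not> Th M (b @ d @ i) (c @ i')"
    using uf_tuples[OF uf_pw[OF EE]] T''
  proof eventually_elim
    case (elim c)
    note c = elim(1) and e = elim(2)
    from TW show ?case
    proof eventually_elim
      case (elim i')
      from TE e show ?case
      proof eventually_elim
        case (elim b)
        note b = elim(1)
        from TE elim(2) show ?case
        proof eventually_elim
          case (elim d)
          note d = elim(1)
          from TW elim(2) show ?case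
          proof eventually_elim
            case (elim i)
            show ?case
            proof
              assume "Th M (b @ d @ i) (c @ i')"
              then obtain x where x: "X x b" "\<not> X x d" "alt m (X x) k c" "xi x i"
                using tuples_len[OF b] tuples_len[OF d] tuples_len[OF c] by (auto simp: Th_def sel)
              have "alt m (X x) (k + 1) (c @ b @ d)"
                unfolding alt_append[OF tuples_len[OF c]]
                using x tuples_len[OF b] tuples_len[OF d] by simp
              moreover have "c @ b @ d \<in> tu ?K1"
                using tuples_append[OF c tuples_append[OF b d]] tA by (simp add: mult_2 add_ac)
              ultimately show False using x(4) elim(2) unfolding xi_def by auto
            qed
          qed
        qed
      qed
    qed
  qed
  have "is_node M"
    unfolding is_node_def
    using E X W ufG dng dnI JM nga gen1 gen2
    by (simp add: sel(1-5,7,8) eventually_fprod uf_fprod)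
  then show ?thesis using sel by blast
qed

section \<open>A generic ultrafilter extending the type of a\<close>

definition realizes_uf :: "'u list filter \<Rightarrow> nat \<Rightarrow> 'u list \<Rightarrow> bool" where
  "realizes_uf Y k y \<longleftrightarrow> y \<in> tu k \<and> (\<forall>P. df L U A k P \<longrightarrow> (\<forall>\<^sub>F y in Y. P y) \<longrightarrow> P y)"

lemma realizes_ufD: "realizes_uf Y k y \<Longrightarrow> df L U A k P \<Longrightarrow> \<forall>\<^sub>F y in Y. P y \<Longrightarrow> P y"
  unfolding realizes_uf_def by blast

text \<open>Saturation reduces the claim to a single \<open>T\<close>, because the formulas that
  hold generically are closed under finite conjunction.\<close>

lemma realizes_uf_ext:
  assumes w: "realizes_uf W mw w" and C: "small C" and \<Phi>: "df L U C k \<Phi>"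
    and ex: "\<And>T. df L U A (k + mw) T \<Longrightarrow> \<forall>\<^sub>F z in G. \<forall>\<^sub>F w in W. T (z @ w) \<Longrightarrow> \<exists>z\<in>tu k. \<Phi> z \<and> T (z @ w)"
  shows "\<exists>z\<in>tu k. \<Phi> z \<and> realizes_uf (G \<otimes>f W) (k + mw) (z @ w)"
proof -
  have wt: "w \<in> tu mw" using w by (simp add: realizes_uf_def)
  define \<T> where "\<T> = {T. df L U A (k + mw) T \<and> (\<forall>\<^sub>F z in G. \<forall>\<^sub>F w in W. T (z @ w))}"
  define H where "H T z \<longleftrightarrow> \<Phi> z \<and> T (z @ w)" for T z
  let ?B = "A \<union> C \<union> set w"
  have "\<exists>z\<in>tu k. \<forall>P\<in>H ` \<T>. P z"
  proof (rule sat_df)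
    show "small ?B" by (intro small_Un small_A C small_set[OF wt])
    fix P assume "P \<in> H ` \<T>"
    then obtain T where T: "P = H T" "df L U A (k + mw) T" unfolding \<T>_def by blast
    have "tm U ?B k mw (\<lambda>z. w)" by (rule tm_const) (use wt in \<open>auto simp: tuples_def\<close>)
    from tm_append[OF tm_id this] have "df L U ?B k (\<lambda>z. T (z @ w))"
      by (rule df_tm[OF df_mono[OF T(2)], rotated]) auto
    moreover have "df L U ?B k \<Phi>" by (rule df_mono[OF \<Phi>]) auto
    ultimately show "df L U ?B k P" unfolding T(1) H_def by (rule df_conj[rotated])
  next
    fix F assume "finite F" "F \<subseteq> H ` \<T>"
    from finite_subset_image[OF this] obtain S where S: "S \<subseteq> \<T>" "finite S" "F = H ` S" by (elim exE conjE)
    have 1: "df L U A (k + mw) (\<lambda>v. \<forall>T\<in>S. T v)"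
      by (rule df_Ball_finite[OF S(2)]) (use S(1) in \<open>auto simp: \<T>_def\<close>)
    have "\<forall>\<^sub>F z in G. \<forall>T\<in>S. \<forall>\<^sub>F w in W. T (z @ w)"
      by (rule eventually_ball_finite[OF S(2)]) (use S(1) in \<open>auto simp: \<T>_def\<close>)
    then have "\<forall>\<^sub>F z in G. \<forall>\<^sub>F w in W. \<forall>T\<in>S. T (z @ w)"
      by (rule eventually_mono) (rule eventually_ball_finite[OF S(2)])
    from ex[OF 1 this] show "\<exists>z\<in>tu k. \<forall>P\<in>F. P z" unfolding S(3) H_def by blast
  qed
  then obtain z where z: "z \<in> tu k" "\<And>T. T \<in> \<T> \<Longrightarrow> H T z" by blast
  have "(\<lambda>v. True) \<in> \<T>" by (simp add: \<T>_def df_const)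
  from z(2)[OF this] have "\<Phi> z" by (simp add: H_def)
  moreover have "realizes_uf (G \<otimes>f W) (k + mw) (z @ w)"
    unfolding realizes_uf_def
  proof (intro conjI allI impI)
    show "z @ w \<in> tu (k + mw)" by (rule tuples_append[OF z(1) wt])
    fix P assume "df L U A (k + mw) P" "\<forall>\<^sub>F y in G \<otimes>f W. P y"
    then have "P \<in> \<T>" by (simp add: \<T>_def eventually_fprod)
    from z(2)[OF this] show "P (z @ w)" by (simp add: H_def)
  qed
  ultimately show ?thesis using z(1) by blast
qed

text \<open>The witness for a finite part is sought in \<open>A\<close>: for \<open>z\<close> in
  \<open>A\<close>, the statement \<open>T (z @ w)\<close> is a condition over \<open>A\<close> on
  \<open>w\<close> alone, which \<open>w\<close> satisfies because it is generic.\<close>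

lemma realizes_uf_generic:
  assumes w: "realizes_uf W mw w" and G: "uf A k G" and g: "df L U (Dom U) k g" "\<forall>\<^sub>F z in G. g z"
  shows "\<exists>z\<in>tu k. g z \<and> realizes_uf (G \<otimes>f W) (k + mw) (z @ w)"
proof -
  obtain C where C: "finite C" "C \<subseteq> Dom U" "df L U C k g" using df_finite_params[OF g(1)] by auto
  show ?thesis
  proof (rule realizes_uf_ext[OF w small_finite[OF C(1,2)] C(3)])
    fix T assume T: "df L U A (k + mw) T" "\<forall>\<^sub>F z in G. \<forall>\<^sub>F w in W. T (z @ w)"
    have "\<forall>\<^sub>F z in G. g z \<and> T (z @ w)"
      using g(2) T(2) uf_tuples[OF G]
    proof eventually_elim
      case (elim z)
      have "tm U A mw k (\<lambda>w. z)" by (rule tm_const[OF elim(3) tA[OF elim(3)]])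
      from df_tm[OF T(1) tm_append[OF this tm_id]] have "df L U A mw (\<lambda>w. T (z @ w))" .
      from realizes_ufD[OF w this elim(2)] elim(1) show ?case by blast
    qed
    from uf_happens[OF G this] show "\<exists>z\<in>tu k. g z \<and> T (z @ w)" using tA by blast
  qed
qed

text \<open>In a condition the formula \<open>h\<close> is over \<open>A\<close> and compatible with
  \<open>G\<close>, while \<open>g\<close> may use any parameters of the model. Meeting all
  conditions is what remains of the compatibility of \<open>a\<close> for a generic \<open>x\<close>
  over larger sets.\<close>

type_synonym 'v condition = "('v list \<Rightarrow> 'v list \<Rightarrow> bool) \<times> nat \<times> 'v list filter \<times> ('v list \<Rightarrow> bool)"

definition is_condition :: "'u condition \<Rightarrow> bool" where
  "is_condition = (\<lambda>(h, k, G, g). uf A k G \<and> df2 L U A n k h \<and> compatible h k G \<and> df L U (Dom U) k g \<and> (\<forall>\<^sub>F z in G. g z))"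

definition meets :: "'u list \<Rightarrow> 'u condition \<Rightarrow> bool" where
  "meets x = (\<lambda>(h, k, G, g). \<exists>z\<in>tu k. h x z \<and> g z)"

lemma df_meets:
  assumes "is_condition v"
  shows "df L U (Dom U) n (\<lambda>x. meets x v)"
proof -
  obtain h k G g where v: "v = (h, k, G, g)" by (cases v)
  have "df2 L U A n k h" and g: "df L U (Dom U) k g" using assms by (auto simp: is_condition_def v)
  then have h: "df2 L U (Dom U) n k h" using df2_mono A(1) by blast
  show ?thesis unfolding meets_def v prod.case
  proof (intro df_ex df_conj)
    show "df L U (Dom U) (n + k) (\<lambda>w. h (take n w) (drop n w))" using h by (simp add: df2_def)
    show "df L U (Dom U) (n + k) (\<lambda>w. g (drop n w))"
      by (rule df_tm[OF g], rule tm_eq, (rule tm_intros)+) simp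
  qed
qed

text \<open>If no admissible \<open>x\<close> meets \<open>(h, k, G, g)\<close>, then \<open>g\<close> fails on every \<open>z\<close> with \<open>h(x, z)\<close> for some admissible
  \<open>x\<close>.  Alternating such \<open>z\<close> with generic realizations of \<open>G\<close>, on which \<open>g\<close> holds, contradicts NIP.\<close>

lemma conditions_consistent:
  "(\<forall>v\<in>set V. is_condition v) \<Longrightarrow> uf A my Y \<Longrightarrow> realizes_uf Y my y \<Longrightarrow> df2 L U A n my R \<Longrightarrow> \<forall>\<^sub>F y in Y. R a y \<Longrightarrow>
     \<exists>x\<in>tu n. R x y \<and> (\<forall>v\<in>set V. meets x v)"
proof (induction V arbitrary: my Y y R)
  case Nil
  have "df L U A my (\<lambda>y. \<exists>x\<in>tu n. R x y)"
    by (intro df_ex, rule df2_tm[OF Nil.prems(4)]; rule tm_eq, (rule tm_intros)+; simp)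
  moreover have "\<forall>\<^sub>F y in Y. \<exists>x\<in>tu n. R x y"
    using Nil.prems(5) by eventually_elim (rule bexI[OF _ a_tu])
  ultimately have "\<exists>x\<in>tu n. R x y" by (rule realizes_ufD[OF Nil.prems(3)])
  then show ?case by simp
next
  case (Cons v V)
  obtain h k G g where v: "v = (h, k, G, g)" by (cases v)
  have G: "uf A k G" and h: "df2 L U A n k h" and J: "compatible h k G"
    and g: "df L U (Dom U) k g" "\<forall>\<^sub>F z in G. g z" using Cons.prems(1) by (auto simp: is_condition_def v)
  have V: "\<forall>v\<in>set V. is_condition v" using Cons.prems(1) by simp
  note R = Cons.prems(4,5)
  have yt: "y \<in> tu my" using Cons.prems(3) by (simp add: realizes_uf_def)
  \<comment> \<open>The parameters of \<open>g\<close> are made variable, so that the bound on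
    alternation is a formula over \<open>A\<close> and passes to realizations.\<close>
  obtain e Q where e: "set e \<subseteq> Dom U" "df0 L U (k + length e) Q"
    "\<And>v. v \<in> tu k \<Longrightarrow> g v \<longleftrightarrow> Q (v @ e)" using g(1) unfolding df_def by auto
  define g' where "g' e z = Q (z @ e)" for e z
  have g': "g z \<longleftrightarrow> g' e z" if "z \<in> tu k" for z using e(3)[OF that] by (simp add: g'_def)
  have et: "e \<in> tu (length e)" using e(1) by (simp add: tuples_def)
  have dQ: "df L U A (k + length e) Q"
    unfolding df_def using e(2) by (intro exI[of _ "[]"] exI[of _ Q]) simp
  have dg': "df2 L U A (length e) k g'"
    unfolding df2_def g'_def by (rule df_tm[OF dQ], rule tm_eq, (rule tm_intros)+) simp
  obtain K where K: "\<forall>\<^sub>F c in pw (G \<otimes>f G) K. \<not> (\<exists>x\<in>tu (length e). alt k (g' x) K c)"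
    using alternation_bound[OF dg' small_A G] by blast
  have basic: "uf A (2 * k) (G \<otimes>f G)" using uf_fprod[OF G G] by (simp add: mult_2)
  show ?case
  proof (rule ccontr)
    assume "\<not> ?case"
    then have no: "\<not> g z" if "x \<in> tu n" "R x y" "\<forall>v\<in>set V. meets x v" "z \<in> tu k" "h x z" for x z
      using that by (auto simp: v meets_def)
    obtain C where C: "finite C" "C \<subseteq> Dom U" "df L U C n (\<lambda>x. \<forall>v\<in>set V. meets x v)"
    proof -
      have "df L U (Dom U) n (\<lambda>x. \<forall>v\<in>set V. meets x v)"
        by (rule df_Ball_finite) (use V df_meets in auto)
      from df_finite_params[OF this] that show ?thesis by auto
    qed
    \<comment> \<open>Each round puts a pair in front: a block \<open>z\<close> matched with an
      admissible \<open>x\<close>, where \<open>g\<close> fails by assumption, and before it a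
      generic block where \<open>g\<close> holds.\<close>
    have chain: "\<exists>c\<in>tu (j * (2 * k)). alt k (g' e) j c \<and> realizes_uf (pw (G \<otimes>f G) j \<otimes>f Y) (j * (2 * k) + my) (c @ y)" for j
    proof (induction j)
      case 0
      show ?case using Cons.prems(3) by simp
    next
      case (Suc j)
      let ?j = "j * (2 * k)"
      obtain c where c: "c \<in> tu ?j" "alt k (g' e) j c"
        "realizes_uf (pw (G \<otimes>f G) j \<otimes>f Y) (?j + my) (c @ y)" using Suc.IH by blast
      let ?W = "pw (G \<otimes>f G) j \<otimes>f Y" and ?m = "?j + my"
      have W: "uf A ?m ?W" by (rule uf_fprod[OF uf_pw[OF basic] Cons.prems(2)])
      define \<Phi> where "\<Phi> z \<longleftrightarrow> (\<exists>x\<in>tu n. R x y \<and> (\<forall>v\<in>set V. meets x v) \<and> h x z)" for z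
      have "\<exists>z\<in>tu k. \<Phi> z \<and> realizes_uf (G \<otimes>f ?W) (k + ?m) (z @ c @ y)"
      proof (rule realizes_uf_ext[OF c(3)])
        let ?C = "A \<union> (C \<union> set y)"
        show "small ?C" by (intro small_Un small_A small_finite[OF C(1,2)] small_set[OF yt])
        show "df L U ?C k \<Phi>" unfolding \<Phi>_def
        proof (intro df_ex df_conj)
          have "tm U ?C (k + n) my (\<lambda>w. y)" by (rule tm_const) (use yt in \<open>auto simp: tuples_def\<close>)
          then show "df L U ?C (k + n) (\<lambda>w. R (drop k w) y)"
            by (rule df2_tm[OF df2_mono[OF R(1)], rotated 2], simp) (rule tm_eq, (rule tm_intros)+, simp)
          have C': "df L U ?C n (\<lambda>x. \<forall>v\<in>set V. meets x v)" by (rule df_mono[OF C(3)]) auto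
          show "df L U ?C (k + n) (\<lambda>w. \<forall>v\<in>set V. meets (drop k w) v)"
            by (rule df_tm[OF C', of "k + n" "drop k"], rule tm_eq, (rule tm_intros)+) simp
          show "df L U ?C (k + n) (\<lambda>w. h (drop k w) (take k w))"
            by (rule df2_tm[OF df2_mono[OF h]], simp; rule tm_eq, (rule tm_intros)+; simp)
        qed
        fix T assume T: "df L U A (k + ?m) T" "\<forall>\<^sub>F z in G. \<forall>\<^sub>F w in ?W. T (z @ w)"
        \<comment> \<open>Compatibility of \<open>h\<close> makes \<open>R'\<close> hold generically
          at \<open>a\<close>. The induction hypothesis then supplies an admissible \<open>x\<close>
          together with the block \<open>z\<close>.\<close>
        define R' where "R' x w \<longleftrightarrow> R x (drop ?j w) \<and> (\<exists>z\<in>tu k. h x z \<and> T (z @ w))" for x w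
        have R': "df2 L U A n ?m R'" unfolding df2_def R'_def
        proof (intro df_conj df_ex)
          show "df L U A (n + ?m) (\<lambda>w. R (take n w) (drop ?j (drop n w)))"
            by (rule df2_tm[OF R(1)]; rule tm_eq, (rule tm_intros)+; simp)
          show "df L U A (n + ?m + k) (\<lambda>w. h (take n (take (n + ?m) w)) (drop (n + ?m) w))"
            by (rule df2_tm[OF h]; rule tm_eq, (rule tm_intros)+; simp)
          show "df L U A (n + ?m + k) (\<lambda>w. T (drop (n + ?m) w @ drop n (take (n + ?m) w)))"
            by (rule df_tm[OF T(1)]; rule tm_eq, (rule tm_intros)+; simp)
        qed
        have "\<forall>\<^sub>F w in ?W. R a (drop ?j w)"
          unfolding eventually_fprod using uf_tuples[OF uf_pw[OF basic]]
          by eventually_elim (use R(2) in \<open>simp add: tuples_def\<close>)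
        then have "\<forall>\<^sub>F w in ?W. R' a w"
          unfolding R'_def using compatibleD[OF J W T] by (rule eventually_conj)
        from Cons.IH[OF V W c(3) R' this] obtain x where x: "x \<in> tu n" "R' x (c @ y)" "\<forall>v\<in>set V. meets x v"
          by (elim bexE conjE)
        then show "\<exists>z\<in>tu k. \<Phi> z \<and> T (z @ c @ y)"
          using tuples_len[OF c(1)] unfolding R'_def \<Phi>_def by auto
      qed
      then obtain z where z: "z \<in> tu k" "\<Phi> z" "realizes_uf (G \<otimes>f ?W) (k + ?m) (z @ c @ y)" by (elim bexE conjE)
      have "\<not> g z" using z(1,2) no unfolding \<Phi>_def by blast
      from realizes_uf_generic[OF z(3) G g] obtain \<zeta> where \<zeta>: "\<zeta> \<in> tu k" "g \<zeta>"
        "realizes_uf (G \<otimes>f (G \<otimes>f ?W)) (k + (k + ?m)) (\<zeta> @ z @ c @ y)" by (elim bexE conjE)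
      show ?case
      proof (intro bexI conjI)
        show "alt k (g' e) (Suc j) (\<zeta> @ z @ c)"
          using g'[OF \<zeta>(1)] g'[OF z(1)] \<zeta>(2) \<open>\<not> g z\<close> tuples_len[OF \<zeta>(1)] tuples_len[OF z(1)] c(2) by simp
        show "realizes_uf (pw (G \<otimes>f G) (Suc j) \<otimes>f Y) (Suc j * (2 * k) + my) ((\<zeta> @ z @ c) @ y)"
        proof -
          have e1: "Suc j * (2 * k) + my = k + (k + ?m)" by (simp add: mult_2)
          show ?thesis unfolding e1 using \<zeta>(3) by (simp add: fprod_assoc)
        qed
        show "\<zeta> @ z @ c \<in> tu (Suc j * (2 * k))"
          using tuples_append[OF \<zeta>(1) tuples_append[OF z(1) c(1)]] by (simp add: mult_2 add_ac)
      qed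
    qed
    from chain[of K] obtain c where c: "c \<in> tu (K * (2 * k))" "alt k (g' e) K c"
      "realizes_uf (pw (G \<otimes>f G) K \<otimes>f Y) (K * (2 * k) + my) (c @ y)" by (elim bexE conjE)
    \<comment> \<open>The tuple \<open>c\<close> realizes a power of \<open>G \<otimes>f G\<close>
      over \<open>A\<close>, so the generic bound on alternation applies to it; but \<open>e\<close>
      alternates along it \<open>K\<close> times.\<close>
    have "\<not> (\<exists>x\<in>tu (length e). alt k (g' x) K (take (K * (2 * k)) (c @ y)))"
    proof (rule realizes_ufD[OF c(3)])
      show "df L U A (K * (2 * k) + my) (\<lambda>v. \<not> (\<exists>x\<in>tu (length e). alt k (g' x) K (take (K * (2 * k)) v)))"
        by (intro df_not df_ex, rule df_alt[OF dg']; rule tm_eq, (rule tm_intros)+; simp)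
      show "\<forall>\<^sub>F v in pw (G \<otimes>f G) K \<otimes>f Y. \<not> (\<exists>x\<in>tu (length e). alt k (g' x) K (take (K * (2 * k)) v))"
        unfolding eventually_fprod using uf_tuples[OF uf_pw[OF basic]] K
        by eventually_elim (simp add: tuples_def)
    qed
    then show False using c(1,2) et tuples_len[OF c(1)] by auto
  qed
qed

text \<open>The finite intersection property is \<open>conditions_consistent\<close> with the empty
  tuple for \<open>y\<close>; finitely many formulas over \<open>A\<close> true at \<open>a\<close>
  are put into \<open>R\<close>.\<close>

lemma exists_generic_ultrafilter:
  "\<exists>P. ultra P \<and> (\<forall>\<^sub>F x in P. x \<in> tu n) \<and>
     (\<forall>Q. df L U A n Q \<longrightarrow> Q a \<longrightarrow> (\<forall>\<^sub>F x in P. Q x)) \<and>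
     (\<forall>v. is_condition v \<longrightarrow> (\<forall>\<^sub>F x in P. meets x v))"
proof -
  define \<F>1 where "\<F>1 = {Q. df L U A n Q \<and> Q a}"
  define \<F>2 where "\<F>2 = (\<lambda>v x. meets x v) ` Collect is_condition"
  have "\<exists>P. ultra P \<and> (\<forall>Q\<in>insert (\<lambda>x. x \<in> tu n) (\<F>1 \<union> \<F>2). eventually Q P)"
  proof (rule ultra_of_fip)
    fix F assume F: "finite F" "F \<subseteq> insert (\<lambda>x. x \<in> tu n) (\<F>1 \<union> \<F>2)"
    have "finite (F \<inter> \<F>2)" "F \<inter> \<F>2 \<subseteq> (\<lambda>v x. meets x v) ` Collect is_condition" using F(1) by (auto simp: \<F>2_def)
    from finite_subset_image[OF this] obtain S where S: "S \<subseteq> Collect is_condition" "finite S"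
      "F \<inter> \<F>2 = (\<lambda>v x. meets x v) ` S" by (elim exE conjE)
    obtain V where V: "set V = S" using finite_list[OF S(2)] ..
    have 1: "df L U A n (\<lambda>x. \<forall>Q\<in>F \<inter> \<F>1. Q x)"
      by (rule df_Ball_finite) (use F(1) in \<open>auto simp: \<F>1_def\<close>)
    have "\<exists>x\<in>tu n. (\<forall>Q\<in>F \<inter> \<F>1. Q x) \<and> (\<forall>v\<in>set V. meets x v)"
    proof (rule conditions_consistent[where my = 0 and Y = fnil and y = "[]" and R = "\<lambda>x y. \<forall>Q\<in>F \<inter> \<F>1. Q x"])
      show "\<forall>v\<in>set V. is_condition v" using S(1) V by auto
      show "uf A 0 fnil" by (rule uf_fnil)
      show "realizes_uf fnil 0 []" by (simp add: realizes_uf_def)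
      show "df2 L U A n 0 (\<lambda>x y. \<forall>Q\<in>F \<inter> \<F>1. Q x)"
        unfolding df2_def by (rule df_tm[OF 1, of "n + 0" "take n"], rule tm_eq, (rule tm_intros)+) simp
      show "\<forall>\<^sub>F y in fnil. \<forall>Q\<in>F \<inter> \<F>1. Q a" by (simp add: \<F>1_def)
    qed
    then obtain x where x: "x \<in> tu n" "\<forall>Q\<in>F \<inter> \<F>1. Q x" "\<forall>v\<in>S. meets x v" unfolding V by (elim bexE conjE)
    have "\<forall>Q\<in>F \<inter> \<F>2. Q x" unfolding S(3) using x(3) by simp
    then have "\<forall>Q\<in>F. Q x" using x(1,2) F(2) by auto
    then show "\<exists>x. \<forall>Q\<in>F. Q x" ..
  qed
  then obtain P where P: "ultra P" "\<And>Q. Q \<in> insert (\<lambda>x. x \<in> tu n) (\<F>1 \<union> \<F>2) \<Longrightarrow> eventually Q P" by blast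
  have "\<forall>\<^sub>F x in P. x \<in> tu n" by (rule P(2)) simp
  moreover have "\<forall>\<^sub>F x in P. Q x" if "df L U A n Q" "Q a" for Q
    by (rule P(2)) (use that in \<open>simp add: \<F>1_def\<close>)
  moreover have "\<forall>\<^sub>F x in P. meets x v" if "is_condition v" for v
    by (rule P(2)) (use that in \<open>auto simp: \<F>2_def\<close>)
  ultimately show ?thesis using P(1) by (intro exI[of _ P]) simp
qed

end

section \<open>Interleaved laws\<close>

text \<open>In \<open>law G k K i\<close> the first \<open>i\<close> blocks are interleaved with the following \<open>K\<close> ones: it is the law
  of \<open>(c\<^sub>0, \<dots>, c\<^sub>i\<^sub>-\<^sub>1, u\<^sub>0, \<dots>, u\<^sub>K\<^sub>-\<^sub>1)\<close> chosen in the order \<open>c\<^sub>0, u\<^sub>0, c\<^sub>1, u\<^sub>1, \<dots>\<close>.\<close>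

primrec law :: "'u list filter \<Rightarrow> nat \<Rightarrow> nat \<Rightarrow> nat \<Rightarrow> 'u list filter" where
  "law G k 0 i = fnil"
| "law G k (Suc K) i = (case i of 0 \<Rightarrow> G \<otimes>f law G k K 0
     | Suc j \<Rightarrow> fbind G (\<lambda>c. fbind G (\<lambda>u.
         filtermap (\<lambda>v. c @ take (j * k) v @ u @ drop (j * k) v) (law G k K j))))"

lemma law_0: "law G k K 0 = pw G K"
  by (induction K) simp_all

lemma eventually_law_Suc:
  "eventually P (law G k (Suc K) (Suc j)) \<longleftrightarrow>
     (\<forall>\<^sub>F c in G. \<forall>\<^sub>F u in G. \<forall>\<^sub>F v in law G k K j. P (c @ take (j * k) v @ u @ drop (j * k) v))"
  by (simp add: eventually_fbind eventually_filtermap)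

lemma uf_law:
  assumes G: "uf A k G"
  shows "i \<le> K \<Longrightarrow> uf A (i * k + K * k) (law G k K i)"
proof (induction K arbitrary: i)
  case (Suc K)
  show ?case
  proof (cases i)
    case 0
    then show ?thesis using uf_pw[OF G, of "Suc K"] by (simp only: law_0 0) simp
  next
    case (Suc j)
    have IH: "uf A (j * k + K * k) (law G k K j)" using Suc.IH[of j] Suc.prems Suc by simp
    have "ultra (law G k (Suc K) (Suc j))"
      by (simp, intro ultra_fbind always_eventually allI ultra_filtermap uf_ultra[OF IH] uf_ultra[OF G])
    moreover have "\<forall>\<^sub>F v in law G k (Suc K) (Suc j). v \<in> tuples A (Suc j * k + Suc K * k)"
      unfolding eventually_law_Suc using uf_tuples[OF G]
    proof eventually_elim
      case (elim c)
      note c = this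
      from uf_tuples[OF G] show ?case
      proof eventually_elim
        case (elim u)
        note u = this
        from uf_tuples[OF IH] show ?case
        proof eventually_elim
          case (elim v)
          from tuples_append[OF c tuples_append[OF tuples_take[OF elim] tuples_append[OF u tuples_drop[OF elim]]]]
          show ?case by (simp add: add_ac)
        qed
      qed
    qed
    ultimately show ?thesis using Suc by (simp add: uf_def)
  qed
qed (simp add: uf_fnil)

text \<open>In \<open>law\<close> the first positive and the first negative block are chosen before
  everything else, exactly as in \<open>pw (G \<otimes>f G)\<close>. Fixing them restricts
  \<open>C\<close> to the \<open>y\<close> that alternate there.\<close>

lemma law_alt2:
  assumes G: "uf A k G"
  shows "\<forall>\<^sub>F w in pw (G \<otimes>f G) K. \<not> (\<exists>y\<in>C. alt k (R y) K w) \<Longrightarrow>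
    \<forall>\<^sub>F v in law G k K K. \<not> (\<exists>y\<in>C. alt2 k (R y) K (take (K * k) v) (drop (K * k) v))"
proof (induction K arbitrary: C)
  case (Suc K)
  have "\<forall>\<^sub>F c in G. \<forall>\<^sub>F u in G. \<forall>\<^sub>F w in pw (G \<otimes>f G) K. \<not> (\<exists>y\<in>C. alt k (R y) (Suc K) (c @ u @ w))"
    using Suc.prems by (simp only: pw.simps eventually_fprod append_assoc)
  with uf_tuples[OF G] show ?case
    unfolding eventually_law_Suc
  proof eventually_elim
    case (elim c)
    note c = elim(1)
    from uf_tuples[OF G] elim(2) show ?case
    proof eventually_elim
      case (elim u)
      note u = elim(1)
      have "\<forall>\<^sub>F w in pw (G \<otimes>f G) K. \<not> (\<exists>y\<in>{y\<in>C. R y c \<and> \<not> R y u}. alt k (R y) K w)"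
        using elim(2) by eventually_elim (use tuples_len[OF c] tuples_len[OF u] in simp)
      from uf_tuples[OF uf_law[OF G order_refl]] Suc.IH[OF this] show ?case
      proof eventually_elim
        case (elim v)
        have l: "length v = K * k + K * k" using elim(1) by (simp add: tuples_def)
        have 1: "take (Suc K * k) (c @ take (K * k) v @ u @ drop (K * k) v) = c @ take (K * k) v"
          "drop (Suc K * k) (c @ take (K * k) v @ u @ drop (K * k) v) = u @ drop (K * k) v"
          using l tuples_len[OF c] by simp_all
        show ?case unfolding 1 using elim(2) tuples_len[OF c] tuples_len[OF u] by simp
      qed
    qed
  qed
qed simp

definition matches :: "('u list \<Rightarrow> 'u list \<Rightarrow> bool) \<Rightarrow> nat \<Rightarrow> nat \<Rightarrow> (nat \<Rightarrow> 'u list) \<Rightarrow> 'u list \<Rightarrow> bool" where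
  "matches I k i b c \<longleftrightarrow> (\<forall>j<i. I (b j) (take k (drop (j * k) c)))"

lemma matches_snoc:
  assumes "length c = i * k" "length z = k"
  shows "matches I k (Suc i) b (c @ z) \<longleftrightarrow> matches I k i b c \<and> I (b i) z"
proof -
  have 1: "take k (drop (j * k) (c @ z)) = take k (drop (j * k) c)" if "j < i" for j
  proof -
    have "Suc j * k \<le> i * k" using that by (intro mult_le_mono1) simp
    then show ?thesis using assms(1) by simp
  qed
  have 2: "take k (drop (i * k) (c @ z)) = z" using assms by simp
  have "(\<forall>j<i. I (b j) (take k (drop (j * k) (c @ z)))) \<longleftrightarrow> (\<forall>j<i. I (b j) (take k (drop (j * k) c)))"
    by (intro all_cong) (simp only: 1)
  then show ?thesis unfolding matches_def All_less_Suc 2 by blast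
qed

definition ins :: "nat \<Rightarrow> 'u list \<Rightarrow> 'u list \<Rightarrow> 'u list" where
  "ins l z v = take l v @ z @ drop l v"

lemma ins_append: "length c = l \<Longrightarrow> ins l z (c @ r) = c @ z @ r"
  by (simp add: ins_def)

lemma ins_append2: "l \<le> length v \<Longrightarrow> ins l z (v @ w) = ins l z v @ w"
  by (simp add: ins_def)

section \<open>The two products\<close>

context type_setting
begin

text \<open>\<open>\<Omega>'\<close> has one block more than \<open>\<Omega>\<close>, at position \<open>l\<close>, and a realization of \<open>I(a, \<cdot>)\<close> can serve as that block.\<close>

definition insertion :: "('u list \<Rightarrow> 'u list \<Rightarrow> bool) \<Rightarrow> nat \<Rightarrow> nat \<Rightarrow> nat \<Rightarrow> 'u list filter \<Rightarrow> 'u list filter \<Rightarrow> bool" where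
  "insertion I k l N \<Omega>' \<Omega> \<longleftrightarrow> (\<forall>mw W Q. uf A mw W \<longrightarrow> df L U A (N + k + mw) Q \<longrightarrow>
     (\<forall>\<^sub>F v in \<Omega>'. \<forall>\<^sub>F w in W. Q (v @ w)) \<longrightarrow>
     (\<forall>\<^sub>F v in \<Omega>. \<forall>\<^sub>F w in W. \<exists>z\<in>tu k. I a z \<and> Q (ins l z v @ w)))"

lemma insertionD:
  "insertion I k l N \<Omega>' \<Omega> \<Longrightarrow> uf A mw W \<Longrightarrow> df L U A (N + k + mw) Q \<Longrightarrow>
     \<forall>\<^sub>F v in \<Omega>'. \<forall>\<^sub>F w in W. Q (v @ w) \<Longrightarrow>
     \<forall>\<^sub>F v in \<Omega>. \<forall>\<^sub>F w in W. \<exists>z\<in>tu k. I a z \<and> Q (ins l z v @ w)"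
  unfolding insertion_def by blast

text \<open>\<open>om i\<close> is a law for \<open>i\<close> blocks followed by a tail of length
  \<open>mr\<close>. Going down one step gives up the last block to a realization of
  \<open>I(a, \<cdot>)\<close>, and \<open>om 0\<close> is a law for the tail alone.\<close>

definition tower :: "('u list \<Rightarrow> 'u list \<Rightarrow> bool) \<Rightarrow> nat \<Rightarrow> nat \<Rightarrow> nat \<Rightarrow> (nat \<Rightarrow> 'u list filter) \<Rightarrow> bool" where
  "tower I k i0 mr om \<longleftrightarrow> (\<forall>i\<le>i0. uf A (i * k + mr) (om i)) \<and>
     (\<forall>i<i0. insertion I k (i * k) (i * k + mr) (om (Suc i)) (om i))"

text \<open>The additional tail is absorbed into the test ultrafilter \<open>W\<close> of
  \<open>insertion\<close>.\<close>

lemma tower_ext: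
  assumes t: "tower I k i0 mr om" and Z: "uf A mz Z"
  shows "tower I k i0 (mr + mz) (\<lambda>i. om i \<otimes>f Z)"
  unfolding tower_def
proof (intro conjI allI impI)
  fix i assume i: "i \<le> i0"
  then show "uf A (i * k + (mr + mz)) (om i \<otimes>f Z)"
    using uf_fprod[OF _ Z, of "i * k + mr" "om i"] t by (simp add: tower_def add.assoc)
next
  fix i assume i: "i < i0"
  have I: "insertion I k (i * k) (i * k + mr) (om (Suc i)) (om i)" and uo: "uf A (i * k + mr) (om i)"
    using t i by (auto simp: tower_def)
  show "insertion I k (i * k) (i * k + (mr + mz)) (om (Suc i) \<otimes>f Z) (om i \<otimes>f Z)"
    unfolding insertion_def
  proof (intro allI impI)
    fix mw W Q
    assume W: "uf A mw W" and Q: "df L U A (i * k + (mr + mz) + k + mw) Q"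
      "\<forall>\<^sub>F v in om (Suc i) \<otimes>f Z. \<forall>\<^sub>F w in W. Q (v @ w)"
    have "\<forall>\<^sub>F v in om i. \<forall>\<^sub>F w in Z \<otimes>f W. \<exists>z\<in>tu k. I a z \<and> Q (ins (i * k) z v @ w)"
    proof (rule insertionD[OF I uf_fprod[OF Z W]])
      show "df L U A (i * k + mr + k + (mz + mw)) Q" using Q(1) by (simp add: add_ac)
      show "\<forall>\<^sub>F v in om (Suc i). \<forall>\<^sub>F w in Z \<otimes>f W. Q (v @ w)" using Q(2) by (simp add: eventually_fprod)
    qed
    with uf_tuples[OF uo]
    have "\<forall>\<^sub>F v in om i. \<forall>\<^sub>F \<zeta> in Z. \<forall>\<^sub>F w in W. \<exists>z\<in>tu k. I a z \<and> Q (ins (i * k) z (v @ \<zeta>) @ w)"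
      by eventually_elim (simp add: eventually_fprod ins_append2 tuples_def)
    then show "\<forall>\<^sub>F v in om i \<otimes>f Z. \<forall>\<^sub>F w in W. \<exists>z\<in>tu k. I a z \<and> Q (ins (i * k) z v @ w)"
      by (simp add: eventually_fprod)
  qed
qed

text \<open>For \<open>i = 0\<close> this is compatibility, tested against the remaining blocks
  together with \<open>W\<close>. Otherwise the first pair of blocks, which lies in
  \<open>A\<close>, becomes a parameter and the hypothesis for smaller \<open>K\<close>
  applies.\<close>

lemma insertion_law:
  assumes G: "uf A k G" and J: "compatible I k G"
  shows "i < K \<Longrightarrow> insertion I k (i * k) (i * k + K * k) (law G k K (Suc i)) (law G k K i)"
proof (induction K arbitrary: i)
  case (Suc K)
  show ?case
    unfolding insertion_def
  proof (intro allI impI)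
    fix mw W Q
    assume W: "uf A mw W" and Q: "df L U A (i * k + Suc K * k + k + mw) Q"
      "\<forall>\<^sub>F v in law G k (Suc K) (Suc i). \<forall>\<^sub>F w in W. Q (v @ w)"
    show "\<forall>\<^sub>F v in law G k (Suc K) i. \<forall>\<^sub>F w in W. \<exists>z\<in>tu k. I a z \<and> Q (ins (i * k) z v @ w)"
    proof (cases i)
      case 0
      have "\<forall>\<^sub>F w in pw G (Suc K) \<otimes>f W. \<exists>z\<in>tu k. I a z \<and> Q (z @ w)"
      proof (rule compatibleD[OF J uf_fprod[OF uf_pw[OF G] W]])
        show "df L U A (k + (Suc K * k + mw)) Q" using Q(1) by (simp add: 0 add_ac)
        show "\<forall>\<^sub>F z in G. \<forall>\<^sub>F w in pw G (Suc K) \<otimes>f W. Q (z @ w)"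
          using Q(2) unfolding 0 eventually_law_Suc by (simp add: law_0 eventually_fprod)
      qed
      then show ?thesis by (simp add: 0 law_0 eventually_fprod ins_def)
    next
      case (Suc j)
      then have j: "j < K" using Suc.prems by simp
      from Q(2) have "\<forall>\<^sub>F c in G. \<forall>\<^sub>F u in G. \<forall>\<^sub>F v in law G k K i.
          \<forall>\<^sub>F w in W. Q ((c @ take (i * k) v @ u @ drop (i * k) v) @ w)"
        by (simp only: eventually_law_Suc)
      with uf_tuples[OF G] show ?thesis
        unfolding Suc eventually_law_Suc
      proof eventually_elim
        case (elim c)
        note c = elim(1)
        from uf_tuples[OF G] elim(2) show ?case
        proof eventually_elim
          case (elim u)
          note u = elim(1)
          define Q' where "Q' v = Q (c @ take (i * k) v @ u @ drop (i * k) v)" for v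
          let ?N = "j * k + K * k + k + mw"
          have "tm U A ?N k (\<lambda>v. c)" "tm U A ?N k (\<lambda>v. u)"
            by (intro tm_const c u tA)+
          then have dQ': "df L U A ?N Q'"
            unfolding Q'_def
            by (intro df_tm[OF Q(1)]) (rule tm_eq, (assumption | rule tm_intros)+, simp add: Suc)
          have "\<forall>\<^sub>F v in law G k K (Suc j). \<forall>\<^sub>F w in W. Q' (v @ w)"
            using uf_tuples[OF uf_law[OF G Suc_leI[OF j]]] elim(2)[unfolded Suc]
          proof eventually_elim
            case (elim v)
            have "Suc j * k \<le> length v" using tuples_len[OF elim(1)] by simp
            then show ?case using elim(2) by (simp add: Q'_def Suc)
          qed
          from insertionD[OF Suc.IH[OF j] W dQ' this]
          have "\<forall>\<^sub>F v in law G k K j. \<forall>\<^sub>F w in W. \<exists>z\<in>tu k. I a z \<and> Q' (ins (j * k) z v @ w)" .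
          with uf_tuples[OF uf_law[OF G less_imp_le[OF j]]] show ?case
          proof eventually_elim
            case (elim v)
            have l: "length v = j * k + K * k" by (rule tuples_len[OF elim(1)])
            from elim(2) show ?case
            proof eventually_elim
              case (elim w)
              then obtain z where z: "z \<in> tu k" "I a z" "Q' (ins (j * k) z v @ w)" by (elim bexE conjE)
              have "ins (Suc j * k) z (c @ take (j * k) v @ u @ drop (j * k) v) @ w
                = c @ take (i * k) (ins (j * k) z v @ w) @ u @ drop (i * k) (ins (j * k) z v @ w)"
                using l tuples_len[OF c] tuples_len[OF z(1)] by (simp add: ins_def Suc)
              then show ?case using z unfolding Q'_def by (intro bexI[OF _ z(1)]) simp
            qed
          qed
        qed
      qed
    qed
  qed
qed simp

lemma tower_law:
  assumes "uf A k G" "compatible I k G"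
  shows "tower I k K (K * k) (law G k K)"
  using assms by (simp add: tower_def uf_law insertion_law)

section \<open>Certificates, child nodes and valid tuples\<close>

abbreviation ns :: "'u node \<Rightarrow> nat" where "ns M \<equiv> nm M + nt M"

definition Xt :: "'u node \<Rightarrow> 'u list \<Rightarrow> 'u list \<Rightarrow> bool" where
  "Xt M x y \<longleftrightarrow> nX M x (take (nm M) y) \<and> ng M x (drop (nm M) y)"

lemma Th_iff: "Th M y z \<longleftrightarrow> (\<exists>x\<in>tu n. Xt M x y \<and> nI M x z)"
  by (simp add: Th_def Xt_def)

lemma df_Xt:
  assumes "is_node M"
  shows "df2 L U A n (ns M) (Xt M)"
proof -
  have 1: "df2 L U A n (nm M) (nX M)" "df2 L U A n (nt M) (ng M)" using assms by (auto simp: is_node_def)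
  show ?thesis unfolding df2_def Xt_def
  proof (intro df_conj)
    show "df L U A (n + ns M) (\<lambda>w. nX M (take n w) (take (nm M) (drop n w)))"
      by (rule df2_tm[OF 1(1)]; rule tm_eq, (rule tm_intros)+; simp)
    show "df L U A (n + ns M) (\<lambda>w. ng M (take n w) (drop (nm M) (drop n w)))"
      by (rule df2_tm[OF 1(2)]; rule tm_eq, (rule tm_intros)+; simp)
  qed
qed

lemma df_Th:
  assumes "is_node M"
  shows "df2 L U A (ns M) (nz M) (Th M)"
proof -
  have 1: "df2 L U A n (nz M) (nI M)" using assms by (auto simp: is_node_def)
  show ?thesis unfolding df2_def Th_iff
  proof (intro df_ex df_conj)
    let ?N = "ns M + nz M + n"
    show "df L U A ?N (\<lambda>w. Xt M (drop (ns M + nz M) w) (take (ns M) (take (ns M + nz M) w)))"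
      by (rule df2_tm[OF df_Xt[OF assms]]; rule tm_eq, (rule tm_intros)+; simp)
    show "df L U A ?N (\<lambda>w. nI M (drop (ns M + nz M) w) (drop (ns M) (take (ns M + nz M) w)))"
      by (rule df2_tm[OF 1]; rule tm_eq, (rule tm_intros)+; simp)
  qed
qed

definition bnd :: "'u node \<Rightarrow> nat \<Rightarrow> bool" where
  "bnd M K \<longleftrightarrow> 0 < K \<and> (\<forall>\<^sub>F c in pw (nG M \<otimes>f nG M) K. \<not> (\<exists>y\<in>tu (ns M). alt (nz M) (Th M y) K c))"

lemma bnd_exists: "is_node M \<Longrightarrow> \<exists>K. bnd M K"
  using alternation_bound[OF df_Th small_A, of M "nG M"] unfolding bnd_def is_node_def by blast

definition no_alt2 :: "'u node \<Rightarrow> nat \<Rightarrow> 'u list \<Rightarrow> bool" where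
  "no_alt2 M K v \<longleftrightarrow> \<not> (\<exists>y\<in>tu (ns M). alt2 (nz M) (Th M y) K (take (K * nz M) v) (drop (K * nz M) v))"

lemma no_alt2:
  assumes M: "is_node M" and K: "bnd M K"
  shows "df L U A (K * nz M + K * nz M) (no_alt2 M K)"
    and "\<forall>\<^sub>F v in law (nG M) (nz M) K K. no_alt2 M K v"
proof -
  show "df L U A (K * nz M + K * nz M) (no_alt2 M K)"
    unfolding no_alt2_def
    by (intro df_not df_ex, rule df_alt2[OF df_Th[OF M]]; rule tm_eq, (rule tm_intros)+; simp)
  show "\<forall>\<^sub>F v in law (nG M) (nz M) K K. no_alt2 M K v"
    unfolding no_alt2_def
  proof (rule law_alt2)
    show "uf A (nz M) (nG M)" using M by (simp add: is_node_def)
    show "\<forall>\<^sub>F w in pw (nG M \<otimes>f nG M) K. \<not> (\<exists>y\<in>tu (ns M). alt (nz M) (Th M y) K w)"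
      using K by (simp add: bnd_def)
  qed
qed

text \<open>The argument is \<open>(b, t, z\<^sub>0, \<dots>, z\<^sub>K\<^sub>-\<^sub>1)\<close>; it certifies that \<open>\<not> (X(x; b) \<and> g(x, t))\<close> belongs to \<open>\<pi>\<close>.\<close>

definition cert :: "'u node \<Rightarrow> nat \<Rightarrow> 'u list \<Rightarrow> bool" where
  "cert M K v \<longleftrightarrow> none (nz M) (Th M (take (ns M) v)) K (drop (ns M) v)"

abbreviation cz :: "'u node \<Rightarrow> nat \<Rightarrow> nat" where "cz M K \<equiv> nt M + K * nz M"
abbreviation cZ :: "'u node \<Rightarrow> nat \<Rightarrow> 'u list filter" where "cZ M K \<equiv> nZ M \<otimes>f pw (nG M) K"

lemma df_cert: "is_node M \<Longrightarrow> df L U A (nm M + cz M K) (cert M K)"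
  unfolding cert_def
  by (rule df_none[OF df_Th]; (rule tm_eq, (rule tm_intros)+)?; simp)

lemma uf_cZ: "is_node M \<Longrightarrow> uf A (cz M K) (cZ M K)"
  by (auto simp: is_node_def intro!: uf_fprod uf_pw)

lemma cert_eventually:
  assumes M: "is_node M"
  shows "\<forall>\<^sub>F v in nE M. \<forall>\<^sub>F \<zeta> in cZ M K. cert M K (v @ \<zeta>)"
proof -
  have G: "uf A (nz M) (nG M)" and E: "uf A (nm M) (nE M)" and T: "uf A (nt M) (nZ M)"
    and generic_over: "\<forall>\<^sub>F b in nE M. \<forall>\<^sub>F t in nZ M. \<forall>\<^sub>F z in nG M. \<not> Th M (b @ t) z"
    using M by (auto simp: is_node_def)
  from uf_tuples[OF E] generic_over show ?thesis
    unfolding eventually_fprod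
  proof eventually_elim
    case (elim b)
    note b = elim(1)
    from uf_tuples[OF T] elim(2) show ?case
    proof eventually_elim
      case (elim t)
      from none_eventually[OF G elim(2)] show ?case
        by eventually_elim (use tuples_len[OF b] tuples_len[OF elim(1)] in \<open>simp add: cert_def\<close>)
    qed
  qed
qed

text \<open>The formula \<open>nX M\<close> says that no block matched with \<open>x\<close>
  completes \<open>v\<close> to a solution of \<open>Q\<close>. By \<open>insertion\<close> with an
  empty test tuple it fails at \<open>a\<close> generically, so \<open>node_exists\<close>
  applies.\<close>

lemma child_exists:
  assumes t: "tower I k (Suc i) mr om" and I: "df2 L U A n k I"
    and Q: "df L U A (Suc i * k + mr) Q" "\<forall>\<^sub>F v in om (Suc i). Q v"
  shows "\<exists>M. is_node M \<and> nm M = i * k + mr \<and> nE M = om i \<and>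
     nX M = (\<lambda>x v. \<not> (\<exists>z\<in>tu k. I x z \<and> Q (ins (i * k) z v)))"
proof -
  let ?N = "i * k + mr"
  let ?X = "\<lambda>x v. \<not> (\<exists>z\<in>tu k. I x z \<and> Q (ins (i * k) z v))"
  have Ii: "insertion I k (i * k) ?N (om (Suc i)) (om i)" and uo: "uf A ?N (om i)"
    using t by (auto simp: tower_def)
  have "\<forall>\<^sub>F v in om i. \<forall>\<^sub>F w in fnil. \<exists>z\<in>tu k. I a z \<and> Q (ins (i * k) z v @ w)"
    by (rule insertionD[OF Ii uf_fnil]) (use Q in \<open>simp_all add: add_ac\<close>)
  then have 1: "\<forall>\<^sub>F v in om i. \<not> ?X a v" by simp
  have "df2 L U A n ?N ?X"
    unfolding df2_def
  proof (intro df_not df_ex df_conj)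
    show "df L U A (n + ?N + k) (\<lambda>w. I (take n (take (n + ?N) w)) (drop (n + ?N) w))"
      by (rule df2_tm[OF I]; rule tm_eq, (rule tm_intros)+; simp)
    show "df L U A (n + ?N + k) (\<lambda>w. Q (ins (i * k) (drop (n + ?N) w) (drop n (take (n + ?N) w))))"
      unfolding ins_def by (rule df_tm[OF Q(1)], rule tm_eq, (rule tm_intros)+) simp
  qed
  from node_exists[OF uo this 1] show ?thesis by blast
qed

text \<open>The combinatorial condition on \<open>r\<close> under which the first \<open>i\<close> members of a Morley sequence of \<open>\<pi>\<close> can be
  matched with blocks \<open>c\<close> such that \<open>Q(c, r)\<close>.  Matching the last member reduces to a certificate for the node
  that expresses the nonexistence of a match, hence to the same problem for \<open>i - 1\<close> members.\<close>

primrec valid :: "('u list \<Rightarrow> 'u list \<Rightarrow> bool) \<Rightarrow> nat \<Rightarrow> nat \<Rightarrow> nat \<Rightarrow> ('u list \<Rightarrow> bool) \<Rightarrow> 'u list \<Rightarrow> bool" where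
  "valid I k 0 mr Q r = Q r"
| "valid I k (Suc i) mr Q r \<longleftrightarrow> (\<exists>M K. is_node M \<and> bnd M K \<and> nm M = i * k + mr \<and>
     nX M = (\<lambda>x v. \<not> (\<exists>z\<in>tu k. I x z \<and> Q (ins (i * k) z v))) \<and>
     (\<forall>\<^sub>F \<zeta> in cZ M K. valid I k i (mr + cz M K) (cert M K) (r @ \<zeta>)))"

text \<open>The certificate of the child node holds generically by \<open>cert_eventually\<close>.
  Appending its variables to the tail of the tower leads to the hypothesis for one block
  fewer.\<close>

lemma valid_eventually:
  assumes I: "df2 L U A n k I"
  shows "tower I k i mr om \<Longrightarrow> df L U A (i * k + mr) Q \<Longrightarrow> \<forall>\<^sub>F v in om i. Q v \<Longrightarrow>
    \<forall>\<^sub>F r in om 0. valid I k i mr Q r"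
proof (induction i arbitrary: mr om Q)
  case (Suc i)
  obtain M where M: "is_node M" "nm M = i * k + mr" "nE M = om i"
    "nX M = (\<lambda>x v. \<not> (\<exists>z\<in>tu k. I x z \<and> Q (ins (i * k) z v)))"
    using child_exists[OF Suc.prems(1) I Suc.prems(2,3)] by (elim exE conjE)
  obtain K where K: "bnd M K" using bnd_exists[OF M(1)] ..
  have "tower I k i mr om" using Suc.prems(1) by (simp add: tower_def)
  from tower_ext[OF this uf_cZ[OF M(1)]]
  have t: "tower I k i (mr + cz M K) (\<lambda>i. om i \<otimes>f cZ M K)" .
  have "\<forall>\<^sub>F r in om 0 \<otimes>f cZ M K. valid I k i (mr + cz M K) (cert M K) r"
  proof (rule Suc.IH[OF t])
    show "df L U A (i * k + (mr + cz M K)) (cert M K)"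
      using df_cert[OF M(1), of K] by (simp add: M(2) add.assoc)
    show "\<forall>\<^sub>F v in om i \<otimes>f cZ M K. cert M K v"
      using cert_eventually[OF M(1), of K] by (simp only: M(3) eventually_fprod)
  qed
  then have "\<forall>\<^sub>F r in om 0. \<forall>\<^sub>F \<zeta> in cZ M K. valid I k i (mr + cz M K) (cert M K) (r @ \<zeta>)"
    unfolding eventually_fprod[of _ "om 0"] .
  then show ?case by eventually_elim (use M K in auto)
next
  case 0
  from "0.prems"(3) show ?case by eventually_elim simp
qed

end

section \<open>Chains of generic realizations\<close>

locale generic_setting = type_setting L U \<kappa> A a
  for L :: "('f, 'r) lang" and U :: "('f, 'r, 'u) struct" and \<kappa> :: "'k rel" and A :: "'u set"
    and a :: "'u list" +
  fixes PP :: "'u list filter"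
  assumes PPu: "ultra PP" and PPt: "\<forall>\<^sub>F x in PP. x \<in> tu n"
    and PPa: "df L U A n Q \<Longrightarrow> Q a \<Longrightarrow> \<forall>\<^sub>F x in PP. Q x"
    and PPH: "is_condition v \<Longrightarrow> \<forall>\<^sub>F x in PP. meets x v"
begin

text \<open>A generic \<open>x\<close> meets the condition given by \<open>nI M\<close> and
  \<open>\<not> Th M y\<close>. The resulting \<open>z\<close> satisfies \<open>nI M x z\<close>
  without \<open>Th M y z\<close>, so \<open>x\<close> cannot satisfy
  \<open>Xt M x y\<close>.\<close>

lemma eventually_not_Xt:
  assumes M: "is_node M" and y: "y \<in> tu (ns M)" and G: "\<forall>\<^sub>F z in nG M. \<not> Th M y z"
  shows "\<forall>\<^sub>F x in PP. \<not> Xt M x y"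
proof -
  have "tm U (Dom U) (nz M) (ns M) (\<lambda>z. y)" by (rule tm_const[OF y y])
  from df_not[OF df2_tm[OF df2_mono[OF df_Th[OF M] A(1)] this tm_id]]
  have "df L U (Dom U) (nz M) (\<lambda>z. \<not> Th M y z)" .
  then have "is_condition (nI M, nz M, nG M, \<lambda>z. \<not> Th M y z)"
    using M G by (simp add: is_condition_def is_node_def)
  from PPH[OF this] PPt show ?thesis
  proof eventually_elim
    case (elim x)
    then show ?case by (auto simp: meets_def Th_iff)
  qed
qed

definition generic_over :: "'u set \<Rightarrow> 'u list \<Rightarrow> bool" where
  "generic_over S x \<longleftrightarrow> (\<forall>P. df L U S n P \<longrightarrow> (\<forall>\<^sub>F x in PP. P x) \<longrightarrow> P x)"

lemma generic_overD: "generic_over S x \<Longrightarrow> df L U S n P \<Longrightarrow> \<forall>\<^sub>F x in PP. P x \<Longrightarrow> P x"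
  unfolding generic_over_def by blast

lemma generic_over_mono: "generic_over S' x \<Longrightarrow> S \<subseteq> S' \<Longrightarrow> generic_over S x"
  unfolding generic_over_def by (intro allI impI) (blast intro: df_mono)

lemma generic_over_exists:
  assumes "small S"
  shows "\<exists>x\<in>tu n. generic_over S x"
proof -
  have "\<exists>x\<in>tu n. \<forall>P\<in>{P. df L U S n P \<and> (\<forall>\<^sub>F x in PP. P x)}. P x"
  proof (rule sat_df[OF assms])
    fix F assume F: "finite F" "F \<subseteq> {P. df L U S n P \<and> (\<forall>\<^sub>F x in PP. P x)}"
    have "\<forall>\<^sub>F x in PP. \<forall>P\<in>F. P x"
      by (rule eventually_ball_finite[OF F(1)]) (use F(2) in auto)
    from ultra_happens[OF PPu eventually_conj[OF PPt this]] show "\<exists>v\<in>tu n. \<forall>P\<in>F. P v"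
      by (elim exE conjE, intro bexI)
  qed simp
  then show ?thesis unfolding generic_over_def mem_Collect_eq by blast
qed

text \<open>An exchange of quantifiers: here \<open>c\<close> may depend on \<open>l\<close> typical
  certificate blocks, and one \<open>c\<close> that works for generic blocks is obtained. If every
  \<open>c\<close> failed generically, then by compactness every generic set of \<zeta> would have a
  finite part refuting all \<open>c\<close>, and \<open>finite_cover_alternates\<close> would
  contradict the bound \<open>l\<close>.\<close>

lemma cert_vcl:
  assumes M: "is_node M" and L: "\<forall>\<^sub>F w in pw (cZ M K \<otimes>f cZ M K) l.
      \<not> (\<exists>v\<in>tu (nm M). alt (cz M K) (\<lambda>\<zeta>. cert M K (v @ \<zeta>)) l w)"
    and S: "small S" "A \<subseteq> S" and C: "df L U S m C" and r: "r \<in> tuples A mr" and m: "nm M = m + mr"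
    and ev: "\<forall>\<^sub>F z in pw (cZ M K) l. \<exists>c\<in>tu m. C c \<and> none (cz M K) (\<lambda>\<zeta>. \<not> cert M K (c @ r @ \<zeta>)) l z"
  shows "\<exists>c\<in>tu m. C c \<and> (\<forall>\<^sub>F \<zeta> in cZ M K. cert M K (c @ r @ \<zeta>))"
proof (rule ccontr)
  assume no: "\<not> ?thesis"
  note Z = uf_cZ[OF M, of K]
  let ?C = "{c \<in> tu m. C c}"
  have "\<not> (\<forall>\<^sub>F w in pw (cZ M K \<otimes>f cZ M K) l.
      \<not> (\<exists>c\<in>?C. alt (cz M K) (\<lambda>\<zeta>. \<not> \<not> cert M K (c @ r @ \<zeta>)) l w))"
  proof (rule finite_cover_alternates[OF Z])
    fix J assume J: "\<forall>\<^sub>F \<zeta> in cZ M K. \<zeta> \<in> J"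
    let ?J = "{\<zeta> \<in> tuples A (cz M K). \<zeta> \<in> J}"
    have "\<exists>J0\<subseteq>?J. finite J0 \<and> (\<forall>c\<in>?C. \<exists>\<zeta>\<in>J0. \<not> cert M K (c @ r @ \<zeta>))"
    proof (rule compact_cover[OF S(1) C])
      fix \<zeta> assume "\<zeta> \<in> ?J"
      then have z: "\<zeta> \<in> tuples A (cz M K)" by simp
      have "tm U A m mr (\<lambda>c. r)" "tm U A m (cz M K) (\<lambda>c. \<zeta>)"
        by (intro tm_const r z tA)+
      then have "df L U A m (\<lambda>c. \<not> cert M K (c @ r @ \<zeta>))"
        by (intro df_not df_tm[OF df_cert[OF M]])
          (rule tm_eq, (assumption | rule tm_intros)+, simp add: m)
      then show "df L U S m (\<lambda>c. \<not> cert M K (c @ r @ \<zeta>))" by (rule df_mono) (rule S(2))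
    next
      show "\<forall>c\<in>tu m. C c \<longrightarrow> (\<exists>\<zeta>\<in>?J. \<not> cert M K (c @ r @ \<zeta>))"
      proof (intro ballI impI)
        fix c assume "c \<in> tu m" "C c"
        with no have "\<not> (\<forall>\<^sub>F \<zeta> in cZ M K. cert M K (c @ r @ \<zeta>))" by blast
        then have "\<forall>\<^sub>F \<zeta> in cZ M K. \<not> cert M K (c @ r @ \<zeta>)" by (simp add: ultra_not[OF uf_ultra[OF Z]])
        from uf_happens[OF Z eventually_conj[OF J this]]
        show "\<exists>\<zeta>\<in>?J. \<not> cert M K (c @ r @ \<zeta>)" by blast
      qed
    qed
    then obtain J0 where "J0 \<subseteq> ?J" "finite J0" "\<forall>c\<in>?C. \<exists>\<zeta>\<in>J0. \<not> cert M K (c @ r @ \<zeta>)"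
      by (elim exE conjE)
    then show "\<exists>J0\<subseteq>J. finite J0 \<and> (\<forall>c\<in>?C. \<exists>\<zeta>\<in>J0. \<not> cert M K (c @ r @ \<zeta>))"
      by (intro exI[of _ J0] conjI) auto
  next
    show "\<forall>\<^sub>F z in pw (cZ M K) l. \<exists>c\<in>?C. none (cz M K) (\<lambda>\<zeta>. \<not> cert M K (c @ r @ \<zeta>)) l z"
      using ev by eventually_elim blast
  qed
  moreover have "\<forall>\<^sub>F w in pw (cZ M K \<otimes>f cZ M K) l.
      \<not> (\<exists>c\<in>?C. alt (cz M K) (\<lambda>\<zeta>. \<not> \<not> cert M K (c @ r @ \<zeta>)) l w)"
    using L
  proof eventually_elim
    case (elim w)
    show ?case
    proof
      assume "\<exists>c\<in>?C. alt (cz M K) (\<lambda>\<zeta>. \<not> \<not> cert M K (c @ r @ \<zeta>)) l w"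
      then obtain c where c: "c \<in> tu m" "alt (cz M K) (\<lambda>\<zeta>. cert M K ((c @ r) @ \<zeta>)) l w" by auto
      have "c @ r \<in> tu (nm M)" unfolding m by (rule tuples_append[OF c(1) tA[OF r]])
      with c(2) elim show False by blast
    qed
  qed
  ultimately show False by (rule notE)
qed

text \<open>A tuple \<open>t\<close> of \<open>A\<close> is chosen for which the certificate holds
  generically and \<open>ng M a t\<close> is true. The first excludes \<open>X\<close> and
  \<open>g\<close> together for generic \<open>x\<close>, and the second forces
  \<open>g\<close>.\<close>

lemma cert_imp:
  assumes M: "is_node M" and K: "bnd M K" and b: "b \<in> tu (nm M)"
    and ev: "\<forall>\<^sub>F \<zeta> in cZ M K. cert M K (b @ \<zeta>)"
  shows "\<forall>\<^sub>F x in PP. \<not> nX M x b"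
proof -
  have T: "uf A (nt M) (nZ M)" and G: "uf A (nz M) (nG M)" and ga: "\<forall>\<^sub>F t in nZ M. ng M a t"
    and dg: "df2 L U A n (nt M) (ng M)" using M by (auto simp: is_node_def)
  have "\<forall>\<^sub>F t in nZ M. \<forall>\<^sub>F z in nG M. \<not> Th M (b @ t) z"
    using uf_tuples[OF T] ev[unfolded eventually_fprod]
  proof eventually_elim
    case (elim t)
    have "\<forall>\<^sub>F z in pw (nG M) K. none (nz M) (Th M (b @ t)) K z"
      using elim(2) by eventually_elim (use tuples_len[OF b] tuples_len[OF elim(1)] in \<open>simp add: cert_def\<close>)
    then show ?case by (rule eventually_none[OF G, rotated]) (use K in \<open>simp add: bnd_def\<close>)
  qed
  from uf_happens[OF T eventually_conj[OF this ga]] obtain t where t: "t \<in> tuples A (nt M)"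
    "\<forall>\<^sub>F z in nG M. \<not> Th M (b @ t) z" "ng M a t" by (elim bexE conjE)
  have "tm U A n (nt M) (\<lambda>x. t)" by (rule tm_const[OF t(1) tA[OF t(1)]])
  from PPa[OF df2_tm[OF dg tm_id this] t(3)] have "\<forall>\<^sub>F x in PP. ng M x t" .
  with eventually_not_Xt[OF M tuples_append[OF b tA[OF t(1)]] t(2)] show ?thesis
    by eventually_elim (use tuples_len[OF b] in \<open>simp add: Xt_def\<close>)
qed

lemma df_matches:
  assumes I: "df2 L U A n k I" and b: "\<And>j. j < i \<Longrightarrow> b j \<in> tu n \<and> set (b j) \<subseteq> B" and B: "A \<subseteq> B"
  shows "df L U B (i * k) (matches I k i b)"
  unfolding matches_def[abs_def]
proof (rule df_Ball_less)
  fix j assume j: "j < i"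
  then have "Suc j * k \<le> i * k" by (intro mult_le_mono1) simp
  then have e: "min (i * k - j * k) k = k" by simp
  have "tm U B (i * k) n (\<lambda>v. b j)" by (rule tm_const) (use b[OF j] in \<open>auto simp: tuples_def\<close>)
  moreover have "tm U B (i * k) k (\<lambda>v. take k (drop (j * k) v))"
    by (rule tm_eq, (rule tm_intros)+) (rule e)
  ultimately show "df L U B (i * k) (\<lambda>v. I (b j) (take k (drop (j * k) v)))"
    by (rule df2_tm[OF df2_mono[OF I B]])
qed

text \<open>The last member must avoid \<open>nX M\<close>, which by \<open>cert_imp\<close> follows
  from generic certificates for \<open>c @ r\<close>. By \<open>cert_vcl\<close> it suffices that
  \<open>c\<close> has \<open>l\<close> typical certificates. This is a formula over
  \<open>A\<close>, so the induction hypothesis provides such \<open>c\<close> for the earlier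
  members.\<close>

lemma generic_chain:
  assumes I: "df2 L U A n k I" and S: "small S"
  shows "tower I k i mr om \<Longrightarrow> df L U A (i * k + mr) Q \<Longrightarrow> \<forall>\<^sub>F v in om i. Q v \<Longrightarrow>
    \<exists>b. (\<forall>j<i. b j \<in> tu n \<and> generic_over S (b j)) \<and> (\<forall>\<^sub>F r in om 0. \<exists>c\<in>tu (i * k). matches I k i b c \<and> Q (c @ r))"
proof (induction i arbitrary: mr om Q)
  case (Suc i)
  obtain M where M: "is_node M" "nm M = i * k + mr" "nE M = om i"
    "nX M = (\<lambda>x v. \<not> (\<exists>z\<in>tu k. I x z \<and> Q (ins (i * k) z v)))"
    using child_exists[OF Suc.prems(1) I Suc.prems(2,3)] by (elim exE conjE)
  obtain K where K: "bnd M K" using bnd_exists[OF M(1)] ..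
  note Z = uf_cZ[OF M(1), of K]
  have dc: "df2 L U A (nm M) (cz M K) (\<lambda>v \<zeta>. cert M K (v @ \<zeta>))"
    unfolding df2_def by (rule df_tm[OF df_cert[OF M(1)]]; rule tm_eq, (rule tm_intros)+; simp)
  from alternation_bound[OF dc small_A Z]
  obtain l where l: "\<forall>\<^sub>F w in pw (cZ M K \<otimes>f cZ M K) l.
      \<not> (\<exists>v\<in>tu (nm M). alt (cz M K) (\<lambda>\<zeta>. cert M K (v @ \<zeta>)) l w)" by (elim exE conjE)
  have tw: "tower I k i mr om" using Suc.prems(1) by (simp add: tower_def)
  have uo: "uf A mr (om 0)" using tw by (auto simp: tower_def)
  \<comment> \<open>Because \<open>none\<close> negates, this asserts that all \<open>l\<close>
    certificates hold.\<close>
  define Q' where "Q' v = none (cz M K) (\<lambda>\<zeta>. \<not> cert M K (take (nm M) v @ \<zeta>)) l (drop (nm M) v)" for v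
  have "\<exists>b. (\<forall>j<i. b j \<in> tu n \<and> generic_over S (b j)) \<and>
      (\<forall>\<^sub>F r in om 0 \<otimes>f pw (cZ M K) l. \<exists>c\<in>tu (i * k). matches I k i b c \<and> Q' (c @ r))"
  proof (rule Suc.IH[OF tower_ext[OF tw uf_pw[OF Z, of l]]])
    have "df2 L U A (nm M) (cz M K) (\<lambda>v \<zeta>. \<not> cert M K (v @ \<zeta>))"
      using df_not[OF dc[unfolded df2_def]] by (simp add: df2_def)
    note dn = this
    show "df L U A (i * k + (mr + l * cz M K)) Q'"
      unfolding Q'_def[abs_def]
    proof (rule df_none[OF dn])
      show "tm U A (i * k + (mr + l * cz M K)) (nm M) (take (nm M))"
        by (rule tm_eq, (rule tm_intros)+) (simp add: M(2))
      show "tm U A (i * k + (mr + l * cz M K)) (l * cz M K) (drop (nm M))"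
        by (rule tm_eq, (rule tm_intros)+) (simp add: M(2))
    qed
    have "uf A (nm M) (om i)" using tw M(2) by (auto simp: tower_def)
    from uf_tuples[OF this] cert_eventually[OF M(1), of K, unfolded M(3)]
    have "\<forall>\<^sub>F v in om i. \<forall>\<^sub>F z in pw (cZ M K) l. Q' (v @ z)"
    proof eventually_elim
      case (elim v)
      have "\<forall>\<^sub>F \<zeta> in cZ M K. \<not> \<not> cert M K (v @ \<zeta>)" using elim(2) by simp
      from none_eventually[OF Z this] show ?case
        by eventually_elim (use tuples_len[OF elim(1)] in \<open>simp add: Q'_def\<close>)
    qed
    then show "\<forall>\<^sub>F v in om i \<otimes>f pw (cZ M K) l. Q' v" by (simp only: eventually_fprod)
  qed
  then obtain b where b: "\<forall>j<i. b j \<in> tu n \<and> generic_over S (b j)"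
    and ev: "\<forall>\<^sub>F r in om 0 \<otimes>f pw (cZ M K) l. \<exists>c\<in>tu (i * k). matches I k i b c \<and> Q' (c @ r)" by (elim exE conjE)
  let ?B = "A \<union> (\<Union>j\<in>{..<i}. set (b j))"
  have B: "small ?B" "A \<subseteq> ?B"
    by (rule small_Un[OF small_A], rule small_finite) (use b in \<open>auto simp: tuples_def\<close>)
  have dh: "df L U ?B (i * k) (matches I k i b)"
    by (rule df_matches[OF I _ B(2)]) (use b in auto)
  define cok where "cok r c \<longleftrightarrow> c \<in> tu (i * k) \<and> matches I k i b c \<and> (\<forall>\<^sub>F x in PP. \<not> nX M x (c @ r))" for r c
  have cok: "\<forall>\<^sub>F r in om 0. \<exists>c. cok r c"
    using uf_tuples[OF uo] ev[unfolded eventually_fprod[of _ "om 0"]]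
  proof eventually_elim
    case (elim r)
    note r = elim(1)
    have "\<forall>\<^sub>F z in pw (cZ M K) l. \<exists>c\<in>tu (i * k). matches I k i b c \<and>
        none (cz M K) (\<lambda>\<zeta>. \<not> cert M K (c @ r @ \<zeta>)) l z"
      using elim(2)
    proof eventually_elim
      case (elim z)
      then obtain c where c: "c \<in> tu (i * k)" "matches I k i b c" "Q' (c @ r @ z)" by (elim bexE conjE)
      have sp: "take (nm M) (c @ r @ z) = c @ r" "drop (nm M) (c @ r @ z) = z"
        using tuples_len[OF c(1)] tuples_len[OF r] by (simp_all add: M(2))
      from c(3) have "none (cz M K) (\<lambda>\<zeta>. \<not> cert M K (c @ r @ \<zeta>)) l z"
        unfolding Q'_def sp append_assoc .
      with c(1,2) show ?case by blast
    qed
    from cert_vcl[OF M(1) l B dh r M(2) this] obtain c where c: "c \<in> tu (i * k)" "matches I k i b c"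
      "\<forall>\<^sub>F \<zeta> in cZ M K. cert M K ((c @ r) @ \<zeta>)" by auto
    have "c @ r \<in> tu (nm M)" unfolding M(2) by (rule tuples_append[OF c(1) tA[OF r]])
    from cert_imp[OF M(1) K this c(3)] c(1,2) show ?case unfolding cok_def by blast
  qed
  \<comment> \<open>One choice of \<open>c\<close> for every \<open>r\<close> in \<open>A\<close>
    gives a small set, so a single \<open>x\<close> can be generic over all of them. The default
    \<open>[]\<close> keeps the set inside the universe.\<close>
  define cf where "cf r = (if \<exists>c. cok r c then SOME c. cok r c else [])" for r
  have cf: "cok r (cf r)" if "\<exists>c. cok r c" for r
    using someI_ex[OF that] that by (simp add: cf_def)
  let ?S = "S \<union> A \<union> (\<Union>r\<in>tuples A mr. set (cf r))"
  have "set (cf r) \<subseteq> Dom U" for r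
    using cf[of r] by (cases "\<exists>c. cok r c") (auto simp: cok_def tuples_def cf_def)
  then have "small ?S" by (intro small_Un S small_A small_UN card_tuples) auto
  from generic_over_exists[OF this] obtain x where x: "x \<in> tu n" "generic_over ?S x" by blast
  define b' where "b' = b(i := x)"
  have gx: "generic_over S x" by (rule generic_over_mono[OF x(2)]) auto
  have b': "\<forall>j<Suc i. b' j \<in> tu n \<and> generic_over S (b' j)"
    using b x(1) gx by (auto simp: b'_def less_Suc_eq)
  have "\<forall>\<^sub>F r in om 0. \<exists>c\<in>tu (Suc i * k). matches I k (Suc i) b' c \<and> Q (c @ r)"
    using uf_tuples[OF uo] cok
  proof eventually_elim
    case (elim r)
    note r = elim(1)
    have c: "cf r \<in> tu (i * k)" "matches I k i b (cf r)" "\<forall>\<^sub>F x in PP. \<not> nX M x (cf r @ r)"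
      using cf[OF elim(2)] by (auto simp: cok_def)
    have "\<not> nX M x (cf r @ r)"
    proof (rule generic_overD[OF x(2) _ c(3)])
      have "tm U ?S n (nm M) (\<lambda>x. cf r @ r)"
        by (rule tm_const)
          (use tuples_len[OF c(1)] r c(1) A(1) in \<open>auto simp: M(2) tuples_def\<close>)
      moreover have "df2 L U A n (nm M) (nX M)" using M(1) by (simp add: is_node_def)
      ultimately show "df L U ?S n (\<lambda>x. \<not> nX M x (cf r @ r))"
        by (intro df_not df2_tm[OF df2_mono tm_id]) auto
    qed
    then obtain z where z: "z \<in> tu k" "I x z" "Q (cf r @ z @ r)"
      using ins_append[OF tuples_len[OF c(1)]] by (auto simp: M(4))
    have "matches I k i b' (cf r)" using c(2) by (simp add: matches_def b'_def)
    then have "matches I k (Suc i) b' (cf r @ z)"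
      using z(2) by (simp add: matches_snoc[OF tuples_len[OF c(1)] tuples_len[OF z(1)]] b'_def)
    moreover have "cf r @ z \<in> tu (Suc i * k)" using tuples_append[OF c(1) z(1)] by (simp add: add.commute)
    ultimately show ?case using z(3) by (intro bexI[of _ "cf r @ z"]) simp_all
  qed
  with b' show ?case by blast
next
  case 0
  from "0.prems"(3) show ?case by (simp add: matches_def)
qed

text \<open>Consistency of \<open>\<pi>\<close> comes from this condition on \<open>v\<close>, generic stability from \<open>valid\<close>.\<close>

definition safe :: "'u node \<Rightarrow> nat \<Rightarrow> 'u list \<Rightarrow> bool" where
  "safe M K v \<longleftrightarrow> (\<forall>y\<in>tu (ns M). none (nz M) (Th M y) K v \<longrightarrow> (\<forall>\<^sub>F x in PP. \<not> Xt M x y))"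

text \<open>The element \<open>b j\<close> witnesses \<Theta> at block \<open>j\<close> of
  \<open>c\<close>, while \<Theta> holds at no block of \<open>r\<close>; hence \<open>y\<close>
  alternates \<open>K\<close> times.\<close>

lemma matches_Xt_alt2:
  assumes h: "matches (nI M) (nz M) K b c" and b: "\<And>j. j < K \<Longrightarrow> b j \<in> tu n \<and> Xt M (b j) y"
    and c: "c \<in> tu (K * nz M)" and y: "y \<in> tu (ns M)" and nn: "none (nz M) (Th M y) K r"
  shows "\<not> no_alt2 M K (c @ r)"
proof -
  have "\<forall>j<K. Th M y (take (nz M) (drop (j * nz M) c))"
    using h b unfolding matches_def Th_iff by blast
  from alt2I[OF this nn] show ?thesis
    using y tuples_len[OF c] by (auto simp: no_alt2_def)
qed

text \<open>Otherwise a typical \<open>v\<close> is accompanied by some \<open>y\<close> that is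
  free of \<Theta> along \<open>v\<close> although generic \<open>x\<close> satisfy
  \<open>Xt M x y\<close>. A chain of \<open>K\<close> members generic over all these
  \<open>y\<close> satisfies \<open>Xt\<close> for them, and its matching alternates
  \<open>K\<close> times.\<close>

lemma safe_eventually:
  assumes M: "is_node M" and K: "bnd M K"
  shows "\<forall>\<^sub>F v in pw (nG M) K. safe M K v"
proof (rule ccontr)
  have G: "uf A (nz M) (nG M)" and I: "df2 L U A n (nz M) (nI M)" and J: "compatible (nI M) (nz M) (nG M)"
    using M by (auto simp: is_node_def)
  note uG = uf_pw[OF G, of K]
  assume "\<not> ?thesis"
  then have bad: "\<forall>\<^sub>F v in pw (nG M) K. \<not> safe M K v" by (simp add: ultra_not[OF uf_ultra[OF uG]])
  define yok where "yok v y \<longleftrightarrow> y \<in> tu (ns M) \<and> none (nz M) (Th M y) K v \<and> (\<forall>\<^sub>F x in PP. Xt M x y)" for v y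
  define yf where "yf v = (if \<exists>y. yok v y then SOME y. yok v y else [])" for v
  have yf: "yok v (yf v)" if "\<exists>y. yok v y" for v
    using someI_ex[OF that] that by (simp add: yf_def)
  have yok: "\<exists>y. yok v y" if v: "\<not> safe M K v" for v
  proof -
    obtain y where y: "y \<in> tu (ns M)" "none (nz M) (Th M y) K v" "\<not> (\<forall>\<^sub>F x in PP. \<not> Xt M x y)"
      using v unfolding safe_def by blast
    from y(3) have "\<forall>\<^sub>F x in PP. Xt M x y" unfolding ultra_not[OF PPu] by simp
    with y(1,2) show ?thesis unfolding yok_def by blast
  qed
  let ?S = "A \<union> (\<Union>v\<in>tuples A (K * nz M). set (yf v))"
  have "set (yf v) \<subseteq> Dom U" for v
    using yf[of v] by (cases "\<exists>y. yok v y") (auto simp: yok_def tuples_def yf_def)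
  then have S: "small ?S" by (intro small_Un small_A small_UN card_tuples) auto
  from generic_chain[OF I S tower_law[OF G J] no_alt2[OF M K]]
  obtain b where b: "\<forall>j<K. b j \<in> tu n \<and> generic_over ?S (b j)"
    "\<forall>\<^sub>F r in law (nG M) (nz M) K 0. \<exists>c\<in>tu (K * nz M). matches (nI M) (nz M) K b c \<and> no_alt2 M K (c @ r)"
    by (elim exE conjE)
  from uf_happens[OF uG eventually_conj[OF bad b(2)[unfolded law_0]]]
  obtain r c where r: "r \<in> tuples A (K * nz M)" "\<not> safe M K r"
    and c: "c \<in> tu (K * nz M)" "matches (nI M) (nz M) K b c" "no_alt2 M K (c @ r)" by (elim bexE conjE)
  have y: "yf r \<in> tu (ns M)" "none (nz M) (Th M (yf r)) K r" "\<forall>\<^sub>F x in PP. Xt M x (yf r)"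
    using yf[OF yok[OF r(2)]] by (auto simp: yok_def)
  have "tm U ?S n (ns M) (\<lambda>x. yf r)" by (rule tm_const) (use y(1) r(1) in \<open>auto simp: tuples_def\<close>)
  then have "df L U ?S n (\<lambda>x. Xt M x (yf r))"
    by (intro df2_tm[OF df2_mono[OF df_Xt[OF M]] tm_id]) auto
  then have "Xt M (b j) (yf r)" if "j < K" for j using generic_overD[OF _ _ y(3)] b(1) that by blast
  with b(1) have "\<not> no_alt2 M K (c @ r)" by (intro matches_Xt_alt2[OF c(2) _ c(1) y(1,2)]) blast
  with c(3) show False by (rule notE[rotated])
qed

section \<open>The generically stable type\<close>

definition good :: "'u node \<Rightarrow> nat \<Rightarrow> 'u list \<Rightarrow> bool" where
  "good M K v \<longleftrightarrow> safe M K v \<and> valid (nI M) (nz M) K (K * nz M) (no_alt2 M K) v"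

lemma good_eventually:
  assumes M: "is_node M" and K: "bnd M K"
  shows "\<forall>\<^sub>F v in pw (nG M) K. good M K v"
proof -
  have G: "uf A (nz M) (nG M)" and I: "df2 L U A n (nz M) (nI M)" and J: "compatible (nI M) (nz M) (nG M)"
    using M by (auto simp: is_node_def)
  have "\<forall>\<^sub>F v in pw (nG M) K. valid (nI M) (nz M) K (K * nz M) (no_alt2 M K) v"
    using valid_eventually[OF I tower_law[OF G J] no_alt2[OF M K]] by (simp only: law_0)
  with safe_eventually[OF M K] show ?thesis
    unfolding good_def by (rule eventually_conj)
qed

text \<open>Since \<open>v\<close> lies in \<open>A\<close>, the last conjunct is a condition on
  \<open>y\<close> that is definable over \<open>A\<close>; this is the source of
  Ind-definability.\<close>

definition cut :: "'u node \<Rightarrow> nat \<Rightarrow> 'u list \<Rightarrow> 'u list \<Rightarrow> bool" where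
  "cut M K v y \<longleftrightarrow> is_node M \<and> bnd M K \<and> v \<in> tuples A (K * nz M) \<and> good M K v \<and>
     y \<in> tu (ns M) \<and> none (nz M) (Th M y) K v"

definition basic :: "('u list \<Rightarrow> bool) \<Rightarrow> bool" where
  "basic Q \<longleftrightarrow> (df L U A n Q \<and> Q a) \<or> (\<exists>M K v y. cut M K v y \<and> Q = (\<lambda>x. \<not> Xt M x y))"

lemma basic_cases:
  assumes "basic Q"
  obtains "df L U A n Q" "Q a" | M K v y where "cut M K v y" "Q = (\<lambda>x. \<not> Xt M x y)"
  using assms unfolding basic_def by (elim disjE exE conjE)

definition entails :: "('u list \<Rightarrow> bool) \<Rightarrow> bool" where
  "entails Q \<longleftrightarrow> (\<exists>S. finite S \<and> (\<forall>P\<in>S. basic P) \<and> (\<forall>x\<in>tu n. (\<forall>P\<in>S. P x) \<longrightarrow> Q x))"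

lemma entails_basic: "basic Q \<Longrightarrow> entails Q"
  unfolding entails_def by (intro exI[of _ "{Q}"]) simp

lemma entails_base: "df L U A n Q \<Longrightarrow> Q a \<Longrightarrow> entails Q"
  by (rule entails_basic) (simp add: basic_def)

lemma entails_cut: "cut M K v y \<Longrightarrow> entails (\<lambda>x. \<not> Xt M x y)"
  by (rule entails_basic) (unfold basic_def, intro disjI2 exI[of _ M] exI[of _ K] exI[of _ v] exI[of _ y], simp)

lemma entails_mono:
  assumes "entails P" "\<And>x. x \<in> tu n \<Longrightarrow> P x \<Longrightarrow> Q x"
  shows "entails Q"
proof -
  obtain S where "finite S" "\<forall>P\<in>S. basic P" "\<forall>x\<in>tu n. (\<forall>P\<in>S. P x) \<longrightarrow> P x"
    using assms(1) unfolding entails_def by (elim exE conjE)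
  with assms(2) show ?thesis unfolding entails_def by (intro exI[of _ S]) simp
qed

lemma entails_conj:
  assumes "entails P" "entails Q"
  shows "entails (\<lambda>x. P x \<and> Q x)"
proof -
  obtain S where S: "finite S" "\<forall>P\<in>S. basic P" "\<forall>x\<in>tu n. (\<forall>P\<in>S. P x) \<longrightarrow> P x"
    using assms(1) unfolding entails_def by (elim exE conjE)
  obtain T where T: "finite T" "\<forall>P\<in>T. basic P" "\<forall>x\<in>tu n. (\<forall>P\<in>T. P x) \<longrightarrow> Q x"
    using assms(2) unfolding entails_def by (elim exE conjE)
  show ?thesis unfolding entails_def
  proof (intro exI[of _ "S \<union> T"] conjI ballI impI)
    show "finite (S \<union> T)" using S(1) T(1) by simp
    show "basic P" if "P \<in> S \<union> T" for P using that S(2) T(2) by blast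
    fix x assume x: "x \<in> tu n" and "\<forall>P\<in>S \<union> T. P x"
    then have "\<forall>P\<in>S. P x" "\<forall>P\<in>T. P x" by blast+
    with S(3)[THEN bspec, OF x] T(3)[THEN bspec, OF x] show "P x" "Q x" by - (erule (1) mp, erule (1) mp)
  qed
qed

lemma entails_Ball: "finite F \<Longrightarrow> (\<And>i. i \<in> F \<Longrightarrow> entails (P i)) \<Longrightarrow> entails (\<lambda>x. \<forall>i\<in>F. P i x)"
proof (induction F rule: finite_induct)
  case empty
  show ?case by (rule entails_base) (simp_all add: df_const)
next
  case (insert i F)
  have "entails (\<lambda>x. P i x \<and> (\<forall>i\<in>F. P i x))"
    by (rule entails_conj[OF insert.prems insert.IH]) (simp_all add: insert.prems)
  then show ?case by (rule entails_mono) simp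
qed

lemma basic_PP:
  assumes "basic Q"
  shows "\<forall>\<^sub>F x in PP. Q x"
  using assms
proof (cases rule: basic_cases)
  case 1
  then show ?thesis by (rule PPa)
next
  case (2 M K v y)
  then show ?thesis by (simp add: cut_def good_def safe_def)
qed

lemma entails_PP:
  assumes "entails Q"
  shows "\<forall>\<^sub>F x in PP. Q x"
proof -
  obtain S where S: "finite S" "\<forall>P\<in>S. basic P" "\<forall>x\<in>tu n. (\<forall>P\<in>S. P x) \<longrightarrow> Q x"
    using assms unfolding entails_def by (elim exE conjE)
  have "\<forall>\<^sub>F x in PP. \<forall>P\<in>S. P x"
    by (rule eventually_ball_finite[OF S(1)]) (use S(2) basic_PP in blast)
  with PPt show ?thesis by eventually_elim (use S(3) in simp)
qed

text \<open>The hypotheses are discharged one at a time. A formula over \<open>A\<close> becomes a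
  premise of an implication. In a cut formula the tuple \<open>y\<close> becomes a variable,
  quantified over all tuples that satisfy the same condition over \<open>A\<close> and hence give
  cut formulas too.\<close>

lemma entails_uniform:
  assumes "finite S"
  shows "(\<forall>P\<in>S. basic P) \<Longrightarrow> df2 L U A n m Q \<Longrightarrow> b \<in> tu m \<Longrightarrow>
    \<forall>x\<in>tu n. (\<forall>P\<in>S. P x) \<longrightarrow> Q x b \<Longrightarrow>
    \<exists>E. df L U A m E \<and> E b \<and> (\<forall>b'\<in>tu m. E b' \<longrightarrow> entails (\<lambda>x. Q x b'))"
  using assms
proof (induction S arbitrary: m Q b rule: finite_induct)
  case empty
  have "df L U A m (\<lambda>b. \<forall>x\<in>tu n. Q x b)"
    by (intro df_all, rule df2_tm[OF empty.prems(2)]; rule tm_eq, (rule tm_intros)+; simp)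
  moreover have "entails (\<lambda>x. Q x b')" if "\<forall>x\<in>tu n. Q x b'" for b'
  proof -
    have "entails (\<lambda>x. True)" by (rule entails_base) (simp_all add: df_const)
    then show ?thesis by (rule entails_mono) (use that in simp)
  qed
  ultimately show ?case using empty.prems(4) by (intro exI[of _ "\<lambda>b. \<forall>x\<in>tu n. Q x b"]) simp
next
  case (insert P S)
  have S: "\<forall>P\<in>S. basic P" and GP: "basic P" using insert.prems(1) by simp_all
  note dQ = insert.prems(2) and b = insert.prems(3)
  from GP show ?case
  proof (cases rule: basic_cases)
    case 1
    have "df2 L U A n m (\<lambda>x b. P x \<longrightarrow> Q x b)"
      unfolding df2_def
    proof (rule df_imp)
      show "df L U A (n + m) (\<lambda>w. P (take n w))"
        by (rule df_tm[OF 1(1)], rule tm_eq, (rule tm_intros)+) simp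
      show "df L U A (n + m) (\<lambda>w. Q (take n w) (drop n w))" using dQ by (simp only: df2_def)
    qed
    from insert.IH[OF S this b] insert.prems(4)
    obtain E where E: "df L U A m E" "E b" "\<forall>b'\<in>tu m. E b' \<longrightarrow> entails (\<lambda>x. P x \<longrightarrow> Q x b')"
      by (auto simp del: not_imp)
    have "entails (\<lambda>x. Q x b')" if "b' \<in> tu m" "E b'" for b'
    proof -
      from E(3) that have "entails (\<lambda>x. P x \<longrightarrow> Q x b')" by simp
      from entails_conj[OF entails_base[OF 1] this] show ?thesis by (rule entails_mono) simp
    qed
    with E(1,2) show ?thesis by (intro exI[of _ E]) simp
  next
    case (2 M K v y)
    have M: "is_node M" and K: "bnd M K" and v: "v \<in> tuples A (K * nz M)" "good M K v"
      and y: "y \<in> tu (ns M)" "none (nz M) (Th M y) K v" using 2(1) by (auto simp: cut_def)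
    let ?Q = "\<lambda>x w. \<not> Xt M x (drop m w) \<longrightarrow> Q x (take m w)"
    have d: "df2 L U A n (m + ns M) ?Q"
      unfolding df2_def
    proof (rule df_imp[OF df_not])
      show "df L U A (n + (m + ns M)) (\<lambda>w. Xt M (take n w) (drop m (drop n w)))"
        by (rule df2_tm[OF df_Xt[OF M]]; rule tm_eq, (rule tm_intros)+; simp)
      show "df L U A (n + (m + ns M)) (\<lambda>w. Q (take n w) (take m (drop n w)))"
        by (rule df2_tm[OF dQ]; rule tm_eq, (rule tm_intros)+; simp)
    qed
    have "\<forall>x\<in>tu n. (\<forall>P\<in>S. P x) \<longrightarrow> ?Q x (b @ y)"
      using insert.prems(4) tuples_len[OF b] by (simp add: 2(2))
    from insert.IH[OF S d tuples_append[OF b y(1)] this]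
    obtain E where E: "df L U A (m + ns M) E" "E (b @ y)" "\<forall>w\<in>tu (m + ns M). E w \<longrightarrow> entails (\<lambda>x. ?Q x w)"
      by (elim exE conjE)
    let ?E = "\<lambda>b. \<exists>y\<in>tu (ns M). none (nz M) (Th M y) K v \<and> E (b @ y)"
    have "df L U A m ?E"
    proof (intro df_ex df_conj)
      have "tm U A (m + ns M) (K * nz M) (\<lambda>w. v)" by (rule tm_const[OF v(1) tA[OF v(1)]])
      then show "df L U A (m + ns M) (\<lambda>w. none (nz M) (Th M (drop m w)) K v)"
        by (rule df_none[OF df_Th[OF M], rotated]) (rule tm_eq, (rule tm_intros)+, simp)
      show "df L U A (m + ns M) (\<lambda>w. E (take m w @ drop m w))"
        by (rule df_tm[OF E(1)], rule tm_eq, (rule tm_intros)+) simp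
    qed
    moreover have "?E b" using y E(2) by blast
    moreover have "entails (\<lambda>x. Q x b')" if b': "b' \<in> tu m" "?E b'" for b'
    proof -
      from b'(2) obtain y' where y': "y' \<in> tu (ns M)" "none (nz M) (Th M y') K v" "E (b' @ y')"
        by (elim bexE conjE)
      from E(3) tuples_append[OF b'(1) y'(1)] y'(3) have "entails (\<lambda>x. ?Q x (b' @ y'))" by blast
      moreover have "cut M K v y'" using M K v y' by (simp add: cut_def)
      ultimately have "entails (\<lambda>x. \<not> Xt M x y' \<and> ?Q x (b' @ y'))" using entails_conj[OF entails_cut] by blast
      then show ?thesis by (rule entails_mono) (use tuples_len[OF b'(1)] in simp)
    qed
    ultimately show ?thesis by (intro exI[of _ ?E]) simp
  qed
qed

definition gs_type :: "('f, 'r, 'u) pfm set" where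
  "gs_type = {\<theta> \<in> pforms L n (Dom U). entails (\<lambda>x. psat U x \<theta>)}"

lemma gs_type_partial_type: "partial_type L U n gs_type"
  unfolding partial_type_def
proof (intro conjI)
  show "gs_type \<subseteq> pforms L n (Dom U)" by (auto simp: gs_type_def)
  show "consistent U n gs_type"
    unfolding consistent_def
  proof (intro allI impI, elim conjE)
    fix F assume F: "finite F" "F \<subseteq> gs_type"
    have "entails (\<lambda>x. \<forall>\<theta>\<in>F. psat U x \<theta>)"
      by (rule entails_Ball[OF F(1)]) (use F(2) in \<open>auto simp: gs_type_def\<close>)
    from ultra_happens[OF PPu eventually_conj[OF PPt entails_PP[OF this]]]
    show "\<exists>as. realizes U n F as" unfolding realizes_def .
  qed
  show "generated L U n gs_type \<subseteq> gs_type"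
  proof
    fix \<theta> assume "\<theta> \<in> generated L U n gs_type"
    then obtain F where F: "finite F" "F \<subseteq> gs_type" "\<forall>as. realizes U n F as \<longrightarrow> psat U as \<theta>"
      and \<theta>: "\<theta> \<in> pforms L n (Dom U)" unfolding generated_def by auto
    have "entails (\<lambda>x. \<forall>\<theta>\<in>F. psat U x \<theta>)"
      by (rule entails_Ball[OF F(1)]) (use F(2) in \<open>auto simp: gs_type_def\<close>)
    then have "entails (\<lambda>x. psat U x \<theta>)" by (rule entails_mono) (use F(3) in \<open>simp add: realizes_def\<close>)
    with \<theta> show "\<theta> \<in> gs_type" by (simp add: gs_type_def)
  qed
qed

text \<open>The ultrafilter \<open>PP\<close> contains all formulas over \<open>A\<close> true at
  \<open>a\<close>, so it cannot also contain a formula over \<open>A\<close> that fails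
  there.\<close>

lemma gs_type_restr: "gs_type \<restriction>\<restriction> A \<subseteq> tp L U A a"
proof
  fix \<theta> assume "\<theta> \<in> gs_type \<restriction>\<restriction> A"
  then have \<theta>: "\<theta> \<in> pforms L n A" "entails (\<lambda>x. psat U x \<theta>)"
    by (auto simp: gs_type_def restr_def pforms_def)
  have "psat U a \<theta>"
  proof (rule ccontr)
    assume "\<not> psat U a \<theta>"
    from PPa[OF df_not[OF df_psat[OF \<theta>(1) A(1)]] this]
    have "\<not> (\<forall>\<^sub>F x in PP. psat U x \<theta>)" by (simp add: ultra_not[OF PPu])
    with entails_PP[OF \<theta>(2)] show False by (rule notE[rotated])
  qed
  with \<theta>(1) show "\<theta> \<in> tp L U A a" by (simp add: tp_def)
qed

lemma gs_type_Ind_definable: "Ind_definable L U n A gs_type"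
  unfolding Ind_definable_def
proof (intro allI ballI)
  fix m \<phi> assume \<phi>: "\<phi> \<in> forms L (n + m)"
  let ?S = "{b \<in> tu m. (\<phi>, b) \<in> gs_type}"
  \<comment> \<open>All definable sets inside \<open>?S\<close> are taken;
    \<open>entails_uniform\<close> puts each point of \<open>?S\<close> into one of them.\<close>
  let ?D = "{D. definable_over L U A m D \<and> D \<subseteq> ?S}"
  have "?S \<subseteq> \<Union>?D"
  proof
    fix b assume "b \<in> ?S"
    then have b: "b \<in> tu m" "(\<phi>, b) \<in> gs_type" by simp_all
    have pf: "(\<phi>, b') \<in> pforms L n (Dom U)" if "b' \<in> tu m" for b'
      using \<phi> that by (auto simp: pforms_def tuples_def)
    from b(2) have "entails (\<lambda>x. holds U \<phi> (x @ b))" by (simp add: gs_type_def psat_def)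
    then obtain S where S: "finite S" "\<forall>P\<in>S. basic P"
      "\<forall>x\<in>tu n. (\<forall>P\<in>S. P x) \<longrightarrow> holds U \<phi> (x @ b)" unfolding entails_def by (elim exE conjE)
    have "df2 L U A n m (\<lambda>x b. holds U \<phi> (x @ b))"
      unfolding df2_def append_take_drop_id by (rule df_form[OF \<phi>])
    from entails_uniform[OF S(1,2) this b(1) S(3)]
    obtain E where E: "df L U A m E" "E b" "\<forall>b'\<in>tu m. E b' \<longrightarrow> entails (\<lambda>x. holds U \<phi> (x @ b'))"
      by (elim exE conjE)
    from df_pform[OF E(1)] obtain \<theta> where \<theta>: "\<theta> \<in> pforms L m A" "\<forall>v\<in>tu m. E v \<longleftrightarrow> psat U v \<theta>"
      by (elim bexE conjE)
    let ?X = "{b \<in> tu m. psat U b \<theta>}"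
    have "definable_over L U A m ?X" unfolding definable_over_def using \<theta>(1) by blast
    moreover have "?X \<subseteq> ?S" using E(3) \<theta>(2) pf by (auto simp: gs_type_def psat_def)
    moreover have "b \<in> ?X" using b(1) E(2) \<theta>(2) by simp
    ultimately show "b \<in> \<Union>?D" by blast
  qed
  then have "?S = \<Union>?D" by blast
  then show "\<exists>\<D>. (\<forall>D\<in>\<D>. definable_over L U A m D) \<and> ?S = \<Union>\<D>"
    by (intro exI[of _ ?D]) simp
qed

section \<open>Morley sequences of the type and generic stability\<close>

definition morley :: "(nat \<Rightarrow> 'u list) \<Rightarrow> bool" where
  "morley e \<longleftrightarrow> (\<forall>i. e i \<in> tu n \<and> (\<forall>Q. df L U (A \<union> (\<Union>j<i. set (e j))) n Q \<longrightarrow> entails Q \<longrightarrow> Q (e i)))"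

lemma morleyD: "morley e \<Longrightarrow> df L U (A \<union> (\<Union>j<i. set (e j))) n Q \<Longrightarrow> entails Q \<Longrightarrow> Q (e i)"
  and morley_tu: "morley e \<Longrightarrow> e i \<in> tu n"
  unfolding morley_def by blast+

lemma morley_subseq:
  assumes e: "morley e" and g: "strict_mono g"
  shows "morley (e \<circ> g)"
  unfolding morley_def
proof (intro allI conjI impI)
  fix i show "(e \<circ> g) i \<in> tu n" using morley_tu[OF e] by simp
  fix Q assume Q: "df L U (A \<union> (\<Union>j<i. set ((e \<circ> g) j))) n Q" "entails Q"
  have "(\<Union>j<i. set ((e \<circ> g) j)) \<subseteq> (\<Union>j<g i. set (e j))"
    using g by (auto simp: strict_mono_def)
  then have "A \<union> (\<Union>j<i. set ((e \<circ> g) j)) \<subseteq> A \<union> (\<Union>j<g i. set (e j))" by blast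
  from morleyD[OF e df_mono[OF Q(1) this] Q(2)] show "Q ((e \<circ> g) i)" by simp
qed

text \<open>Validity lets \<open>t\<close> and a good \<open>z\<close> be chosen in
  \<open>A\<close>, and the induction hypothesis matches the earlier members so that the certificate
  holds. It turns the exclusion of \<open>Xt\<close> at the match into a cut formula, hence into a
  consequence that the next member must satisfy.\<close>

lemma morley_chain:
  assumes I: "df2 L U A n k I" and e: "morley e"
  shows "valid I k i mr Q r \<Longrightarrow> df L U A (i * k + mr) Q \<Longrightarrow> r \<in> tuples A mr \<Longrightarrow>
    \<exists>c\<in>tu (i * k). matches I k i e c \<and> Q (c @ r)"
proof (induction i arbitrary: mr Q r)
  case (Suc i)
  from Suc.prems(1) obtain M K where M: "is_node M" "nm M = i * k + mr"
    "nX M = (\<lambda>x v. \<not> (\<exists>z\<in>tu k. I x z \<and> Q (ins (i * k) z v)))" and K: "bnd M K"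
    and ev: "\<forall>\<^sub>F \<zeta> in cZ M K. valid I k i (mr + cz M K) (cert M K) (r @ \<zeta>)"
    unfolding valid.simps by (elim exE conjE)
  note r = Suc.prems(3)
  have T: "uf A (nt M) (nZ M)" and G: "uf A (nz M) (nG M)" and ga: "\<forall>\<^sub>F t in nZ M. ng M a t"
    and dg: "df2 L U A n (nt M) (ng M)" and dX: "df2 L U A n (nm M) (nX M)"
    using M(1) by (auto simp: is_node_def)
  from uf_happens[OF T eventually_conj[OF ga ev[unfolded eventually_fprod]]]
  obtain t where t: "t \<in> tuples A (nt M)" "ng M a t"
    "\<forall>\<^sub>F z in pw (nG M) K. valid I k i (mr + cz M K) (cert M K) (r @ t @ z)" by (elim bexE conjE)
  from uf_happens[OF uf_pw[OF G] eventually_conj[OF good_eventually[OF M(1) K] t(3)]]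
  obtain z where z: "z \<in> tuples A (K * nz M)" "good M K z"
    "valid I k i (mr + cz M K) (cert M K) (r @ t @ z)" by (elim bexE conjE)
  have "\<exists>c\<in>tu (i * k). matches I k i e c \<and> cert M K (c @ r @ t @ z)"
  proof (rule Suc.IH[OF z(3)])
    show "df L U A (i * k + (mr + cz M K)) (cert M K)"
      using df_cert[OF M(1), of K] by (simp add: M(2) add.assoc)
    show "r @ t @ z \<in> tuples A (mr + cz M K)"
      by (rule tuples_append[OF r tuples_append[OF t(1) z(1)]])
  qed
  then obtain c where c: "c \<in> tu (i * k)" "matches I k i e c" "cert M K (c @ r @ t @ z)" by (elim bexE conjE)
  have cr: "c @ r \<in> tu (nm M)" unfolding M(2) by (rule tuples_append[OF c(1) tA[OF r]])
  have crt: "(c @ r) @ t \<in> tu (ns M)" by (rule tuples_append[OF cr tA[OF t(1)]])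
  have "take (ns M) (((c @ r) @ t) @ z) = (c @ r) @ t" "drop (ns M) (((c @ r) @ t) @ z) = z"
    using tuples_len[OF crt] by (simp_all del: append_assoc)
  with c(3) have "none (nz M) (Th M ((c @ r) @ t)) K z"
    by (simp add: cert_def del: take_append drop_append)
  then have "cut M K z ((c @ r) @ t)" using M(1) K z(1,2) crt by (simp add: cut_def)
  from entails_cut[OF this] have 1: "entails (\<lambda>x. \<not> Xt M x ((c @ r) @ t))" .
  have "tm U A n (nt M) (\<lambda>x. t)" by (rule tm_const[OF t(1) tA[OF t(1)]])
  from entails_base[OF df2_tm[OF dg tm_id this] t(2)] have "entails (\<lambda>x. ng M x t)" .
  \<comment> \<open>Quantifying over \<open>c\<close> leaves only parameters from \<open>A\<close>
    and the earlier members, so that \<open>morleyD\<close> applies; the match found for the next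
    member may differ from \<open>c\<close>.\<close>
  from entails_conj[OF 1 this] have 2: "entails (\<lambda>x. \<exists>c\<in>tu (i * k). matches I k i e c \<and> \<not> nX M x (c @ r))"
  proof (rule entails_mono)
    fix x assume "\<not> Xt M x ((c @ r) @ t) \<and> ng M x t"
    then have "\<not> nX M x (c @ r)" unfolding Xt_def using tuples_len[OF cr] by auto
    with c(1,2) show "\<exists>c\<in>tu (i * k). matches I k i e c \<and> \<not> nX M x (c @ r)" by blast
  qed
  let ?B = "A \<union> (\<Union>j<i. set (e j))"
  have "df L U ?B n (\<lambda>x. \<exists>c\<in>tu (i * k). matches I k i e c \<and> \<not> nX M x (c @ r))"
  proof (intro df_ex df_conj df_not)
    have "df L U ?B (i * k) (matches I k i e)"
      by (rule df_matches[OF I]) (use morley_tu[OF e] in auto)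
    then show "df L U ?B (n + i * k) (\<lambda>w. matches I k i e (drop n w))"
      by (rule df_tm) (rule tm_eq, (rule tm_intros)+, simp)
    have "tm U ?B (n + i * k) mr (\<lambda>w. r)"
      by (rule tm_const) (use r A(1) in \<open>auto simp: tuples_def\<close>)
    then show "df L U ?B (n + i * k) (\<lambda>w. nX M (take n w) (drop n w @ r))"
      by (intro df2_tm[OF df2_mono[OF dX]]) (simp, (rule tm_eq, (assumption | rule tm_intros)+, simp add: M(2))+)
  qed
  from morleyD[OF e this 2] obtain c' where c': "c' \<in> tu (i * k)" "matches I k i e c'" "\<not> nX M (e i) (c' @ r)"
    by (elim bexE conjE)
  then obtain z' where z': "z' \<in> tu k" "I (e i) z'" "Q (c' @ z' @ r)"
    using ins_append[OF tuples_len[OF c'(1)]] by (auto simp: M(3))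
  have "matches I k (Suc i) e (c' @ z')"
    using c'(2) z'(2) by (simp add: matches_snoc[OF tuples_len[OF c'(1)] tuples_len[OF z'(1)]])
  moreover have "c' @ z' \<in> tu (Suc i * k)" using tuples_append[OF c'(1) z'(1)] by (simp add: add.commute)
  ultimately show ?case using z'(3) by (intro bexI[of _ "c' @ z'"]) simp_all
next
  case 0
  then show ?case by (simp add: matches_def)
qed

text \<open>Infinitely many members satisfying \<open>Xt M (e j) y\<close> form a Morley sequence
  again. Matching its first \<open>K\<close> members with blocks before \<open>v\<close> would make
  \<Theta> alternate \<open>K\<close> times.\<close>

lemma morley_cut:
  assumes e: "morley e" and c: "cut M K v y"
  shows "finite {j. Xt M (e j) y}"
proof (rule ccontr)
  let ?J = "{j. Xt M (e j) y}"
  assume inf: "infinite ?J"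
  have M: "is_node M" and K: "bnd M K" and v: "v \<in> tuples A (K * nz M)" "good M K v"
    and y: "y \<in> tu (ns M)" "none (nz M) (Th M y) K v" using c by (auto simp: cut_def)
  have I: "df2 L U A n (nz M) (nI M)" using M by (simp add: is_node_def)
  from infinite_enumerate[OF inf] obtain g :: "nat \<Rightarrow> nat" where g: "strict_mono g" "\<forall>i. g i \<in> ?J"
    by (elim exE conjE)
  note eg = morley_subseq[OF e g(1)]
  have "valid (nI M) (nz M) K (K * nz M) (no_alt2 M K) v" using v(2) by (simp add: good_def)
  from morley_chain[OF I eg this no_alt2(1)[OF M K] v(1)]
  obtain d where d: "d \<in> tu (K * nz M)" "matches (nI M) (nz M) K (e \<circ> g) d" "no_alt2 M K (d @ v)"
    by (elim bexE conjE)
  have "\<not> no_alt2 M K (d @ v)"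
    by (rule matches_Xt_alt2[OF d(2) _ d(1) y]) (use g(2) morley_tu[OF eg] in simp)
  with d(3) show False by (rule notE[rotated])
qed

lemma gs_type_generically_stable: "generically_stable L U n A gs_type"
  unfolding generically_stable_def
proof (intro conjI gs_type_partial_type gs_type_Ind_definable allI impI ballI)
  fix e :: "nat \<Rightarrow> 'u list" and \<theta>
  assume e: "\<forall>k. realizes U n (gs_type \<restriction>\<restriction> (A \<union> (\<Union>j<k. set (e j)))) (e k)" and \<theta>: "\<theta> \<in> gs_type"
  have et: "e k \<in> tu n" for k using e by (simp add: realizes_def)
  have "morley e"
    unfolding morley_def
  proof (intro allI conjI impI et)
    fix i Q
    let ?B = "A \<union> (\<Union>j<i. set (e j))"
    assume Q: "df L U ?B n Q" "entails Q"
    have B: "?B \<subseteq> Dom U" using A(1) et by (auto simp: tuples_def)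
    from df_pform[OF Q(1)] obtain \<eta> where \<eta>: "\<eta> \<in> pforms L n ?B" "\<forall>v\<in>tu n. Q v \<longleftrightarrow> psat U v \<eta>"
      by (elim bexE conjE)
    have "entails (\<lambda>x. psat U x \<eta>)" by (rule entails_mono[OF Q(2)]) (use \<eta>(2) in simp)
    moreover have "\<eta> \<in> pforms L n (Dom U)" using \<eta>(1) B by (auto simp: pforms_def)
    ultimately have "\<eta> \<in> gs_type \<restriction>\<restriction> ?B" using \<eta>(1) by (auto simp: gs_type_def restr_def pforms_def)
    with e have "psat U (e i) \<eta>" by (simp add: realizes_def)
    with \<eta>(2) et show "Q (e i)" by simp
  qed
  note m = this
  from \<theta> obtain S where S: "finite S" "\<forall>P\<in>S. basic P" "\<forall>x\<in>tu n. (\<forall>P\<in>S. P x) \<longrightarrow> psat U x \<theta>"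
    by (auto simp: gs_type_def entails_def)
  have "finite {k. \<not> P (e k)}" if "basic P" for P
    using that
  proof (cases rule: basic_cases)
    case 1
    have "P (e k)" for k by (rule morleyD[OF m df_mono[OF 1(1)] entails_base[OF 1]]) auto
    then show ?thesis by simp
  next
    case (2 M K v y)
    with morley_cut[OF m 2(1)] show ?thesis by simp
  qed
  then have "finite (\<Union>P\<in>S. {k. \<not> P (e k)})" using S(1,2) by blast
  moreover have "{k. \<not> psat U (e k) \<theta>} \<subseteq> (\<Union>P\<in>S. {k. \<not> P (e k)})" using S(3) et by blast
  ultimately show "finite {k. \<not> psat U (e k) \<theta>}" by (rule rev_finite_subset)
qed

section \<open>Transfer along types and saturation of the pair\<close>

lemma tp_df:
  assumes a': "realizes U n (tp L U B a) a'" and B: "B \<subseteq> Dom U" and Q: "df L U B n Q" "Q a"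
  shows "Q a'"
proof -
  from df_pform[OF Q(1)] obtain \<theta> where \<theta>: "\<theta> \<in> pforms L n B" "\<forall>v\<in>tu n. Q v \<longleftrightarrow> psat U v \<theta>"
    by (elim bexE conjE)
  with Q(2) a_tu have "\<theta> \<in> tp L U B a" by (simp add: tp_def)
  with a' \<theta>(2) show ?thesis by (simp add: realizes_def)
qed

text \<open>Such a formula is atomic for the pair: the relation symbol takes \<open>t\<close> and
  the parameters \<open>e\<close>, and since \<open>a\<close> comes last in its interpretation, the
  variables of \<phi> are permuted accordingly.\<close>

lemma pair_formula:
  assumes Y: "df2 L U A k n Y"
  shows "\<exists>\<theta>\<in>pforms (pair_lang L n) k A. \<forall>A'\<subseteq>Dom U. \<forall>t\<in>tuples A' k. psat (pair_struct U A' a) t \<theta> \<longleftrightarrow> Y t a"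
proof -
  obtain e \<phi> where e: "set e \<subseteq> A \<inter> Dom U" and \<phi>: "\<phi> \<in> forms L (k + n + length e)"
    "\<forall>v\<in>tu (k + n). Y (take k v) (drop k v) \<longleftrightarrow> holds U \<phi> (v @ e)"
    using df_parametrize[OF Y[unfolded df2_def]] by (elim exE conjE)
  let ?l = "k + length e"
  have "tm U {} (?l + n) (k + n + length e) (\<lambda>w. (take k w @ drop ?l w) @ drop k (take ?l w))"
    by (rule tm_eq, (rule tm_intros)+) simp
  from form_select[OF \<phi>(1) this] obtain \<psi> where \<psi>: "\<psi> \<in> forms L (?l + n)"
    "\<forall>w\<in>tu (?l + n). holds U \<psi> w \<longleftrightarrow> holds U \<phi> ((take k w @ drop ?l w) @ drop k (take ?l w))"
    by (elim bexE)
  let ?\<theta> = "(Rel (?l, \<psi>) (map Var [0..<?l]), e)"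
  show ?thesis
  proof (intro bexI[of _ ?\<theta>] allI impI ballI)
    show "?\<theta> \<in> pforms (pair_lang L n) k A"
      using e \<psi>(1) by (auto simp: pforms_def forms_def pair_lang_def)
    fix A' t assume A': "A' \<subseteq> Dom U" and t: "t \<in> tuples A' k"
    have tt: "t \<in> tu k" using t A' tuples_mono by blast
    have l: "length t = k" by (rule tuples_len[OF t])
    have et: "e \<in> tu (length e)" using e by (auto simp: tuples_def)
    have "psat (pair_struct U A' a) t ?\<theta> \<longleftrightarrow> holds U \<psi> (map ((!) (t @ e)) [0..<?l] @ a)"
      by (simp add: psat_def holds_def pair_struct_def comp_def del: upt_Suc)
    also have "map ((!) (t @ e)) [0..<?l] = t @ e"
      using map_nth[of "t @ e"] l by simp
    also have "holds U \<psi> ((t @ e) @ a) \<longleftrightarrow> holds U \<phi> ((t @ a) @ e)"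
      using \<psi>(2) tuples_append[OF tuples_append[OF tt et] a_tu] l by simp
    also have "\<dots> \<longleftrightarrow> Y t a" using \<phi>(2)[THEN bspec, OF tuples_append[OF tt a_tu]] l by simp
    finally show "psat (pair_struct U A' a) t ?\<theta> \<longleftrightarrow> Y t a" .
  qed
qed

text \<open>The formulas have parameters in \<open>A\<close>, of size below its successor cardinal,
  and finite parts are satisfied in \<open>A\<close> itself because \<open>Z\<close> concentrates
  there.\<close>

lemma pair_saturation:
  assumes A': "A \<subseteq> A'" "A' \<subseteq> Dom U" and st: "saturated (pair_lang L n) (cardSuc |A| ) (pair_struct U A' a)"
    and Z: "uf A k Z" and Y: "\<And>i. i \<in> J \<Longrightarrow> df2 L U A k n (Y i)" "\<And>i. i \<in> J \<Longrightarrow> \<forall>\<^sub>F t in Z. Y i t a"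
  shows "\<exists>t\<in>tuples A' k. \<forall>i\<in>J. Y i t a"
proof -
  let ?N = "pair_struct U A' a"
  have dN: "Dom ?N = A'" by (simp add: pair_struct_def)
  have "\<forall>i\<in>J. \<exists>\<theta>. \<theta> \<in> pforms (pair_lang L n) k A \<and> (\<forall>t\<in>tuples A' k. psat ?N t \<theta> \<longleftrightarrow> Y i t a)"
  proof
    fix i assume "i \<in> J"
    from pair_formula[OF Y(1)[OF this]] obtain \<theta> where \<theta>: "\<theta> \<in> pforms (pair_lang L n) k A"
      "\<forall>A'\<subseteq>Dom U. \<forall>t\<in>tuples A' k. psat (pair_struct U A' a) t \<theta> \<longleftrightarrow> Y i t a" by (elim bexE)
    with A'(2) show "\<exists>\<theta>. \<theta> \<in> pforms (pair_lang L n) k A \<and> (\<forall>t\<in>tuples A' k. psat ?N t \<theta> \<longleftrightarrow> Y i t a)"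
      by (intro exI[of _ \<theta>] conjI \<theta>(1)) simp
  qed
  from bchoice[OF this] obtain th where th: "\<forall>i\<in>J. th i \<in> pforms (pair_lang L n) k A \<and>
    (\<forall>t\<in>tuples A' k. psat ?N t (th i) \<longleftrightarrow> Y i t a)" ..
  have "consistent ?N k (th ` J)"
    unfolding consistent_def
  proof (intro allI impI, elim conjE)
    fix F assume "finite F" "F \<subseteq> th ` J"
    from finite_subset_image[OF this] obtain S where S: "S \<subseteq> J" "finite S" "F = th ` S" by (elim exE conjE)
    have "\<forall>\<^sub>F t in Z. \<forall>i\<in>S. Y i t a"
      by (rule eventually_ball_finite[OF S(2)]) (rule ballI, rule Y(2), rule subsetD[OF S(1)])
    from uf_happens[OF Z this] obtain t where t: "t \<in> tuples A k" "\<forall>i\<in>S. Y i t a" by (elim bexE)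
    have "t \<in> tuples A' k" using t(1) tuples_mono[OF A'(1)] by blast
    moreover have "psat ?N t (th i)" if "i \<in> S" for i
      using th[THEN bspec, of i] that S(1) t(2) \<open>t \<in> tuples A' k\<close> by auto
    ultimately have "realizes ?N k F t" unfolding realizes_def dN S(3) by simp
    then show "\<exists>t. realizes ?N k F t" ..
  qed
  moreover have "th ` J \<subseteq> pforms (pair_lang L n) k A" using th by blast
  moreover have "|A| <o cardSuc |A|" by (rule cardSuc_greater[OF card_of_Card_order])
  moreover have "A \<subseteq> Dom ?N" using A'(1) by (simp only: dN)
  ultimately obtain t where "realizes ?N k (th ` J) t" using saturatedD[OF st] by blast
  then have t: "t \<in> tuples A' k" "\<forall>i\<in>J. psat ?N t (th i)" by (simp_all add: realizes_def dN)
  have "Y i t a" if i: "i \<in> J" for i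
    using th[THEN bspec, OF i] t(2)[THEN bspec, OF i] t(1) by simp
  with t(1) show ?thesis by (intro bexI[of _ t] ballI)
qed

end

section \<open>Realizations of the product with a finitely satisfiable type\<close>

lemma global_type_Neg:
  assumes q: "global_type L U m q" and \<theta>: "\<theta> \<in> pforms L m (Dom U)" and nq: "\<theta> \<notin> q"
  shows "\<exists>\<eta>\<in>q. snd \<eta> = snd \<theta> \<and> (\<forall>t. psat U t \<eta> \<longleftrightarrow> \<not> psat U t \<theta>)"
proof -
  obtain \<phi> b where e: "\<theta> = (\<phi>, b)" by fastforce
  have "(Neg \<phi>, b) \<in> q" using q \<theta> nq unfolding global_type_def e by blast
  then show ?thesis by (rule bexI[rotated]) (simp add: e psat_def holds_def)
qed

text \<open>By completeness the conjunction of finitely many formulas of \<open>q\<close> belongs to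
  \<open>q\<close>, so it is satisfied in \<open>A\<close>; this is the finite intersection
  property.\<close>

lemma fin_satisfiable_ultrafilter:
  assumes q: "global_type L U m q" and fs: "fin_satisfiable_in U m A q" and A: "A \<subseteq> Dom U"
  shows "\<exists>E. uf A m E \<and> (\<forall>\<theta>\<in>q. \<forall>\<^sub>F t in E. psat U t \<theta>)"
proof -
  have con: "consistent U m q" and sub: "q \<subseteq> pforms L m (Dom U)"
    using q by (simp_all add: global_type_def)
  let ?F = "insert (\<lambda>t. t \<in> tuples A m) ((\<lambda>\<theta> t. psat U t \<theta>) ` q)"
  have "\<exists>E. ultra E \<and> (\<forall>P\<in>?F. eventually P E)"
  proof (rule ultra_of_fip)
    fix F assume F: "finite F" "F \<subseteq> ?F"
    let ?F1 = "F - {\<lambda>t. t \<in> tuples A m}"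
    have "finite ?F1" "?F1 \<subseteq> (\<lambda>\<theta> t. psat U t \<theta>) ` q" using F by auto
    from finite_subset_image[OF this] obtain S where S: "S \<subseteq> q" "finite S"
      "?F1 = (\<lambda>\<theta> t. psat U t \<theta>) ` S" by (elim exE conjE)
    from pforms_Conj_finite[OF S(2) subset_trans[OF S(1) sub]] obtain \<chi> where \<chi>: "\<chi> \<in> pforms L m (Dom U)"
      "\<And>t. t \<in> tuples (Dom U) m \<Longrightarrow> psat U t \<chi> \<longleftrightarrow> (\<forall>\<theta>\<in>S. psat U t \<theta>)" by blast
    have "\<chi> \<in> q"
    proof (rule ccontr)
      assume "\<chi> \<notin> q"
      from global_type_Neg[OF q \<chi>(1) this] obtain \<eta> where \<eta>: "\<eta> \<in> q" "\<forall>t. psat U t \<eta> \<longleftrightarrow> \<not> psat U t \<chi>"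
        by (elim bexE conjE)
      have "finite (insert \<eta> S) \<and> insert \<eta> S \<subseteq> q" using S(1,2) \<eta>(1) by simp
      with con obtain t where "realizes U m (insert \<eta> S) t" unfolding consistent_def by blast
      then have "t \<in> tuples (Dom U) m" "psat U t \<eta>" "\<forall>\<theta>\<in>S. psat U t \<theta>" by (auto simp: realizes_def)
      with \<chi>(2) \<eta>(2) show False by simp
    qed
    with fs obtain t where t: "t \<in> tuples A m" "psat U t \<chi>" unfolding fin_satisfiable_in_def by blast
    then have "\<forall>\<theta>\<in>S. psat U t \<theta>" using \<chi>(2) tuples_mono[OF A] by blast
    then have "\<forall>P\<in>?F1. P t" unfolding S(3) by simp
    have "P t" if "P \<in> F" for P
    proof (cases "P = (\<lambda>t. t \<in> tuples A m)")
      case False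
      with that have "P \<in> ?F1" by simp
      with \<open>\<forall>P\<in>?F1. P t\<close> show ?thesis by (rule bspec)
    qed (use t(1) in simp)
    then show "\<exists>t. \<forall>P\<in>F. P t" by (intro exI[of _ t] ballI)
  qed
  then obtain E where E: "ultra E" "\<forall>P\<in>?F. eventually P E" by (elim exE conjE)
  have "uf A m E" unfolding uf_def by (rule conjI[OF E(1)], rule bspec[OF E(2)]) simp
  moreover have "\<forall>\<^sub>F t in E. psat U t \<theta>" if "\<theta> \<in> q" for \<theta> by (rule bspec[OF E(2)]) (use that in simp)
  ultimately show ?thesis by (intro exI[of _ E]) simp
qed

context generic_setting
begin

lemma tensorI:
  assumes r: "realizes U (n + m) (tensor L U A n m gs_type q \<restriction>\<restriction> B) w" and B: "B \<subseteq> Dom U"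
    and g: "\<theta> \<in> tensor_generators L U A n m gs_type q" "\<theta> \<in> pforms L (n + m) B"
  shows "psat U w \<theta>"
proof -
  have "\<theta> \<in> pforms L (n + m) (Dom U)" using g(2) B by (auto simp: pforms_def)
  then have "\<theta> \<in> tensor L U A n m gs_type q"
    unfolding tensor_def generated_def using g(1) by (intro CollectI conjI exI[of _ "{\<theta>}"]) (simp_all add: realizes_def)
  then have "\<theta> \<in> tensor L U A n m gs_type q \<restriction>\<restriction> B" using g(2) by (auto simp: restr_def pforms_def)
  with r show ?thesis by (simp add: realizes_def)
qed

lemma tensor_q:
  assumes r: "realizes U (n + m) (tensor L U A n m gs_type q \<restriction>\<restriction> B) (x @ b)" and B: "B \<subseteq> Dom U"
    and q: "\<theta> \<in> q" "\<theta> \<in> pforms L m B" and x: "length x = n" and b: "length b = m"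
  shows "psat U b \<theta>"
proof -
  obtain \<psi> d where e: "\<theta> = (\<psi>, d)" by fastforce
  have inj: "inj ((+) n)" by (simp add: inj_def)
  have \<psi>: "\<psi> \<in> forms L (m + length d)" "set d \<subseteq> B" using q(2) by (auto simp: e pforms_def)
  have "psat U (x @ b) (shift n \<psi>, d)"
  proof (rule tensorI[OF r B])
    show "(shift n \<psi>, d) \<in> tensor_generators L U A n m gs_type q"
      unfolding tensor_generators_def using q(1) by (auto simp: e)
    show "(shift n \<psi>, d) \<in> pforms L (n + m) B"
      using \<psi> by (auto simp: pforms_def forms_def wf_fm_rename fv_rename[OF inj])
  qed
  then have "holds U (shift (length x) \<psi>) (x @ b @ d)" by (simp add: psat_def x)
  moreover have "\<psi> \<in> forms L (length (b @ d))" using \<psi>(1) b by simp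
  ultimately show ?thesis using holds_shift[of \<psi> L "b @ d" U x] by (simp add: psat_def e)
qed

text \<open>Here \<open>P\<close> plays the part of the formula d\<phi> and \<open>R\<close> that of
  \<phi> in a generator of the product. Both are first rewritten with the common parameter tuple
  \<open>?e\<close>.\<close>

lemma tensor_gs_type:
  assumes r: "realizes U (n + m) (tensor L U A n m gs_type q \<restriction>\<restriction> B) (x @ b)" and B: "A \<subseteq> B" "B \<subseteq> Dom U"
    and P: "df L U A (m + k) P" and R: "df2 L U A n (m + k) R"
    and PR: "\<And>w. w \<in> tu (m + k) \<Longrightarrow> P w \<Longrightarrow> entails (\<lambda>x. R x w)"
    and x: "x \<in> tu n" and b: "b \<in> tu m" and c: "c \<in> tuples B k" and Pbc: "P (b @ c)"
  shows "R x (b @ c)"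
proof -
  obtain d \<psi> where d: "set d \<subseteq> A \<inter> Dom U" and \<psi>: "\<psi> \<in> forms L (m + k + length d)"
    "\<forall>w\<in>tu (m + k). P w \<longleftrightarrow> holds U \<psi> (w @ d)" using df_parametrize[OF P] by (elim exE conjE)
  obtain d' \<phi> where d': "set d' \<subseteq> A \<inter> Dom U" and \<phi>: "\<phi> \<in> forms L (n + (m + k) + length d')"
    "\<forall>w\<in>tu (n + (m + k)). R (take n w) (drop n w) \<longleftrightarrow> holds U \<phi> (w @ d')"
    using df_parametrize[OF R[unfolded df2_def]] by (elim exE conjE)
  let ?e = "d @ d'"
  let ?N = "m + k + length ?e"
  have "tm U {} ?N (m + k + length d) (take (m + k + length d))"
    by (rule tm_eq, (rule tm_intros)+) simp
  from form_select[OF \<psi>(1) this] obtain \<psi>' where \<psi>': "\<psi>' \<in> forms L ?N"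
    "\<forall>w\<in>tu ?N. holds U \<psi>' w \<longleftrightarrow> holds U \<psi> (take (m + k + length d) w)" by (elim bexE)
  have "tm U {} (n + ?N) (n + (m + k) + length d')
      (\<lambda>w. take (n + (m + k)) w @ drop (n + (m + k) + length d) w)"
    by (rule tm_eq, (rule tm_intros)+) simp
  from form_select[OF \<phi>(1) this] obtain \<phi>' where \<phi>': "\<phi>' \<in> forms L (n + ?N)"
    "\<forall>w\<in>tu (n + ?N). holds U \<phi>' w \<longleftrightarrow>
       holds U \<phi> (take (n + (m + k)) w @ drop (n + (m + k) + length d) w)" by (elim bexE)
  have et: "?e \<in> tu (length ?e)" and eA: "set ?e \<subseteq> A" using d d' by (auto simp: tuples_def)
  have h1: "holds U \<psi>' (w @ ?e) \<longleftrightarrow> P w" if w: "w \<in> tu (m + k)" for w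
    using \<psi>'(2)[THEN bspec, OF tuples_append[OF w et]] \<psi>(2)[THEN bspec, OF w] tuples_len[OF w] by simp
  have h2: "holds U \<phi>' (x @ w @ ?e) \<longleftrightarrow> R x w" if x: "x \<in> tu n" and w: "w \<in> tu (m + k)" for x w
    using \<phi>'(2)[THEN bspec, OF tuples_append[OF x tuples_append[OF w et]]]
      \<phi>(2)[THEN bspec, OF tuples_append[OF x w]] tuples_len[OF w] tuples_len[OF x] by simp
  have ct: "c \<in> tu k" using c tuples_mono[OF B(2)] by blast
  have lc: "length c = k" by (rule tuples_len[OF c])
  have lb: "length b = m" by (rule tuples_len[OF b])
  have lx: "length x = n" by (rule tuples_len[OF x])
  have inj: "inj ((+) n)" by (simp add: inj_def)
  let ?\<theta> = "(Imp (shift n \<psi>') \<phi>', c @ ?e)"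
  have "psat U (x @ b) ?\<theta>"
  proof (rule tensorI[OF r B(2)])
    have pi: "(\<phi>', b' @ c' @ ?e) \<in> gs_type"
      if b': "b' \<in> tu m" and c': "c' \<in> tu k" and h: "holds U \<psi>' (b' @ c' @ ?e)" for b' c'
    proof -
      have w: "b' @ c' \<in> tu (m + k)" by (rule tuples_append[OF b' c'])
      have "P (b' @ c')" using h1[OF w] h by simp
      from PR[OF w this] have "entails (\<lambda>x. psat U x (\<phi>', b' @ c' @ ?e))"
        by (rule entails_mono) (use h2[OF _ w] in \<open>simp add: psat_def\<close>)
      moreover have "(\<phi>', b' @ c' @ ?e) \<in> pforms L n (Dom U)"
        using \<phi>'(1) b' c' et by (auto simp: pforms_def tuples_def add.assoc)
      ultimately show ?thesis by (simp add: gs_type_def)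
    qed
    show "?\<theta> \<in> tensor_generators L U A n m gs_type q"
      unfolding tensor_generators_def
    proof (intro UnI2 CollectI exI conjI)
      show "?\<theta> = (Imp (shift n \<psi>') \<phi>', c @ ?e)" ..
      show "set c \<subseteq> Dom U" using ct by (simp add: tuples_def)
      show "set ?e \<subseteq> A" by (rule eA)
      show "\<phi>' \<in> forms L (n + m + length c + length ?e)" using \<phi>'(1) by (simp add: lc add.assoc)
      show "\<psi>' \<in> forms L (m + length c + length ?e)" using \<psi>'(1) by (simp only: lc)
      show "\<forall>b\<in>tu m. \<forall>c'\<in>tu (length c). holds U \<psi>' (b @ c' @ ?e) \<longrightarrow> (\<phi>', b @ c' @ ?e) \<in> gs_type"
        unfolding lc using pi by blast
    qed
    show "?\<theta> \<in> pforms L (n + m) B"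
      using \<psi>'(1) \<phi>'(1) eA B(1) c lc
      by (auto simp: pforms_def forms_def wf_fm_rename fv_rename[OF inj] tuples_def add.assoc)
  qed
  then have imp: "holds U (shift (length x) \<psi>') (x @ b @ c @ ?e) \<Longrightarrow> holds U \<phi>' (x @ b @ c @ ?e)"
    by (simp add: psat_def holds_def lx)
  have "\<psi>' \<in> forms L (length (b @ c @ ?e))" using \<psi>'(1) lb lc by (simp add: add.assoc)
  from holds_shift[OF this, of U x] have "holds U (shift (length x) \<psi>') (x @ b @ c @ ?e)"
    using h1[OF tuples_append[OF b ct]] Pbc by simp
  from imp[OF this] show ?thesis using h2[OF x tuples_append[OF b ct]] by simp
qed

text \<open>For each formula \<theta> of the target type, a node is built for its negation and the
  ultrafilter of \<open>q\<close>. A suitable \<open>t\<close> in \<open>A'\<close> makes the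
  product exclude \<open>X\<close> and \<open>g\<close> together, and the type over
  \<open>A'\<close> supplies \<open>g\<close>, so \<theta> holds.\<close>

lemma tensor_commutes:
  assumes A': "A \<subseteq> A'" "A' \<subseteq> Dom U" and st: "saturated (pair_lang L n) (cardSuc |A| ) (pair_struct U A' a)"
    and q: "global_type L U m q" "fin_satisfiable_in U m A q"
    and a': "realizes U n (tp L U A' a) a'" and b: "b \<in> tu m"
    and r: "realizes U (n + m) (tensor L U A n m gs_type q \<restriction>\<restriction> A') (a' @ b)"
  shows "realizes U (m + n) (tensor_over L U A m n q (tp L U A a)) (b @ a')"
  unfolding realizes_def
proof (intro conjI ballI)
  have a't: "a' \<in> tu n" using a' by (simp add: realizes_def)
  show "b @ a' \<in> tu (m + n)" by (rule tuples_append[OF b a't])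
  fix \<theta> assume "\<theta> \<in> tensor_over L U A m n q (tp L U A a)"
  then obtain a1 b1 where \<theta>1: "\<theta> \<in> tp L U A (b1 @ a1)" and a1: "realizes U n (tp L U A a) a1"
    and b1: "realizes U m (q \<restriction>\<restriction> (A \<union> set a1)) b1" unfolding tensor_over_def by auto
  have a1t: "a1 \<in> tu n" and b1t: "b1 \<in> tu m" using a1 b1 by (simp_all add: realizes_def)
  have \<theta>: "\<theta> \<in> pforms L (m + n) A" and sat1: "psat U (b1 @ a1) \<theta>"
    using \<theta>1 tuples_len[OF a1t] tuples_len[OF b1t] by (simp_all add: tp_def)
  have d\<theta>: "df L U A (m + n) (\<lambda>v. psat U v \<theta>)" by (rule df_psat[OF \<theta> A(1)])
  obtain E where E: "uf A m E" "\<And>\<eta>. \<eta> \<in> q \<Longrightarrow> \<forall>\<^sub>F t in E. psat U t \<eta>"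
    using fin_satisfiable_ultrafilter[OF q A(1)] by blast
  define X where "X x t \<longleftrightarrow> \<not> psat U (t @ x) \<theta>" for x t
  have X: "df2 L U A n m X"
    unfolding df2_def X_def
    by (intro df_not, rule df_tm[OF d\<theta>]; rule tm_eq, (rule tm_intros)+; simp)
  have q_mem: "\<eta> \<in> q" if \<eta>: "\<eta> \<in> pforms L m (Dom U)" "\<forall>\<^sub>F t in E. psat U t \<eta>" for \<eta>
  proof (rule ccontr)
    assume "\<eta> \<notin> q"
    from global_type_Neg[OF q(1) \<eta>(1) this] obtain \<eta>' where "\<eta>' \<in> q" "\<forall>t. psat U t \<eta>' \<longleftrightarrow> \<not> psat U t \<eta>"
      by (elim bexE conjE)
    with E(2)[of \<eta>'] have "\<not> (\<forall>\<^sub>F t in E. psat U t \<eta>)" by (simp add: ultra_not[OF uf_ultra[OF E(1)]])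
    with \<eta>(2) show False by (rule notE[rotated])
  qed
  \<comment> \<open>Otherwise the negation of \<theta>, with \<open>a1\<close> as parameter, would
    belong to \<open>q\<close> and be satisfied by \<open>b1\<close>.\<close>
  have "\<forall>\<^sub>F t in E. psat U (t @ a1) \<theta>"
  proof (rule ccontr)
    assume "\<not> ?thesis"
    then have ev: "\<forall>\<^sub>F t in E. \<not> psat U (t @ a1) \<theta>" by (simp add: ultra_not[OF uf_ultra[OF E(1)]])
    let ?B = "A \<union> set a1"
    have B: "?B \<subseteq> Dom U" using A(1) a1t by (auto simp: tuples_def)
    have "tm U ?B m n (\<lambda>t. a1)" by (rule tm_const) (use a1t in \<open>auto simp: tuples_def\<close>)
    from tm_append[OF tm_id this] have "df L U ?B m (\<lambda>t. \<not> psat U (t @ a1) \<theta>)"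
      by (intro df_not df_tm[OF df_mono[OF d\<theta>]]) auto
    from df_pform[OF this] obtain \<eta> where \<eta>: "\<eta> \<in> pforms L m ?B"
      "\<forall>t\<in>tu m. \<not> psat U (t @ a1) \<theta> \<longleftrightarrow> psat U t \<eta>" by (elim bexE conjE)
    from uf_tuples[OF E(1)] ev have "\<forall>\<^sub>F t in E. psat U t \<eta>"
      by eventually_elim (use \<eta>(2) tA in blast)
    then have "\<eta> \<in> q" by (rule q_mem[rotated]) (use \<eta>(1) B in \<open>auto simp: pforms_def\<close>)
    then have "\<eta> \<in> q \<restriction>\<restriction> ?B" using \<eta>(1) by (auto simp: restr_def pforms_def)
    with b1 have "psat U b1 \<eta>" by (simp add: realizes_def)
    with \<eta>(2)[THEN bspec, OF b1t] sat1 show False by simp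
  qed
  with uf_tuples[OF E(1)] have "\<forall>\<^sub>F t in E. \<not> X a t"
  proof eventually_elim
    case (elim t)
    have "tm U A n m (\<lambda>x. t)" by (rule tm_const[OF elim(1) tA[OF elim(1)]])
    from df2_tm[OF X tm_id this] have "df L U A n (\<lambda>x. X x t)" .
    from tp_df[OF a1 A(1) this] elim(2) show ?case by (auto simp: X_def)
  qed
  from node_exists[OF E(1) X this] obtain M where M: "is_node M" "nm M = m" "nX M = X" "nE M = E"
    by (elim exE conjE)
  obtain K where K: "bnd M K" using bnd_exists[OF M(1)] ..
  have Z: "uf A (nt M) (nZ M)" and G: "uf A (nz M) (nG M)" and ga: "\<forall>\<^sub>F t in nZ M. ng M a t"
    and dg: "df2 L U A n (nt M) (ng M)"
    and generic_over: "\<forall>\<^sub>F z in nG M. \<forall>\<^sub>F b in nE M. \<forall>\<^sub>F t in nZ M. \<not> Th M (b @ t) z"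
    using M(1) by (auto simp: is_node_def)
  have "\<forall>\<^sub>F z in nG M. \<not> \<not> (\<forall>\<^sub>F w in E \<otimes>f nZ M. \<not> Th M w z)"
    using generic_over by (simp add: M(4) eventually_fprod)
  \<comment> \<open>This uses the order of choice in which \<open>z\<close> comes first:
    \<open>v\<close> is fixed in \<open>A\<close>, good, and free of \<Theta> for generic
    \<open>b\<close> and \<open>t\<close>.\<close>
  from uf_happens[OF uf_pw[OF G] eventually_conj[OF good_eventually[OF M(1) K] none_eventually[OF G this]]]
  obtain v where v: "v \<in> tuples A (K * nz M)" "good M K v"
    "none (nz M) (\<lambda>z. \<not> (\<forall>\<^sub>F w in E \<otimes>f nZ M. \<not> Th M w z)) K v" by (elim bexE conjE)
  define \<chi> where "\<chi> w \<longleftrightarrow> none (nz M) (Th M w) K v" for w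
  from none_swap[OF uf_fprod[OF E(1) Z] v(3)]
  have \<chi>E: "\<forall>\<^sub>F b in E. \<forall>\<^sub>F t in nZ M. \<chi> (b @ t)" by (simp add: \<chi>_def eventually_fprod)
  have "tm U A (ns M) (K * nz M) (\<lambda>w. v)" by (rule tm_const[OF v(1) tA[OF v(1)]])
  from df_none[OF df_Th[OF M(1)] tm_id this] have d\<chi>: "df L U A (m + nt M) \<chi>"
    unfolding \<chi>_def[abs_def] M(2) .
  \<comment> \<open>The index \<open>None\<close> asks for \<open>ng M a t\<close>. The index
    \<open>Some b\<close> asks for \<chi> at \<open>b @ t\<close>, for every \<open>b\<close> in
    \<open>A\<close> for which this holds with generic \<open>t\<close>.\<close>
  let ?J = "insert None (Some ` {b \<in> tuples A m. \<forall>\<^sub>F t in nZ M. \<chi> (b @ t)})"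
  let ?Y = "\<lambda>j t x. case j of None \<Rightarrow> ng M x t | Some b \<Rightarrow> \<chi> (b @ t)"
  have "\<exists>t\<in>tuples A' (nt M). \<forall>j\<in>?J. ?Y j t a"
  proof (rule pair_saturation[OF A' st Z])
    fix j assume "j \<in> ?J"
    then consider "j = None" | b where "j = Some b" "b \<in> tuples A m" "\<forall>\<^sub>F t in nZ M. \<chi> (b @ t)" by auto
    then show "df2 L U A (nt M) n (?Y j)"
    proof cases
      case 1
      show ?thesis unfolding 1 option.case df2_def
        by (rule df2_tm[OF dg]; rule tm_eq, (rule tm_intros)+; simp)
    next
      case (2 b)
      have "tm U A (nt M + n) m (\<lambda>w. b)" by (rule tm_const[OF 2(2) tA[OF 2(2)]])
      then show ?thesis unfolding 2(1) option.case df2_def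
        by (intro df_tm[OF d\<chi>]) (rule tm_eq, (assumption | rule tm_intros)+, simp)
    qed
  next
    fix j assume "j \<in> ?J"
    then show "\<forall>\<^sub>F t in nZ M. ?Y j t a" using ga by auto
  qed
  then obtain t where t: "t \<in> tuples A' (nt M)" "\<forall>j\<in>?J. ?Y j t a" by (elim bexE)
  have tt: "t \<in> tu (nt M)" using t(1) tuples_mono[OF A'(2)] by blast
  have ngt: "ng M a t" using t(2) by simp
  have \<chi>t: "\<chi> (b0 @ t)" if "b0 \<in> tuples A m" "\<forall>\<^sub>F t in nZ M. \<chi> (b0 @ t)" for b0
    using t(2) that by simp
  \<comment> \<open>By the choice of \<open>t\<close>, the formula \<chi>(y, t) holds for generic
    \<open>y\<close> in \<open>A\<close>; it is over \<open>A'\<close> and so belongs to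
    \<open>q\<close>, which \<open>b\<close> realizes over \<open>A'\<close>.\<close>
  have \<chi>b: "\<chi> (b @ t)"
  proof -
    have "tm U A' m (nt M) (\<lambda>y. t)" by (rule tm_const[OF t(1) tt])
    from df_tm[OF df_mono[OF d\<chi> A'(1)] tm_append[OF tm_id this]] have "df L U A' m (\<lambda>y. \<chi> (y @ t))" .
    from df_pform[OF this] obtain \<eta> where \<eta>: "\<eta> \<in> pforms L m A'" "\<forall>y\<in>tu m. \<chi> (y @ t) \<longleftrightarrow> psat U y \<eta>"
      by (elim bexE conjE)
    have "\<forall>\<^sub>F y in E. psat U y \<eta>"
      using uf_tuples[OF E(1)] \<chi>E
    proof eventually_elim
      case (elim y)
      from \<chi>t[OF elim] \<eta>(2) tA[OF elim(1)] show ?case by blast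
    qed
    then have "\<eta> \<in> q" by (rule q_mem[rotated]) (use \<eta>(1) A'(2) in \<open>auto simp: pforms_def\<close>)
    from tensor_q[OF r A'(2) this \<eta>(1) tuples_len[OF a't] tuples_len[OF b]] \<eta>(2) b show ?thesis by blast
  qed
  have "\<not> Xt M a' (b @ t)"
  proof (rule tensor_gs_type[OF r A' d\<chi> _ _ a't b t(1) \<chi>b])
    show "df2 L U A n (m + nt M) (\<lambda>x w. \<not> Xt M x w)"
      using df_not[OF df_Xt[OF M(1), unfolded df2_def]] by (simp add: df2_def M(2))
    fix w assume "w \<in> tu (m + nt M)" "\<chi> w"
    then have "cut M K v w" using M(1,2) K v(1,2) by (simp add: cut_def \<chi>_def)
    then show "entails (\<lambda>x. \<not> Xt M x w)" by (rule entails_cut)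
  qed
  moreover have "ng M a' t"
  proof -
    have "tm U A' n (nt M) (\<lambda>x. t)" by (rule tm_const[OF t(1) tt])
    then have "df L U A' n (\<lambda>x. ng M x t)" by (rule df2_tm[OF df2_mono[OF dg A'(1)] tm_id])
    from tp_df[OF a' A'(2) this ngt] show ?thesis .
  qed
  ultimately have "\<not> X a' b" using tuples_len[OF b] by (auto simp: Xt_def M(2,3))
  then show "psat U (b @ a') \<theta>" by (simp add: X_def)
qed

end

theorem theorem4p1:
  fixes L :: "('f, 'r) lang" and T :: "('f, 'r) fm set" and \<kappa> :: "'k rel"
    and U :: "('f, 'r, 'u) struct" and A :: "'u set" and a :: "'u list"
    and p :: "('f, 'r, 'u) pfm set"
  assumes T: "complete_theory L T" and U: "monster L T \<kappa> U" and NIP: "NIP L U"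
    and A: "A \<subseteq> Dom U" "|A| <o \<kappa>"
    and a: "set a \<subseteq> Dom U" and p: "p = tp L U A a"
  shows "\<exists>\<pi>. generically_stable L U (length a) A \<pi> \<and> \<pi> \<restriction>\<restriction> A \<subseteq> p \<and>
    (\<forall>A' m q.
       A' \<subseteq> Dom U \<and> |A'| <o \<kappa> \<and>
       elementary_extension (pair_lang L (length a)) (pair_struct U A a) (pair_struct U A' a) \<and>
       saturated (pair_lang L (length a)) (cardSuc |A| ) (pair_struct U A' a) \<and>
       global_type L U m q \<and> fin_satisfiable_in U m A q \<longrightarrow>
       (\<forall>a' b. realizes U (length a) (tp L U A' a) a' \<and> b \<in> tuples (Dom U) m \<and>
          realizes U (length a + m) (tensor L U A (length a) m \<pi> q \<restriction>\<restriction> A') (a' @ b) \<longrightarrow>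
          realizes U (m + length a) (tensor_over L U A m (length a) q p) (b @ a')))"
proof -
  interpret type_setting L U \<kappa> A a
    by unfold_locales (use U NIP A a in \<open>simp_all add: monster_def\<close>)
  obtain PP where PP: "ultra PP" "\<forall>\<^sub>F x in PP. x \<in> tu n"
    "\<forall>Q. df L U A n Q \<longrightarrow> Q a \<longrightarrow> (\<forall>\<^sub>F x in PP. Q x)" "\<forall>v. is_condition v \<longrightarrow> (\<forall>\<^sub>F x in PP. meets x v)"
    using exists_generic_ultrafilter by (elim exE conjE)
  \<comment> \<open>The ultrafilter \<open>PP\<close> is fixed before \<open>A'\<close>,
    \<open>m\<close> and \<open>q\<close>, so the same \<open>gs_type\<close> serves for all of
    them.\<close>
  interpret generic_setting L U \<kappa> A a PP
    by unfold_locales (use PP in blast)+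
  show ?thesis
  proof (intro exI[of _ gs_type] conjI gs_type_generically_stable allI impI; (elim conjE)?)
    show "gs_type \<restriction>\<restriction> A \<subseteq> p" unfolding p by (rule gs_type_restr)
    fix A' m q a' b
    assume "A' \<subseteq> Dom U"
      and ext: "elementary_extension (pair_lang L n) (pair_struct U A a) (pair_struct U A' a)"
      and "saturated (pair_lang L n) (cardSuc |A| ) (pair_struct U A' a)"
      "global_type L U m q" "fin_satisfiable_in U m A q" "realizes U n (tp L U A' a) a'" "b \<in> tu m"
      "realizes U (n + m) (tensor L U A n m gs_type q \<restriction>\<restriction> A') (a' @ b)"
    moreover have "A \<subseteq> A'" using ext by (simp add: elementary_extension_def pair_struct_def)
    ultimately show "realizes U (m + n) (tensor_over L U A m n q p) (b @ a')"
      unfolding p by (intro tensor_commutes)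
  qed
qed

end
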